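(* Suppose that for all compact $J\subset I$, $K\subset X$ there exist $C,r>0$ such that $$\Big|\log\frac{d_s(x,y)}{d_{s'}(x,y)}\Big|\le C|s-s'|\quad\text{for } s,s'\in J,\ x,y\in K \text{ (distinct) with } \inf_{s\in J}d_s(x,y)<r,$$ that for all compact $J\subset I$, $K\subset X$ there exists $C'>0$ such that $$|h(s,x)-h(s',x)|\le C'|s-s'|,\quad s,s'\in J,\ x\in K,$$ and moreover that $$\int_0^\infty\frac{v_\beta(\alpha_t,t)}{h(\alpha_t,\beta_t)}\,\mathrm dt=\infty$$ whenever $\beta:[0,\infty)\to X$ is a locally absolutely continuous curve tending to infinity and $\alpha:[0,\infty)\to I$ is locally absolutely continuous. Then $hI\times_{\mathcal F}X$ is globally hyperbolic.
   Context: Setting. $X$ is a locally compact topological space, $I\subset\mathbb R$ an open interval, $h:I\times X\to(0,\infty)$ continuous, and $\mathcal F=\{d_s\}_{s\in I}$ a family of metrics on $X$ whose induced length metrics generate the topology of $X$. Under the log-Lipschitz condition in the claim, absolute continuity of a curve $\beta$ in $X$ does not depend on the chosen metric in $\mathcal F$. A locally absolutely continuous curve $\beta:[0,\infty)\to X$ tends to infinity if for every compact $K\subset X$ there is $T>0$ with $K\cap\beta([T,\infty))=\varnothing$. For an absolutely continuous curve $\beta$ in $X$ let $|\beta_t'|_{d_s}$ be its metric speed with respect to $d_s$, and define the generalized metric speed $v_\beta(s,t)=\limsup_{\delta\to0}\frac1\delta\int_t^{t+\delta}|\beta_u'|_{d_s}\,\mathrm du$. An absolutely continuous curve $\gamma=(\alpha,\beta):[a,b]\to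 I\times X$ is future (past) directed if $\alpha'>0$ ($\alpha'<0$) a.e.; a future or past directed curve is causal if $v_\beta(\alpha_t,t)^2\le h(\gamma_t)^2\alpha'(t)^2$ a.e. and timelike if $v_\beta(\alpha_t,t)^2<h(\gamma_t)^2\alpha'(t)^2$ a.e. Its Lorentzian length, if causal, is $\tau(\gamma)=\int_a^b\sqrt{h(\gamma_t)^2\alpha'(t)^2-v_\beta(\alpha_t,t)^2}\,\mathrm dt$. Write $p\le q$ (resp. $p\ll q$) if there is a future directed causal (resp. timelike) curve from $p$ to $q$ ($\le$ is a preorder, so $p\le p$ always), and $\tau(p,q)=\sup\tau(\gamma)$ over future directed causal curves $\gamma$ from $p$ to $q$, with $\sup\varnothing=0$. $hI\times_{\mathcal F}X$ denotes $I\times X$ (with the product topology) together with $\le,\ll,\tau$. Global hyperbolicity. For a causal curve $\gamma:[a,b]\to Y$ in $Y=hI\times_{\mathcal F}X$ (i.e. $\gamma_t\le\gamma_s$ for $a\le t<s\le b$) put $L_\tau(\gamma)=\inf\{\sum_{i=1}^N\tau(\gamma_{t_{i-1}},\gamma_{t_i}):a=t_0<\dots<t_N=b\}$. $Y$ is totally non-imprisoning if for any compact $K\subset Y$ there is $C$ such that $L_\tau(\gamma)\le C$ for any causal curve $\gamma$ in $K$. $Y$ is globally hyperbolic if it is totally non-imprisoning and all causal diamonds $J(p,q)=\{z\in Y:p\le z\le q\}$, $p,q\in Y$, are compact. *)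

theory Defs
  imports "HOL-Analysis.Analysis"
begin

text \<open>
  Distance functions are passed explicitly as \<^term>\<open>D :: 'a \<Rightarrow> 'a \<Rightarrow> real\<close>, since a whole family
  of metrics lives on one space. The induced length metric is extended: points that are not
  joined by a rectifiable curve are at distance \<^term>\<open>\<infinity> :: ennreal\<close>.
\<close>

definition partition_points :: "real \<Rightarrow> real \<Rightarrow> nat \<Rightarrow> (nat \<Rightarrow> real) \<Rightarrow> bool" where
  "partition_points a b N t \<longleftrightarrow> t 0 = a \<and> t N = b \<and> (\<forall>i<N. t i < t (Suc i))"

definition curve_length :: "('a \<Rightarrow> 'a \<Rightarrow> real) \<Rightarrow> real \<Rightarrow> real \<Rightarrow> (real \<Rightarrow> 'a) \<Rightarrow> ennreal" where
  "curve_length D a b c =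
     Sup {\<Sum>i<N. ennreal (D (c (t i)) (c (t (Suc i)))) | N t. partition_points a b N t}"

definition length_metric :: "('a \<Rightarrow> 'a \<Rightarrow> real) \<Rightarrow> 'a \<Rightarrow> 'a \<Rightarrow> ennreal" where
  "length_metric D x y =
     Inf {curve_length D 0 1 c | c.
            continuous_map (top_of_set {0..1}) (Metric_space.mtopology UNIV D) c \<and>
            c 0 = x \<and> c 1 = y}"

definition generates_topology :: "('a::topological_space \<Rightarrow> 'a \<Rightarrow> ennreal) \<Rightarrow> bool" where
  "generates_topology L \<longleftrightarrow>
     (\<forall>U. open U \<longleftrightarrow> (\<forall>x\<in>U. \<exists>e>0. {y. L x y < e} \<subseteq> U))"

definition abs_cont :: "('a \<Rightarrow> 'a \<Rightarrow> real) \<Rightarrow> real \<Rightarrow> real \<Rightarrow> (real \<Rightarrow> 'a) \<Rightarrow> bool" where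
  "abs_cont D a b c \<longleftrightarrow>
     (\<exists>g :: real \<Rightarrow> real. set_integrable lebesgue {a..b} g \<and>
        (\<forall>s t. a \<le> s \<and> s \<le> t \<and> t \<le> b \<longrightarrow> D (c s) (c t) \<le> (LINT u:{s..t}|lebesgue. g u)))"

text \<open>Absolute continuity with respect to a family of metrics means absolute continuity with
  respect to each of them; for a log-Lipschitz family this is the same as for one of them.\<close>

definition abs_cont_family ::
  "real set \<Rightarrow> (real \<Rightarrow> 'a \<Rightarrow> 'a \<Rightarrow> real) \<Rightarrow> real \<Rightarrow> real \<Rightarrow> (real \<Rightarrow> 'a) \<Rightarrow> bool" where
  "abs_cont_family I d a b \<beta> \<longleftrightarrow> (\<forall>s\<in>I. abs_cont (d s) a b \<beta>)"

definition tends_to_infinity :: "(real \<Rightarrow> 'a::topological_space) \<Rightarrow> bool" where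
  "tends_to_infinity \<beta> \<longleftrightarrow> (\<forall>K. compact K \<longrightarrow> (\<exists>T>0. K \<inter> \<beta> ` {T..} = {}))"

text \<open>Curves are total functions on the reals that matter only on their parameter interval.
  The speeds below are two-sided limits, so at the end points of that interval they may depend
  on values outside it; they are only ever used up to null sets. Likewise the limit in the metric
  speed of an absolutely continuous curve exists only almost everywhere, which suffices for the
  integral in the generalized metric speed. The interval integral is oriented.\<close>

definition metric_speed :: "('a \<Rightarrow> 'a \<Rightarrow> real) \<Rightarrow> (real \<Rightarrow> 'a) \<Rightarrow> real \<Rightarrow> real" where
  "metric_speed D \<beta> u = Lim (at 0) (\<lambda>\<delta>. D (\<beta> (u + \<delta>)) (\<beta> u) / \<bar>\<delta>\<bar>)"

definition gen_speed ::
  "(real \<Rightarrow> 'a \<Rightarrow> 'a \<Rightarrow> real) \<Rightarrow> (real \<Rightarrow> 'a) \<Rightarrow> real \<Rightarrow> real \<Rightarrow> ereal" where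
  "gen_speed d \<beta> s t =
     Limsup (at 0) (\<lambda>\<delta>. ereal
       (1 / \<delta> * interval_lebesgue_integral lebesgue (ereal t) (ereal (t + \<delta>)) (metric_speed (d s) \<beta>)))"

definition future_causal_curve ::
  "real set \<Rightarrow> (real \<Rightarrow> 'a \<Rightarrow> real) \<Rightarrow> (real \<Rightarrow> 'a \<Rightarrow> 'a \<Rightarrow> real) \<Rightarrow>
   real \<Rightarrow> real \<Rightarrow> (real \<Rightarrow> real) \<Rightarrow> (real \<Rightarrow> 'a) \<Rightarrow> bool" where
  "future_causal_curve I h d a b \<alpha> \<beta> \<longleftrightarrow>
     a < b \<and> \<alpha> ` {a..b} \<subseteq> I \<and> abs_cont dist a b \<alpha> \<and> abs_cont_family I d a b \<beta> \<and>
     (AE t in lebesgue. t \<in> {a..b} \<longrightarrow> 0 < deriv \<alpha> t) \<and>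
     (AE t in lebesgue. t \<in> {a..b} \<longrightarrow>
        (gen_speed d \<beta> (\<alpha> t) t)\<^sup>2 \<le> ereal ((h (\<alpha> t) (\<beta> t))\<^sup>2 * (deriv \<alpha> t)\<^sup>2))"

definition lorentz_length ::
  "(real \<Rightarrow> 'a \<Rightarrow> real) \<Rightarrow> (real \<Rightarrow> 'a \<Rightarrow> 'a \<Rightarrow> real) \<Rightarrow>
   real \<Rightarrow> real \<Rightarrow> (real \<Rightarrow> real) \<Rightarrow> (real \<Rightarrow> 'a) \<Rightarrow> ennreal" where
  "lorentz_length h d a b \<alpha> \<beta> =
     (\<integral>\<^sup>+t\<in>{a..b}. ennreal (sqrt ((h (\<alpha> t) (\<beta> t))\<^sup>2 * (deriv \<alpha> t)\<^sup>2
                              - (real_of_ereal (gen_speed d \<beta> (\<alpha> t) t))\<^sup>2)) \<partial>lebesgue)"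

definition cone_le ::
  "real set \<Rightarrow> (real \<Rightarrow> 'a \<Rightarrow> real) \<Rightarrow> (real \<Rightarrow> 'a \<Rightarrow> 'a \<Rightarrow> real) \<Rightarrow>
   real \<times> 'a \<Rightarrow> real \<times> 'a \<Rightarrow> bool" where
  "cone_le I h d p q \<longleftrightarrow>
     (fst p \<in> I \<and> p = q) \<or>
     (\<exists>a b \<alpha> \<beta>. future_causal_curve I h d a b \<alpha> \<beta> \<and> (\<alpha> a, \<beta> a) = p \<and> (\<alpha> b, \<beta> b) = q)"

definition cone_tau ::
  "real set \<Rightarrow> (real \<Rightarrow> 'a \<Rightarrow> real) \<Rightarrow> (real \<Rightarrow> 'a \<Rightarrow> 'a \<Rightarrow> real) \<Rightarrow>
   real \<times> 'a \<Rightarrow> real \<times> 'a \<Rightarrow> ennreal" where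
  "cone_tau I h d p q =
     Sup {lorentz_length h d a b \<alpha> \<beta> | a b \<alpha> \<beta>.
            future_causal_curve I h d a b \<alpha> \<beta> \<and> (\<alpha> a, \<beta> a) = p \<and> (\<alpha> b, \<beta> b) = q}"

text \<open>The space is a subset \<^term>\<open>Y\<close> of a topological space, with a causal relation \<^term>\<open>le\<close> and a
  time separation \<^term>\<open>\<tau>\<close>.\<close>

definition causal_curve_in ::
  "('p::topological_space \<Rightarrow> 'p \<Rightarrow> bool) \<Rightarrow> 'p set \<Rightarrow> real \<Rightarrow> real \<Rightarrow> (real \<Rightarrow> 'p) \<Rightarrow> bool" where
  "causal_curve_in le K a b \<gamma> \<longleftrightarrow>
     a < b \<and> continuous_on {a..b} \<gamma> \<and> \<gamma> ` {a..b} \<subseteq> K \<and>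
     (\<forall>t s. a \<le> t \<and> t < s \<and> s \<le> b \<longrightarrow> le (\<gamma> t) (\<gamma> s))"

definition tau_length ::
  "('p \<Rightarrow> 'p \<Rightarrow> ennreal) \<Rightarrow> real \<Rightarrow> real \<Rightarrow> (real \<Rightarrow> 'p) \<Rightarrow> ennreal" where
  "tau_length \<tau> a b \<gamma> =
     Inf {\<Sum>i<N. \<tau> (\<gamma> (t i)) (\<gamma> (t (Suc i))) | N t. partition_points a b N t}"

definition totally_non_imprisoning ::
  "'p::topological_space set \<Rightarrow> ('p \<Rightarrow> 'p \<Rightarrow> bool) \<Rightarrow> ('p \<Rightarrow> 'p \<Rightarrow> ennreal) \<Rightarrow> bool" where
  "totally_non_imprisoning Y le \<tau> \<longleftrightarrow>
     (\<forall>K. K \<subseteq> Y \<and> compact K \<longrightarrow>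
        (\<exists>C::real. \<forall>a b \<gamma>. causal_curve_in le K a b \<gamma> \<longrightarrow> tau_length \<tau> a b \<gamma> \<le> ennreal C))"

definition causal_diamond :: "'p set \<Rightarrow> ('p \<Rightarrow> 'p \<Rightarrow> bool) \<Rightarrow> 'p \<Rightarrow> 'p \<Rightarrow> 'p set" where
  "causal_diamond Y le p q = {z \<in> Y. le p z \<and> le z q}"

definition globally_hyperbolic ::
  "'p::topological_space set \<Rightarrow> ('p \<Rightarrow> 'p \<Rightarrow> bool) \<Rightarrow> ('p \<Rightarrow> 'p \<Rightarrow> ennreal) \<Rightarrow> bool" where
  "globally_hyperbolic Y le \<tau> \<longleftrightarrow>
     totally_non_imprisoning Y le \<tau> \<and> (\<forall>p\<in>Y. \<forall>q\<in>Y. compact (causal_diamond Y le p q))"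

end

theory Submission
  imports Defs
begin

text \<open>
  The space component of a future directed causal curve can be parametrized by the time coordinate,
  which is absolutely continuous with positive derivative. Causality then says that at time \<open>t\<close> the
  curve moves with speed at most \<open>h\<close>, measured by the metric \<open>d t\<close>. The proof replaces this condition,
  which involves derivatives and null sets, by a bound on the pointwise Lipschitz constant at every
  instant; curves with such a bound are called timed curves, and \<open>cone_le_iff\<close> says that they describe
  the causal relation. The translation has two ingredients. For absolutely continuous curves the metric
  speed exists almost everywhere and integrates to distances (\<open>metric_derivative\<close>), which rests on
  Lebesgue's differentiation theorem. And by the log-Lipschitz condition the metrics at nearby times
  differ at most by factors \<open>exp (C * \<bar>s - s'\<bar>)\<close>, so estimates for the moving metric can be compared with a fixed
  one and chained (\<open>d_le_of_speed_bound\<close>). Two facts about timed curves do the rest.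

  First, a timed curve that starts in a compact set \<open>K\<close> remains in a slightly larger compact set \<open>L\<close> for
  a uniform time (\<open>timed_curve_escape\<close>), since leaving costs a definite distance. This gives total
  non-imprisonment: with \<open>h \<le> H\<close> over \<open>L\<close>, causal curves between nearby points of \<open>K\<close> have Lorentzian
  length at most \<open>H\<close> times the elapsed time, and these bounds add up along a partition.

  Second, pointwise limits of timed curves within a compact set are timed curves (\<open>timed_curve_limit\<close>).
  Together with escape this shows that the timed curves that start at a given point and last until a
  given time remain in a common compact set (\<open>reach_is_bounded\<close>). Otherwise consider the first time \<open>T\<close> at
  which this fails. Curves that leave ever larger compact sets have a cluster point, a timed curve up to
  \<open>T\<close>, which tends to infinity: if it came back to some compact set again and again, the escape estimate
  would confine the approximating curves. Parametrized over a half line, it has an integral of speed over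
  \<open>h\<close> of at most the elapsed time, against the divergence assumption. Hence the timed curves between two
  points form a compact set for the topology of pointwise convergence, and the causal diamond is compact as
  the image of this set times the time interval under evaluation.
\<close>

section \<open>Lebesgue differentiation on the line\<close>

text \<open>
  Absolute continuity of the integral. Above a large height \<open>N\<close> the function \<open>\<bar>f\<bar>\<close> has small integral
  by dominated convergence, and below it a set of measure \<open>\<delta>\<close> contributes at most \<open>N * \<delta>\<close>.
\<close>
lemma integral_small_on_small_sets:
  fixes f :: "'a \<Rightarrow> real"
  assumes f: "integrable M f" and e: "0 < e"
  obtains \<delta> where "0 < \<delta>"
    "\<And>A. A \<in> sets M \<Longrightarrow> emeasure M A < ennreal \<delta> \<Longrightarrow> (LINT x:A|M. \<bar>f x\<bar>) < e"
proof -
  have m[measurable]: "f \<in> borel_measurable M" using f by auto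
  have "(\<lambda>n. LINT x|M. \<bar>f x\<bar> * indicator {x. real n < \<bar>f x\<bar>} x) \<longlonglongrightarrow> (LINT x|M. (\<lambda>_. 0) x)"
  proof (rule integral_dominated_convergence[where w = "\<lambda>x. \<bar>f x\<bar>"])
    show "AE x in M. (\<lambda>n. \<bar>f x\<bar> * indicator {x. real n < \<bar>f x\<bar>} x) \<longlonglongrightarrow> 0"
    proof (rule AE_I2)
      fix x
      obtain N where N: "\<bar>f x\<bar> < real N" using reals_Archimedean2 by blast
      then have "\<forall>\<^sub>F n in sequentially. \<bar>f x\<bar> * indicator {x. real n < \<bar>f x\<bar>} x = 0"
        by (intro eventually_sequentiallyI[of N]) (auto simp: indicator_def)
      then show "(\<lambda>n. \<bar>f x\<bar> * indicator {x. real n < \<bar>f x\<bar>} x) \<longlonglongrightarrow> 0"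
        by (rule tendsto_eventually)
    qed
  qed (use f in \<open>auto simp: indicator_def\<close>)
  then have "\<forall>\<^sub>F n in sequentially. (LINT x|M. \<bar>f x\<bar> * indicator {x. real n < \<bar>f x\<bar>} x) < e / 2"
    using e order_tendstoD(2)[of _ "0::real" sequentially "e / 2"] by simp
  then obtain N where N: "(LINT x|M. \<bar>f x\<bar> * indicator {x. real N < \<bar>f x\<bar>} x) < e / 2"
    by (auto simp: eventually_sequentially)
  define \<delta> where "\<delta> = e / (2 * (real N + 1))"
  have d: "0 < \<delta>" using e by (simp add: \<delta>_def)
  show ?thesis
  proof (rule that[OF d])
    fix A assume A[measurable]: "A \<in> sets M" and mA: "emeasure M A < ennreal \<delta>"
    have fin: "emeasure M A < \<infinity>" using mA by (simp add: order_less_trans[OF _ ennreal_less_top])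
    have mA': "measure M A < \<delta>"
      using mA d fin by (simp add: emeasure_eq_ennreal_measure less_top ennreal_less_iff)
    have i1: "integrable M (\<lambda>x. \<bar>f x\<bar> * indicator {x. real N < \<bar>f x\<bar>} x)"
      by (rule Bochner_Integration.integrable_bound[OF f]) (auto simp: indicator_def)
    have i2: "integrable M (\<lambda>x. real N * indicator A x)"
      using fin by auto
    have "(LINT x:A|M. \<bar>f x\<bar>) \<le> (LINT x|M. \<bar>f x\<bar> * indicator {x. real N < \<bar>f x\<bar>} x + real N * indicator A x)"
      unfolding set_lebesgue_integral_def
    proof (rule integral_mono)
      show "integrable M (\<lambda>x. indicat_real A x *\<^sub>R \<bar>f x\<bar>)"
        using f by (intro integrable_mult_indicator) auto
      show "integrable M (\<lambda>x. \<bar>f x\<bar> * indicator {x. real N < \<bar>f x\<bar>} x + real N * indicator A x)"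
        using i1 i2 by auto
    qed (auto simp: indicator_def)
    also have "\<dots> = (LINT x|M. \<bar>f x\<bar> * indicator {x. real N < \<bar>f x\<bar>} x) + real N * measure M A"
      using i1 i2 by (subst Bochner_Integration.integral_add) auto
    also have "\<dots> < e / 2 + (real N + 1) * \<delta>"
      using N mA' by (intro add_less_le_mono mult_mono) auto
    also have "\<dots> = e" by (simp add: \<delta>_def field_simps)
    finally show "(LINT x:A|M. \<bar>f x\<bar>) < e" .
  qed
qed

lemma set_integral_nonneg_countable_Union:
  fixes f :: "'a \<Rightarrow> real"
  assumes C: "countable C" and disj: "disjoint_family_on A C"
    and meas: "\<And>i. i \<in> C \<Longrightarrow> A i \<in> sets M"
    and int: "set_integrable M (\<Union>i\<in>C. A i) f"
    and nn: "\<And>i. i \<in> C \<Longrightarrow> 0 \<le> (LINT x:A i|M. f x)"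
  shows "0 \<le> (LINT x:(\<Union>i\<in>C. A i)|M. f x)"
proof -
  define B where "B n = (\<Union>i\<in>{i\<in>C. to_nat_on C i = n}. A i)" for n
  have B: "B n = (if n \<in> to_nat_on C ` C then A (the_inv_into C (to_nat_on C) n) else {})" for n
  proof (cases "n \<in> to_nat_on C ` C")
    case True
    then obtain i where i: "i \<in> C" "n = to_nat_on C i" by auto
    then have "{j\<in>C. to_nat_on C j = n} = {i}" using inj_on_to_nat_on[OF C] by (auto dest: inj_onD)
    then show ?thesis using i the_inv_into_f_f[OF inj_on_to_nat_on[OF C]] by (auto simp: B_def)
  qed (auto simp: B_def)
  have inv: "the_inv_into C (to_nat_on C) n \<in> C" if "n \<in> to_nat_on C ` C" for n
    using that the_inv_into_into[OF inj_on_to_nat_on[OF C]] by blast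
  have U: "(\<Union>i\<in>C. A i) = (\<Union>n. B n)" by (auto simp: B_def)
  have Bm[measurable]: "B n \<in> sets M" for n using B[of n] meas inv by auto
  have intB: "set_integrable M S f" if "S \<in> sets M" "S \<subseteq> (\<Union>n. B n)" for S
    using set_integrable_subset[OF int[unfolded U] that] .
  have part: "0 \<le> (LINT x:(\<Union>n<N. B n)|M. f x)" for N
  proof (induction N)
    case 0
    then show ?case by (simp add: set_lebesgue_integral_def)
  next
    case (Suc N)
    have "(\<Union>n<Suc N. B n) = (\<Union>n<N. B n) \<union> B N" by (auto simp: less_Suc_eq)
    moreover have "(\<Union>n<N. B n) \<inter> B N = {}"
      using disj unfolding B_def disjoint_family_on_def by fastforce
    moreover have "0 \<le> (LINT x:B N|M. f x)"
      using B[of N] nn inv by (auto simp: set_lebesgue_integral_def)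
    moreover have "set_integrable M (B N) f" by (rule intB[OF Bm]) auto
    moreover have "set_integrable M (\<Union>n<N. B n) f" by (rule intB[OF sets.finite_UN]) (auto simp: Bm)
    ultimately show ?case
      using Suc set_integral_Un[of "\<Union>n<N. B n" "B N" M f] by simp
  qed
  have "(\<lambda>N. LINT x:(\<Union>n<N. B n)|M. f x) \<longlonglongrightarrow> (LINT x:(\<Union>N. \<Union>n<N. B n)|M. f x)"
  proof (rule set_integral_cont_up)
    have "(\<Union>N. \<Union>n<N. B n) = (\<Union>n. B n)" by blast
    then show "set_integrable M (\<Union>N. \<Union>n<N. B n) f" using int U by simp
    show "incseq (\<lambda>N. \<Union>n<N. B n)" by (auto simp: incseq_def) (meson lessThan_iff less_le_trans)
  qed auto
  moreover have "(\<Union>N. \<Union>n<N. B n) = (\<Union>i\<in>C. A i)" unfolding U by blast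
  ultimately show ?thesis using part by (auto intro: LIMSEQ_le_const)
qed

text \<open>
  The core of Lebesgue's differentiation theorem. Let \<open>S\<close> be the part of \<open>{g < p}\<close> in \<open>(-n, n)\<close>, a
  restriction that makes \<open>g - q\<close> integrable, and let \<open>U\<close> be an open set around \<open>S\<close> that is so little
  larger than \<open>S\<close> that \<open>\<bar>g - q\<bar>\<close> has integral below \<open>e * (q - p)\<close> on \<open>U - S\<close>. Vitali's theorem covers
  the exceptional points of \<open>S\<close>, up to a null set, by disjoint intervals inside \<open>U\<close> over which \<open>g\<close> has
  average above \<open>q\<close>. On their union \<open>V\<close> the integral of \<open>g - q\<close> is nonnegative, yet it is at most
  \<open>-(q - p)\<close> times the measure of \<open>V \<inter> S\<close> plus \<open>e * (q - p)\<close>. So \<open>V \<inter> S\<close> has measure below \<open>e\<close>.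
\<close>
lemma interval_averages_eventually_le_null:
  fixes g :: "real \<Rightarrow> real"
  assumes g: "integrable lebesgue g" and pq: "p < q"
  shows "negligible {t. g t < p \<and>
    (\<forall>\<eta>>0. \<exists>c r. 0 < r \<and> r < \<eta> \<and> t \<in> cball c r \<and> q * (2 * r) < (LINT u:cball c r|lebesgue. g u))}"
    (is "negligible ?E")
proof -
  have [measurable]: "g \<in> borel_measurable lebesgue" using g by auto
  have "negligible (?E \<inter> {-real n<..<real n})" for n
    unfolding negligible_outer_le
  proof (intro allI impI)
    fix e :: real assume e: "0 < e"
    define S where "S = {t. g t < p} \<inter> {-real n<..<real n}"
    have S[measurable]: "S \<in> sets lebesgue"
      unfolding S_def using borel_measurable_less[of g lebesgue "\<lambda>_. p"] by (intro sets.Int) auto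
    define f where "f u = (g u - q) * indicator {-real n<..<real n} u" for u
    have int_ind: "integrable lebesgue (\<lambda>u. q * indicator {-real n<..<real n} u)"
      by (intro integrable_mult_right integrable_real_indicator) auto
    have f: "integrable lebesgue f"
    proof -
      have "integrable lebesgue (\<lambda>u. indicator {-real n<..<real n} u *\<^sub>R g u - q * indicator {-real n<..<real n} u)"
        by (intro Bochner_Integration.integrable_diff integrable_mult_indicator int_ind g) auto
      moreover have "f = (\<lambda>u. indicator {-real n<..<real n} u *\<^sub>R g u - q * indicator {-real n<..<real n} u)"
        by (auto simp: f_def fun_eq_iff algebra_simps)
      ultimately show ?thesis by simp
    qed
    define e' where "e' = e * (q - p)"
    have e': "0 < e'" using e pq by (simp add: e'_def)
    obtain \<delta> where \<delta>: "0 < \<delta>"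
      "\<And>A. A \<in> sets lebesgue \<Longrightarrow> emeasure lebesgue A < ennreal \<delta> \<Longrightarrow> (LINT x:A|lebesgue. \<bar>f x\<bar>) < e'"
      using integral_small_on_small_sets[OF f e'] by metis
    obtain T where T: "open T" "S \<subseteq> T" "(T - S) \<in> lmeasurable" "emeasure lebesgue (T - S) < ennreal \<delta>"
      using sets_lebesgue_outer_open[OF S \<delta>(1)] by blast
    define U where "U = T \<inter> {-real n<..<real n}"
    have U: "open U" "S \<subseteq> U" "U \<subseteq> {-real n<..<real n}" using T by (auto simp: U_def S_def)
    define K where "K = {i. 0 < snd i \<and> cball (fst i) (snd i) \<subseteq> U
      \<and> q * (2 * snd i) < (LINT u:cball (fst i) (snd i)|lebesgue. g u)}"
    obtain C where C: "countable C" "C \<subseteq> K"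
      "pairwise (\<lambda>i j. disjnt (cball (fst i) (snd i)) (cball (fst j) (snd j))) C"
      "negligible ((?E \<inter> {-real n<..<real n}) - (\<Union>i\<in>C. cball (fst i) (snd i)))"
    proof (rule Vitali_covering_theorem_cballs[of K snd "?E \<inter> {-real n<..<real n}" fst])
      show "0 < snd i" if "i \<in> K" for i using that by (simp add: K_def)
      fix x d :: real assume x: "x \<in> ?E \<inter> {-real n<..<real n}" and d: "0 < d"
      then have "x \<in> U" using U(2) by (auto simp: S_def)
      then obtain \<rho> where \<rho>: "0 < \<rho>" "ball x \<rho> \<subseteq> U" using U(1) open_contains_ball by blast
      have "0 < min d (\<rho> / 2)" using d \<rho> by simp
      then obtain c r where cr: "0 < r" "r < min d (\<rho> / 2)" "x \<in> cball c r"
          "q * (2 * r) < (LINT u:cball c r|lebesgue. g u)"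
        using x by blast
      have "cball c r \<subseteq> ball x \<rho>" using cr by (auto simp: dist_real_def)
      then have "(c, r) \<in> K" using cr \<rho> by (auto simp: K_def)
      then show "\<exists>i. i \<in> K \<and> x \<in> cball (fst i) (snd i) \<and> snd i < d" using cr by force
    qed blast
    define V where "V = (\<Union>i\<in>C. cball (fst i) (snd i))"
    have V[measurable]: "V \<in> sets lebesgue" unfolding V_def using C(1) by (intro sets.countable_UN') auto
    have VU: "V \<subseteq> U" using C(2) by (auto simp: V_def K_def)
    have fint: "set_integrable lebesgue A f" if "A \<in> sets lebesgue" for A
      using f that unfolding set_integrable_def by (intro integrable_mult_indicator) auto
    have VSm: "V \<inter> S \<in> lmeasurable"
    proof (rule fmeasurableI2[of "{-real n..real n}"])
      show "V \<inter> S \<subseteq> {-real n..real n}" by (auto simp: S_def)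
    qed auto
    have "0 \<le> (LINT x:V|lebesgue. f x)"
      unfolding V_def
    proof (rule set_integral_nonneg_countable_Union[OF C(1)])
      show "disjoint_family_on (\<lambda>i. cball (fst i) (snd i)) C"
        using C(3) by (auto simp: disjoint_family_on_def pairwise_def disjnt_def)
      show "set_integrable lebesgue (\<Union>i\<in>C. cball (fst i) (snd i)) f"
        using fint[OF V] by (simp add: V_def)
      fix i assume i: "i \<in> C"
      obtain c r where [simp]: "i = (c, r)" by force
      have k: "0 < r" "cball c r \<subseteq> U" "q * (2 * r) < (LINT u:cball c r|lebesgue. g u)"
        using subsetD[OF C(2) i] by (simp_all add: K_def)
      have mem: "indicator {-real n<..<real n} u = (1::real)" if "u \<in> cball c r" for u
        using that k(2) U(3) by (intro indicator_simps) blast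
      have cb: "cball c r = {c - r..c + r}" by (simp add: cball_eq_atLeastAtMost)
      have ig: "set_integrable lebesgue (cball c r) g"
        unfolding set_integrable_def by (rule integrable_mult_indicator[OF _ g]) simp
      have iq: "set_integrable lebesgue (cball c r) (\<lambda>_. q)"
        unfolding set_integrable_def cb real_scaleR_def
        by (intro integrable_mult_left integrable_real_indicator) (simp_all add: emeasure_lborel_Icc_eq)
      have "(LINT u:cball c r|lebesgue. f u) = (LINT u:cball c r|lebesgue. g u - q)"
        unfolding f_def by (rule set_lebesgue_integral_cong) (auto simp only: mem mult_1_right intro!: lmeasurable_cball[THEN fmeasurableD])
      also have "\<dots> = (LINT u:cball c r|lebesgue. g u) - (LINT u:cball c r|lebesgue. q)"
        by (rule set_integral_diff(2)[OF ig iq])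
      also have "(LINT u:cball c r|lebesgue. q) = q * (2 * r)"
        using k(1) unfolding cb set_lebesgue_integral_def by simp
      finally show "0 \<le> (LINT u:cball (fst i) (snd i)|lebesgue. f u)" using k(3) by simp
    qed auto
    also have "(LINT x:V|lebesgue. f x) = (LINT x:(V \<inter> S)|lebesgue. f x) + (LINT x:(V - S)|lebesgue. f x)"
      using set_integral_Un[of "V \<inter> S" "V - S" lebesgue f] fint by (simp add: Int_Diff_Un Int_Diff_disjoint)
    also have "(LINT x:(V - S)|lebesgue. f x) \<le> (LINT x:(V - S)|lebesgue. \<bar>f x\<bar>)"
      using fint[of "V - S"] by (intro set_integral_mono) (auto intro: set_integrable_abs)
    also have "\<dots> < e'"
    proof (rule \<delta>(2))
      have "emeasure lebesgue (V - S) \<le> emeasure lebesgue (T - S)"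
        using VU T by (intro emeasure_mono) (auto simp: U_def)
      then show "emeasure lebesgue (V - S) < ennreal \<delta>" using T(4) by simp
    qed auto
    finally have "- (LINT x:(V \<inter> S)|lebesgue. f x) < e'" by simp
    moreover have "(LINT x:(V \<inter> S)|lebesgue. f x) \<le> (LINT x:(V \<inter> S)|lebesgue. p - q)"
    proof (rule set_integral_mono[OF fint])
      show "set_integrable lebesgue (V \<inter> S) (\<lambda>_. p - q)"
        using VSm unfolding set_integrable_def real_scaleR_def
        by (intro integrable_mult_left integrable_real_indicator) (auto simp: fmeasurable_def)
      show "V \<inter> S \<in> sets lebesgue" using V S by (rule sets.Int)
      show "f x \<le> p - q" if "x \<in> V \<inter> S" for x using that by (auto simp: f_def S_def)
    qed
    moreover have "(LINT x:(V \<inter> S)|lebesgue. p - q) = (p - q) * measure lebesgue (V \<inter> S)"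
      using VSm by (simp add: set_lebesgue_integral_def mult.commute)
    ultimately have "(q - p) * measure lebesgue (V \<inter> S) < e'" by (simp add: algebra_simps)
    then have less: "measure lebesgue (V \<inter> S) < e" using pq by (simp add: e'_def mult.commute)
    define N where "N = (?E \<inter> {-real n<..<real n}) - V"
    have N: "negligible N" using C(4) by (simp add: N_def V_def)
    then have Nm: "N \<in> lmeasurable" "measure lebesgue N = 0"
      by (auto intro: negligible_imp_measurable negligible_imp_measure0)
    show "\<exists>T. ?E \<inter> {-real n<..<real n} \<subseteq> T \<and> T \<in> lmeasurable \<and> measure lebesgue T \<le> e"
    proof (intro exI conjI)
      show "?E \<inter> {-real n<..<real n} \<subseteq> (V \<inter> S) \<union> N" by (auto simp: N_def S_def)
      show "(V \<inter> S) \<union> N \<in> lmeasurable" using VSm Nm by (intro fmeasurable.Un)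
      show "measure lebesgue ((V \<inter> S) \<union> N) \<le> e"
        using measure_Un_le[of "V \<inter> S" lebesgue N] VSm Nm less by auto
    qed
  qed
  then have "negligible (\<Union>n. ?E \<inter> {-real n<..<real n})" by (intro negligible_Union_nat) auto
  moreover have "?E \<subseteq> (\<Union>n. ?E \<inter> {-real n<..<real n})"
  proof
    fix x assume "x \<in> ?E"
    moreover obtain n where "\<bar>x\<bar> < real n" using reals_Archimedean2 by blast
    ultimately show "x \<in> (\<Union>n. ?E \<inter> {-real n<..<real n})" by (auto intro!: exI[of _ n])
  qed
  ultimately show ?thesis using negligible_subset by blast
qed

text \<open>
  The intervals only have to contain \<open>t\<close>, which covers both one-sided difference quotients. Choosing
  rationals \<open>p\<close> and \<open>q'\<close> with \<open>g t < p < q' < q\<close> leaves countably many null sets.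
\<close>
lemma AE_interval_averages_upper:
  fixes g :: "real \<Rightarrow> real"
  assumes g: "integrable lebesgue g"
  shows "AE t in lebesgue. \<forall>q>g t. \<exists>\<eta>>0. \<forall>x y. x < y \<and> x \<le> t \<and> t \<le> y \<and> y - x < \<eta> \<longrightarrow>
     (LINT u:{x..y}|lebesgue. g u) \<le> q * (y - x)"
proof -
  define E where "E p q = {t. g t < p \<and> (\<forall>\<eta>>0. \<exists>c r. 0 < r \<and> r < \<eta> \<and> t \<in> cball c r
      \<and> q * (2 * r) < (LINT u:cball c r|lebesgue. g u))}" for p q :: real
  define N where "N = (\<Union>(p, q)\<in>{(p, q). p \<in> \<rat> \<and> q \<in> \<rat> \<and> p < q}. E p q)"
  have "countable {(p, q). p \<in> \<rat> \<and> q \<in> \<rat> \<and> (p::real) < q}"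
    by (rule countable_subset[of _ "\<rat> \<times> \<rat>"]) (auto simp: countable_rat)
  then have "negligible N"
    unfolding N_def using interval_averages_eventually_le_null[OF g]
    by (intro negligible_countable_Union countable_image) (auto simp: E_def)
  then have "N \<in> null_sets lebesgue" by (simp add: negligible_iff_null_sets)
  moreover define P where "P t q \<longleftrightarrow> (\<exists>\<eta>>0. \<forall>x y. x < y \<and> x \<le> t \<and> t \<le> y \<and> y - x < \<eta> \<longrightarrow>
     (LINT u:{x..y}|lebesgue. g u) \<le> q * (y - x))" for t q
  have "{t \<in> space lebesgue. \<not> (\<forall>q>g t. P t q)} \<subseteq> N"
  proof
    fix t assume "t \<in> {t \<in> space lebesgue. \<not> (\<forall>q>g t. P t q)}"
    then obtain q where q: "g t < q" and no: "\<not> P t q"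
      by blast
    obtain q' where q': "q' \<in> \<rat>" "g t < q'" "q' < q" using Rats_dense_in_real[OF q] by blast
    obtain p where p: "p \<in> \<rat>" "g t < p" "p < q'" using Rats_dense_in_real[OF q'(2)] by blast
    have "t \<in> E p q'"
      unfolding E_def
    proof (intro CollectI conjI allI impI)
      fix \<eta> :: real assume "0 < \<eta>"
      then obtain x y where xy: "x < y" "x \<le> t" "t \<le> y" "y - x < \<eta>"
        "q * (y - x) < (LINT u:{x..y}|lebesgue. g u)"
        using no unfolding P_def by (meson not_le)
      have cb: "cball ((x + y) / 2) ((y - x) / 2) = {x..y}"
        by (auto simp: cball_eq_atLeastAtMost field_simps)
      define w where "w = (y - x) / 2"
      have w: "y - x = 2 * w" "0 < w" using xy by (auto simp: w_def)
      have "q' * (2 * w) < q * (2 * w)" using q' w by simp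
      then have "0 < w \<and> w < \<eta> \<and> t \<in> cball ((x + y) / 2) w
          \<and> q' * (2 * w) < (LINT u:cball ((x + y) / 2) w|lebesgue. g u)"
        using xy w order_less_trans[of "q' * (2 * w)" "q * (2 * w)"] unfolding cb[folded w_def] by auto
      then show "\<exists>c r. 0 < r \<and> r < \<eta> \<and> t \<in> cball c r \<and> q' * (2 * r) < (LINT u:cball c r|lebesgue. g u)"
        by blast
    qed (use p in auto)
    then show "t \<in> N" using p q' by (auto simp: N_def)
  qed
  ultimately have "AE t in lebesgue. \<forall>q>g t. P t q" by (rule AE_I')
  then show ?thesis by (simp only: P_def)
qed

text \<open>
  The upper estimates for \<open>g\<close> and for \<open>-g\<close> squeeze the averages. The primitive is quantified inside the
  almost-everywhere statement, so one null set serves all primitives, even those that are only local.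
\<close>
theorem lebesgue_differentiation:
  fixes g :: "real \<Rightarrow> real"
  assumes g: "integrable lebesgue g"
  shows "AE t in lebesgue. \<forall>G. (\<forall>\<^sub>F s in at t. s < t \<longrightarrow> G t - G s = (LINT u:{s..t}|lebesgue. g u)) \<longrightarrow>
      (\<forall>\<^sub>F s in at t. t < s \<longrightarrow> G s - G t = (LINT u:{t..s}|lebesgue. g u)) \<longrightarrow>
      (G has_real_derivative g t) (at t)"
  using AE_interval_averages_upper[OF g] AE_interval_averages_upper[OF integrable_minus[OF g]]
proof eventually_elim
  case (elim t)
  show ?case
  proof (intro allI impI)
    fix G assume G: "\<forall>\<^sub>F s in at t. s < t \<longrightarrow> G t - G s = (LINT u:{s..t}|lebesgue. g u)"
       "\<forall>\<^sub>F s in at t. t < s \<longrightarrow> G s - G t = (LINT u:{t..s}|lebesgue. g u)"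
    have neg: "(LINT u:{x..y}|lebesgue. - g u) = - (LINT u:{x..y}|lebesgue. g u)" for x y
      by (simp add: set_lebesgue_integral_def)
    have "((\<lambda>s. (G s - G t) / (s - t)) \<longlongrightarrow> g t) (at t)"
    proof (rule tendstoI)
      fix e :: real assume e: "0 < e"
      obtain \<eta> where \<eta>: "0 < \<eta>" "\<And>x y. x < y \<Longrightarrow> x \<le> t \<Longrightarrow> t \<le> y \<Longrightarrow> y - x < \<eta> \<Longrightarrow>
          (LINT u:{x..y}|lebesgue. g u) \<le> (g t + e / 2) * (y - x)"
        using elim(1)[rule_format, of "g t + e / 2"] e by (auto simp: field_simps)
      obtain \<eta>' where \<eta>': "0 < \<eta>'" "\<And>x y. x < y \<Longrightarrow> x \<le> t \<Longrightarrow> t \<le> y \<Longrightarrow> y - x < \<eta>' \<Longrightarrow>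
          (LINT u:{x..y}|lebesgue. - g u) \<le> (- g t + e / 2) * (y - x)"
        using elim(2)[rule_format, of "- g t + e / 2"] e by (auto simp: field_simps)
      have two: "\<bar>I / w - g t\<bar> < e" if "0 < w" "I \<le> (g t + e / 2) * w" "- I \<le> (- g t + e / 2) * w" for I w
      proof -
        have "I / w \<le> g t + e / 2" "g t - e / 2 \<le> I / w"
          using that by (auto simp: field_simps)
        then show ?thesis using e by (simp add: abs_le_iff abs_less_iff)
      qed
      have "\<forall>\<^sub>F s in at t. \<bar>s - t\<bar> < min \<eta> \<eta>'"
        using \<eta> \<eta>' by (auto simp: eventually_at dist_real_def intro!: exI[of _ "min \<eta> \<eta>'"])
      moreover have "\<forall>\<^sub>F s in at t. s \<noteq> t" by (simp add: eventually_at_filter)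
      ultimately show "\<forall>\<^sub>F s in at t. dist ((G s - G t) / (s - t)) (g t) < e"
        using G
      proof eventually_elim
        case (elim s)
        show ?case
        proof (cases "s < t")
          case True
          then have "(G s - G t) / (s - t) = (G t - G s) / (t - s)" by (simp add: divide_simps) (simp add: algebra_simps)
          then show ?thesis
            using two[of "t - s" "G t - G s"] True elim \<eta>(2)[of s t] \<eta>'(2)[of s t] neg[of s t]
            by (auto simp: dist_real_def)
        next
          case False
          then show ?thesis
            using two[of "s - t" "G s - G t"] elim \<eta>(2)[of t s] \<eta>'(2)[of t s] neg[of t s]
            by (auto simp: dist_real_def)
        qed
      qed
    qed
    then show "(G has_real_derivative g t) (at t)" by (simp add: has_field_derivative_iff)
  qed
qed

section \<open>Absolutely continuous functions\<close>

lemma AE_has_derivative_of_integral: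
  fixes \<phi> :: "real \<Rightarrow> real"
  assumes \<phi>: "integrable lebesgue \<phi>"
    and f: "\<And>s t. a \<le> s \<Longrightarrow> s \<le> t \<Longrightarrow> t \<le> b \<Longrightarrow> f t - f s = (LINT u:{s..t}|lebesgue. \<phi> u)"
  shows "AE t in lebesgue. t \<in> {a<..<b} \<longrightarrow> (f has_real_derivative \<phi> t) (at t)"
  using lebesgue_differentiation[OF \<phi>]
proof eventually_elim
  case (elim t)
  show ?case
  proof
    assume t: "t \<in> {a<..<b}"
    have ev: "\<forall>\<^sub>F s in at t. s \<in> {a<..<b}"
      using t by (intro eventually_at_topological[THEN iffD2] exI[of _ "{a<..<b}"]) auto
    show "(f has_real_derivative \<phi> t) (at t)"
    proof (rule elim[rule_format])
      show "\<forall>\<^sub>F s in at t. s < t \<longrightarrow> f t - f s = (LINT u:{s..t}|lebesgue. \<phi> u)"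
        using ev by eventually_elim (use t f in auto)
      show "\<forall>\<^sub>F s in at t. t < s \<longrightarrow> f s - f t = (LINT u:{t..s}|lebesgue. \<phi> u)"
        using ev by eventually_elim (use t f in auto)
    qed
  qed
qed

lemma eventually_at_0_shift:
  fixes t :: real
  assumes "t \<in> {a<..<b}"
  shows "\<forall>\<^sub>F \<delta> in at 0. t + \<delta> \<in> {a<..<b}"
proof -
  have "\<forall>\<^sub>F \<delta> in at 0. \<bar>\<delta>\<bar> < min (t - a) (b - t)"
    using assms by (auto simp: eventually_at dist_real_def intro!: exI[of _ "min (t - a) (b - t)"])
  then show ?thesis by eventually_elim auto
qed

lemma AE_lebesgue_neq_real: "AE t in lebesgue. t \<noteq> (c::real)"
  by (rule AE_I'[of "{c}"]) (auto simp: negligible_iff_null_sets[symmetric])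


lemma integrable_indicator_times:
  fixes f :: "'a \<Rightarrow> real"
  shows "A \<in> sets M \<Longrightarrow> integrable M f \<Longrightarrow> integrable M (\<lambda>x. indicator A x * f x)"
  using integrable_mult_indicator[of A M f] by simp

text \<open>
  A measure on the line is determined by its values on half-open intervals, and there the two sides
  agree by assumption. The consequence that matters: each of the two Stieltjes measures is dominated by
  a measure with a density and is therefore absolutely continuous.
\<close>
lemma interval_measure_sum_eq_density:
  fixes k :: "real \<Rightarrow> real"
  assumes k: "integrable lborel k" "\<And>x. 0 \<le> k x"
    and mono: "mono F1" "mono F2" and cont: "continuous_on UNIV F1" "continuous_on UNIV F2"
    and sum: "\<And>s t. s \<le> t \<Longrightarrow> (F1 t - F1 s) + (F2 t - F2 s) = (LINT u:{s<..t}|lborel. k u)"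
    and A: "A \<in> sets borel"
  shows "emeasure (interval_measure F1) A + emeasure (interval_measure F2) A = emeasure (density lborel k) A"
proof -
  define \<mu> where "\<mu> A = emeasure (interval_measure F1) A + emeasure (interval_measure F2) A" for A
  define M where "M = measure_of UNIV (sets borel) \<mu>"
  have setsM: "sets M = sets borel" by (simp add: M_def sets.sigma_sets_eq[of borel, simplified space_borel])
  have rc: "continuous (at_right a) F1" "continuous (at_right a) F2" for a
    using cont by (auto simp: continuous_on_eq_continuous_at intro: continuous_at_imp_continuous_at_within)
  have "measure_space UNIV (sets borel) \<mu>"
    unfolding measure_space_def
  proof (intro conjI)
    show "sigma_algebra UNIV (sets (borel :: real measure))"
      using sets.sigma_algebra_axioms[of "borel :: real measure"] by simp
    show "positive (sets borel) \<mu>" by (simp add: positive_def \<mu>_def)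
    show "countably_additive (sets borel) \<mu>"
      by (auto simp: countably_additive_def \<mu>_def suminf_emeasure[symmetric] suminf_add[symmetric] summableI)
  qed
  then have eM: "emeasure M A = \<mu> A" if "A \<in> sets borel" for A
    unfolding M_def using that by (simp add: emeasure_measure_of_conv sets.sigma_sets_eq[of borel, simplified])
  have "M = density lborel k"
  proof (rule measure_eqI_generator_eq[where E = "range (\<lambda>(s, t). {s<..t})" and \<Omega> = UNIV and A = "\<lambda>n. {-real n<..real n}"])
    show "Int_stable (range (\<lambda>(s, t). {s<..t::real}))"
    proof (rule Int_stableI_image)
      show "\<exists>z\<in>UNIV. (case x of (s, t) \<Rightarrow> {s<..t}) \<inter> (case y of (s, t) \<Rightarrow> {s<..t}) = (case z of (s, t) \<Rightarrow> {s<..t::real})" for x y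
        by (intro bexI[of _ "(max (fst x) (fst y), min (snd x) (snd y))"]) (auto split: prod.splits)
    qed
    have sb: "sigma_sets UNIV (range (\<lambda>(s, t). {s<..t::real})) = sets borel"
      by (subst borel_sigma_sets_Ioc) simp
    show "sets M = sigma_sets UNIV (range (\<lambda>(s, t). {s<..t::real}))" using setsM sb by simp
    show "sets (density lborel k) = sigma_sets UNIV (range (\<lambda>(s, t). {s<..t::real}))" using sb by simp
    have eq: "emeasure M {s<..t} = emeasure (density lborel k) {s<..t}" "emeasure M {s<..t} < \<infinity>" for s t
    proof -
      have *: "emeasure M {s<..t} = emeasure (density lborel k) {s<..t} \<and> emeasure M {s<..t} < \<infinity>" if st: "s \<le> t"
      proof -
        have "emeasure M {s<..t} = ennreal (F1 t - F1 s) + ennreal (F2 t - F2 s)"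
          using st mono by (simp add: eM \<mu>_def emeasure_interval_measure_Ioc rc monoD)
        also have "\<dots> = ennreal ((F1 t - F1 s) + (F2 t - F2 s))"
          using st mono by (simp add: ennreal_plus monoD)
        finally have 1: "emeasure M {s<..t} = ennreal (LINT u:{s<..t}|lborel. k u)" using sum[OF st] by simp
        have "emeasure (density lborel k) {s<..t} = (\<integral>\<^sup>+u. ennreal (indicator {s<..t} u * k u) \<partial>lborel)"
          using k by (subst emeasure_density) (auto intro!: nn_integral_cong simp: indicator_def)
        also have "\<dots> = ennreal (LINT u:{s<..t}|lborel. k u)"
          using k unfolding set_lebesgue_integral_def real_scaleR_def
          by (intro nn_integral_eq_integral integrable_indicator_times) auto
        finally show ?thesis using 1 by simp
      qed
      show "emeasure M {s<..t} = emeasure (density lborel k) {s<..t}" "emeasure M {s<..t} < \<infinity>"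
        using * by (cases "s \<le> t"; simp)+
    qed
    show "emeasure M X = emeasure (density lborel k) X" if "X \<in> range (\<lambda>(s, t). {s<..t})" for X
      using that eq(1) by auto
    show "emeasure M {-real n<..real n} \<noteq> \<infinity>" for n using eq(2)[of "-real n" "real n"] by auto
    show "(\<Union>n. {-real n<..real n}) = UNIV"
    proof (intro equalityI subsetI)
      fix x :: real
      obtain n where "\<bar>x\<bar> < real n" using reals_Archimedean2 by blast
      then show "x \<in> (\<Union>n. {-real n<..real n})" by (auto intro!: exI[of _ n])
    qed auto
  qed auto
  then show ?thesis using eM[OF A] by (simp add: \<mu>_def)
qed

text \<open>
  Let \<open>K\<close> be the primitive of \<open>\<bar>g\<bar>\<close>. The increments of \<open>f\<close> are dominated by those of \<open>K\<close>, so \<open>f + K\<close> and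
  \<open>K - f\<close> are nondecreasing, and their increments add up to those of \<open>2 * K\<close>. Hence the Stieltjes measure
  of \<open>f + K\<close> is absolutely continuous, and its Radon-Nikodym density minus \<open>\<bar>g\<bar>\<close> is the derivative of
  \<open>f\<close>. Stieltjes measures live on the Borel sets of the whole line; this is why \<open>g\<close> is replaced by a
  Borel function \<open>g'\<close> and \<open>f\<close> is frozen outside \<open>[a, b]\<close> by the clamp \<open>c\<close>.
\<close>
lemma abs_cont_real_imp_integral:
  fixes f g :: "real \<Rightarrow> real"
  assumes g: "set_integrable lebesgue {a..b} g" and ab: "a \<le> b"
    and f: "\<And>s t. a \<le> s \<Longrightarrow> s \<le> t \<Longrightarrow> t \<le> b \<Longrightarrow> \<bar>f t - f s\<bar> \<le> (LINT u:{s..t}|lebesgue. g u)"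
  obtains \<phi> where "integrable lebesgue \<phi>"
    "\<And>s t. a \<le> s \<Longrightarrow> s \<le> t \<Longrightarrow> t \<le> b \<Longrightarrow> f t - f s = (LINT u:{s..t}|lebesgue. \<phi> u)"
proof -
  have Ioc: "(LINT u:{s<..t}|lborel. \<psi> u) = (LINT u:{s..t}|lebesgue. \<psi> u)"
    if "\<psi> \<in> borel_measurable lborel" for \<psi> :: "real \<Rightarrow> real" and s t
  proof -
    have "(LINT u:{s..t}|lebesgue. \<psi> u) = (LINT u:{s..t}|lborel. \<psi> u)"
      unfolding set_lebesgue_integral_def using that by (intro integral_completion) auto
    also have "\<dots> = (LINT u:{s<..t}|lborel. \<psi> u)"
      unfolding set_lebesgue_integral_def
      using that AE_lborel_singleton[of s] by (intro integral_cong_AE) (auto simp: indicator_def elim!: eventually_mono)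
    finally show ?thesis by simp
  qed
  have "(\<lambda>u. indicator {a..b} u *\<^sub>R g u) \<in> borel_measurable (completion lborel)"
    using g unfolding set_integrable_def by auto
  then obtain g' where g'[measurable]: "g' \<in> borel_measurable lborel"
      and gg': "AE u in lborel. indicator {a..b} u *\<^sub>R g u = g' u"
    using completion_ex_borel_measurable_real by blast
  then have gg'': "AE u in lebesgue. indicator {a..b} u *\<^sub>R g u = g' u" by (intro AE_completion)
  have "integrable lebesgue g'"
    using g gg'' unfolding set_integrable_def
    by (subst integrable_cong_AE[where g = "\<lambda>u. indicator {a..b} u *\<^sub>R g u"])
      (auto elim!: eventually_mono simp: measurable_completion)
  then have ig': "integrable lborel g'" using g' integrable_completion by blast
  define k where "k u = \<bar>g' u\<bar>" for u
  have k: "integrable lborel k" and [measurable]: "k \<in> borel_measurable lborel" and k0: "\<And>u. 0 \<le> k u"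
    using ig' unfolding k_def by auto
  have kI: "set_integrable lborel A k" if "A \<in> sets borel" for A
    using k that unfolding set_integrable_def by (intro integrable_mult_indicator) auto
  define K where "K t = (LINT u:{..t}|lborel. k u)" for t
  have KK: "K t - K s = (LINT u:{s<..t}|lborel. k u)" if "s \<le> t" for s t
  proof -
    have "{..t} = {..s} \<union> {s<..t}" using that by auto
    then have "K t = (LINT u:{..s} \<union> {s<..t}|lborel. k u)" by (simp add: K_def)
    also have "\<dots> = K s + (LINT u:{s<..t}|lborel. k u)"
      unfolding K_def by (rule set_integral_Un) (auto simp: kI)
    finally show ?thesis by simp
  qed
  have Kmono: "K s \<le> K t" if "s \<le> t" for s t
  proof -
    have "0 \<le> (LINT u:{s<..t}|lborel. k u)"
      unfolding set_lebesgue_integral_def by (rule Bochner_Integration.integral_nonneg) (simp add: k0)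
    then show ?thesis using KK[OF that] by simp
  qed
  have Kcont: "continuous_on UNIV K"
    unfolding continuous_on_iff
  proof (intro ballI allI impI)
    fix x e :: real assume "0 < e"
    then obtain \<delta> where \<delta>: "0 < \<delta>"
      "\<And>A. A \<in> sets lborel \<Longrightarrow> emeasure lborel A < ennreal \<delta> \<Longrightarrow> (LINT x:A|lborel. \<bar>k x\<bar>) < e"
      using integral_small_on_small_sets[OF k] by metis
    have small: "K t - K s < e" if "s \<le> t" "t - s < \<delta>" for s t
      using \<delta>(2)[of "{s<..t}"] that \<delta>(1) k0 by (simp add: KK ennreal_lessI)
    show "\<exists>d>0. \<forall>x'\<in>UNIV. dist x' x < d \<longrightarrow> dist (K x') (K x) < e"
    proof (intro exI conjI ballI impI)
      fix y assume y: "dist y x < \<delta>"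
      show "dist (K y) (K x) < e"
        using small[of x y] small[of y x] Kmono[of x y] Kmono[of y x] y by (cases "x \<le> y") (auto simp: dist_real_def)
    qed (rule \<delta>)
  qed
  define c where "c t = max a (min b t)" for t
  have cm: "c s \<le> c t" if "s \<le> t" for s t using that by (auto simp: c_def)
  have cab: "a \<le> c t" "c t \<le> b" for t using ab by (auto simp: c_def)
  have cin: "c t = t" if "a \<le> t" "t \<le> b" for t using that by (auto simp: c_def)
  have fK: "\<bar>f (c t) - f (c s)\<bar> \<le> K t - K s" if "s \<le> t" for s t
  proof -
    have "\<bar>f (c t) - f (c s)\<bar> \<le> (LINT u:{c s..c t}|lebesgue. g u)"
      by (intro f cab cm that)
    also have "\<dots> = (LINT u:{c s..c t}|lebesgue. g' u)"
      unfolding set_lebesgue_integral_def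
    proof (rule integral_cong_AE)
      have sub: "{c s..c t} \<subseteq> {a..b}" using cab[of s] cab[of t] by auto
      then have "set_integrable lebesgue {c s..c t} g" using g by (auto intro: set_integrable_subset)
      then show "(\<lambda>u. indicator {c s..c t} u *\<^sub>R g u) \<in> borel_measurable lebesgue"
        unfolding set_integrable_def by (rule borel_measurable_integrable)
      show "AE u in lebesgue. indicator {c s..c t} u *\<^sub>R g u = indicator {c s..c t} u *\<^sub>R g' u"
        using gg'' by eventually_elim (use sub in \<open>auto simp: indicator_def split: if_splits\<close>)
    qed (auto intro: measurable_completion)
    also have "\<dots> = (LINT u:{c s<..c t}|lborel. g' u)" using Ioc[OF g'] by simp
    also have "\<dots> \<le> (LINT u:{c s<..c t}|lborel. k u)"
    proof (rule set_integral_mono)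
      show "set_integrable lborel {c s<..c t} g'"
        unfolding set_integrable_def by (rule integrable_mult_indicator[OF _ ig']) simp
      show "set_integrable lborel {c s<..c t} k" by (rule kI) simp
    qed (simp add: k_def)
    also have "\<dots> \<le> (LINT u:{s<..t}|lborel. k u)"
      using that k0 unfolding set_lebesgue_integral_def
      by (intro integral_mono kI[unfolded set_integrable_def]) (auto simp: indicator_def c_def)
    also have "\<dots> = K t - K s" using KK[OF that] by simp
    finally show ?thesis .
  qed
  define F1 where "F1 t = f (c t) + K t" for t
  define F2 where "F2 t = K t - f (c t)" for t
  have fc: "continuous_on UNIV (\<lambda>t. f (c t))"
    unfolding continuous_on_iff
  proof (intro ballI allI impI)
    fix x e :: real assume "0 < e"
    then obtain d where d: "d > 0" "\<And>y. dist y x < d \<Longrightarrow> dist (K y) (K x) < e"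
      using Kcont unfolding continuous_on_iff by blast
    have "dist (f (c y)) (f (c x)) \<le> dist (K y) (K x)" for y
      using fK[of x y] fK[of y x] by (cases "x \<le> y") (auto simp: dist_real_def)
    then show "\<exists>d>0. \<forall>x'\<in>UNIV. dist x' x < d \<longrightarrow> dist (f (c x')) (f (c x)) < e"
      using d le_less_trans by blast
  qed
  have mono: "mono F1" "mono F2"
  proof -
    have "F1 s \<le> F1 t" "F2 s \<le> F2 t" if "s \<le> t" for s t
      using fK[OF that] by (auto simp: F1_def F2_def)
    then show "mono F1" "mono F2" by (auto intro: monoI)
  qed
  have cont: "continuous_on UNIV F1" "continuous_on UNIV F2"
    unfolding F1_def F2_def by (intro continuous_intros fc Kcont)+
  have sum: "(F1 t - F1 s) + (F2 t - F2 s) = (LINT u:{s<..t}|lborel. 2 * k u)" if "s \<le> t" for s t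
    using KK[OF that] by (simp add: F1_def F2_def)
  note eq = interval_measure_sum_eq_density[OF _ _ mono cont sum, simplified]
  define N where "N = interval_measure F1"
  have le: "emeasure N A \<le> emeasure (density lborel (\<lambda>u. 2 * k u)) A" if "A \<in> sets borel" for A
  proof -
    have "emeasure (density lborel (\<lambda>u. 2 * k u)) A = emeasure N A + emeasure (interval_measure F2) A"
      using eq[of A] that k k0 by (simp add: N_def)
    then show ?thesis by simp
  qed
  have ac: "absolutely_continuous lborel N"
    unfolding absolutely_continuous_def
  proof
    fix A :: "real set" assume A: "A \<in> null_sets lborel"
    then have "A \<in> null_sets (density lborel (\<lambda>u. 2 * k u))"
      using absolutely_continuousI_density[of "\<lambda>u. ennreal (2 * k u)" lborel] by (auto simp: absolutely_continuous_def)
    then show "A \<in> null_sets N" using le[of A] A by (auto simp: null_sets_def N_def)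
  qed
  obtain \<psi> where \<psi>[measurable]: "\<psi> \<in> borel_measurable lborel" and dens: "density lborel \<psi> = N"
    using sigma_finite_measure.Radon_Nikodym[OF sigma_finite_lborel ac] by (auto simp: N_def)
  have "(\<integral>\<^sup>+u. \<psi> u \<partial>lborel) = emeasure N UNIV"
    unfolding dens[symmetric] by (subst emeasure_density) auto
  also have "\<dots> \<le> (\<integral>\<^sup>+u. ennreal (2 * k u) \<partial>lborel)"
    using le[of UNIV] by (simp add: emeasure_density)
  also have "\<dots> = ennreal (LINT u|lborel. 2 * k u)"
    using k k0 by (intro nn_integral_eq_integral) auto
  finally have fin: "(\<integral>\<^sup>+u. \<psi> u \<partial>lborel) < \<infinity>" by (simp add: le_less_trans[OF _ ennreal_less_top])
  then have AEfin: "AE u in lborel. \<psi> u \<noteq> \<infinity>" by (intro nn_integral_noteq_infinite) auto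
  have i\<psi>: "integrable lborel (\<lambda>u. enn2real (\<psi> u))"
  proof (rule integrableI_nonneg)
    have "(\<integral>\<^sup>+u. ennreal (enn2real (\<psi> u)) \<partial>lborel) = (\<integral>\<^sup>+u. \<psi> u \<partial>lborel)"
      using AEfin by (intro nn_integral_cong_AE) (auto simp: less_top elim!: eventually_mono)
    then show "(\<integral>\<^sup>+u. ennreal (enn2real (\<psi> u)) \<partial>lborel) < \<infinity>" using fin by simp
  qed auto
  have F1i: "F1 t - F1 s = (LINT u:{s<..t}|lborel. enn2real (\<psi> u))" if st: "s \<le> t" for s t
  proof -
    have "ennreal (F1 t - F1 s) = emeasure N {s<..t}"
      unfolding N_def using st mono cont
      by (subst emeasure_interval_measure_Ioc)
        (auto simp: monoD continuous_on_eq_continuous_at intro: continuous_at_imp_continuous_at_within)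
    also have "\<dots> = (\<integral>\<^sup>+u. \<psi> u * indicator {s<..t} u \<partial>lborel)"
      unfolding dens[symmetric] by (subst emeasure_density) auto
    also have "\<dots> = (\<integral>\<^sup>+u. ennreal (indicator {s<..t} u * enn2real (\<psi> u)) \<partial>lborel)"
      using AEfin by (intro nn_integral_cong_AE) (auto simp: less_top indicator_def elim!: eventually_mono)
    also have "\<dots> = ennreal (LINT u:{s<..t}|lborel. enn2real (\<psi> u))"
      unfolding set_lebesgue_integral_def real_scaleR_def
      by (intro nn_integral_eq_integral integrable_indicator_times i\<psi>) auto
    finally show ?thesis
      using st mono by (subst (asm) ennreal_inj) (auto simp: monoD set_lebesgue_integral_def)
  qed
  define \<phi> where "\<phi> u = enn2real (\<psi> u) - k u" for u
  show ?thesis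
  proof
    have i\<phi>: "integrable lborel \<phi>" unfolding \<phi>_def using i\<psi> k by (rule Bochner_Integration.integrable_diff)
    then show "integrable lebesgue \<phi>" by (simp add: integrable_completion)
    fix s t assume st: "a \<le> s" "s \<le> t" "t \<le> b"
    have "f t - f s = (F1 t - F1 s) - (K t - K s)" using st by (simp add: F1_def cin)
    also have "\<dots> = (LINT u:{s<..t}|lborel. \<phi> u)"
      unfolding F1i[OF st(2)] KK[OF st(2)] \<phi>_def
      by (subst set_integral_diff(2)) (auto simp: set_integrable_def intro!: integrable_indicator_times i\<psi> k)
    also have "\<dots> = (LINT u:{s..t}|lebesgue. \<phi> u)" by (rule Ioc) (use i\<phi> in auto)
    finally show "f t - f s = (LINT u:{s..t}|lebesgue. \<phi> u)" .
  qed
qed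


lemma set_integral_eps_small:
  fixes g :: "real \<Rightarrow> real"
  assumes g: "set_integrable lebesgue {a..b} g" and e: "0 < e"
  obtains \<delta> where "0 < \<delta>"
    "\<And>s t. a \<le> s \<Longrightarrow> s \<le> t \<Longrightarrow> t \<le> b \<Longrightarrow> t - s < \<delta> \<Longrightarrow> (LINT u:{s..t}|lebesgue. g u) < e"
proof -
  define G where "G u = indicator {a..b} u * g u" for u
  have G: "integrable lebesgue G" using g by (simp add: set_integrable_def G_def[abs_def])
  obtain \<delta> where \<delta>: "0 < \<delta>"
    "\<And>A. A \<in> sets lebesgue \<Longrightarrow> emeasure lebesgue A < ennreal \<delta> \<Longrightarrow> (LINT x:A|lebesgue. \<bar>G x\<bar>) < e"
    using integral_small_on_small_sets[OF G e] by metis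
  show ?thesis
  proof (rule that[OF \<delta>(1)])
    fix s t assume st: "a \<le> s" "s \<le> t" "t \<le> b" "t - s < \<delta>"
    have sub: "{s..t} \<subseteq> {a..b}" using st by auto
    have "(LINT u:{s..t}|lebesgue. g u) = (LINT u:{s..t}|lebesgue. G u)"
      by (rule set_lebesgue_integral_cong) (use sub in \<open>auto simp: G_def\<close>)
    also have "\<dots> \<le> (LINT u:{s..t}|lebesgue. \<bar>G u\<bar>)"
      using G by (intro set_integral_mono) (auto simp: set_integrable_def intro!: integrable_indicator_times)
    also have "\<dots> < e" using st \<delta>(1) by (intro \<delta>(2)) (auto simp: ennreal_lessI)
    finally show "(LINT u:{s..t}|lebesgue. g u) < e" .
  qed
qed

lemma integrable_imp_set_integrable:
  fixes f :: "'a \<Rightarrow> real"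
  shows "integrable M f \<Longrightarrow> A \<in> sets M \<Longrightarrow> set_integrable M A f"
  unfolding set_integrable_def by (rule integrable_mult_indicator)

lemma set_integral_const_Icc:
  fixes L :: real
  assumes "s \<le> t"
  shows "(LINT u:{s..t}|lebesgue. L) = L * (t - s)" "set_integrable lebesgue {s..t} (\<lambda>_. L)"
proof -
  show "set_integrable lebesgue {s..t} (\<lambda>_. L)"
    unfolding set_integrable_def real_scaleR_def
    by (intro integrable_mult_left integrable_real_indicator) (simp_all add: emeasure_lborel_Icc_eq)
  show "(LINT u:{s..t}|lebesgue. L) = L * (t - s)"
    using assms by (simp add: set_lebesgue_integral_def)
qed

lemma set_integral_Icc_diff:
  fixes f :: "real \<Rightarrow> real"
  assumes f: "set_integrable lebesgue {a..t} f" and st: "a \<le> s" "s \<le> t"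
  shows "(LINT u:{a..t}|lebesgue. f u) - (LINT u:{a..s}|lebesgue. f u) = (LINT u:{s..t}|lebesgue. f u)"
proof -
  have "{a..t} = {a..s} \<union> {s<..t}" using st by auto
  then have "(LINT u:{a..t}|lebesgue. f u) = (LINT u:{a..s} \<union> {s<..t}|lebesgue. f u)" by simp
  also have "\<dots> = (LINT u:{a..s}|lebesgue. f u) + (LINT u:{s<..t}|lebesgue. f u)"
    by (rule set_integral_Un) (use st in \<open>auto intro: set_integrable_subset[OF f]\<close>)
  also have "(LINT u:{s<..t}|lebesgue. f u) = (LINT u:{s..t}|lebesgue. f u)"
    unfolding set_lebesgue_integral_def
  proof (rule integral_cong_AE)
    show "AE u in lebesgue. indicator {s<..t} u *\<^sub>R f u = indicator {s..t} u *\<^sub>R f u"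
      using AE_lebesgue_neq_real[of s] by eventually_elim (auto simp: indicator_def)
    have "set_integrable lebesgue {s<..t} f" "set_integrable lebesgue {s..t} f"
      by (rule set_integrable_subset[OF f]; use st in auto)+
    then show "(\<lambda>u. indicator {s<..t} u *\<^sub>R f u) \<in> borel_measurable lebesgue"
      "(\<lambda>u. indicator {s..t} u *\<^sub>R f u) \<in> borel_measurable lebesgue"
      unfolding set_integrable_def by (auto intro: borel_measurable_integrable)
  qed
  finally show ?thesis by simp
qed

section \<open>The metric speed of absolutely continuous curves\<close>

text \<open>
  The averages over the two-sided family of intervals in the shape in which they occur in the
  generalized speed.
\<close>
lemma AE_interval_averages_tendsto:
  fixes m :: "real \<Rightarrow> real"
  assumes m: "integrable lebesgue m"
  shows "AE u in lebesgue. u \<in> {a<..<b} \<longrightarrow>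
    ((\<lambda>\<delta>. (LINT w:{min u (u + \<delta>)..max u (u + \<delta>)}|lebesgue. m w) / \<bar>\<delta>\<bar>) \<longlongrightarrow> m u) (at 0)"
proof -
  define G where "G t = (LINT w:{a..t}|lebesgue. m w)" for t
  have G: "G t - G s = (LINT w:{s..t}|lebesgue. m w)" if "a \<le> s" "s \<le> t" for s t
    unfolding G_def by (rule set_integral_Icc_diff[OF integrable_imp_set_integrable[OF m] that]) simp
  have "AE u in lebesgue. u \<in> {a<..<b} \<longrightarrow> (G has_real_derivative m u) (at u)"
    by (rule AE_has_derivative_of_integral[OF m]) (use G in auto)
  then show ?thesis
  proof eventually_elim
    case (elim u)
    show ?case
    proof
      assume u: "u \<in> {a<..<b}"
      then have "((\<lambda>\<delta>. (G (u + \<delta>) - G u) / \<delta>) \<longlongrightarrow> m u) (at 0)"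
        using elim by (simp add: DERIV_def)
      moreover have "\<forall>\<^sub>F \<delta> in at 0. (G (u + \<delta>) - G u) / \<delta>
          = (LINT w:{min u (u + \<delta>)..max u (u + \<delta>)}|lebesgue. m w) / \<bar>\<delta>\<bar>"
        using eventually_at_0_shift[OF u]
      proof eventually_elim
        case (elim \<delta>)
        show ?case
        proof (cases "0 \<le> \<delta>")
          case True
          then show ?thesis using G[of u "u + \<delta>"] u by (simp add: min_def max_def)
        next
          case False
          then have "G u - G (u + \<delta>) = (LINT w:{u + \<delta>..u}|lebesgue. m w)"
            using G[of "u + \<delta>" u] u elim by simp
          then show ?thesis using False by (simp add: min_def max_def field_simps)
        qed
      qed
      ultimately show "((\<lambda>\<delta>. (LINT w:{min u (u + \<delta>)..max u (u + \<delta>)}|lebesgue. m w) / \<bar>\<delta>\<bar>) \<longlongrightarrow> m u) (at 0)"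
        by (rule Lim_transform_eventually)
    qed
  qed
qed

text \<open>
  The classical construction of the metric derivative. For rational \<open>q\<close> let \<open>\<phi> q\<close> be the derivative of
  the real function \<open>\<lambda>t. D (\<beta> t) (\<beta> q)\<close>, and let \<open>m\<close> be the supremum of the \<open>\<bar>\<phi> q\<bar>\<close>. Distance
  functions are 1-Lipschitz, so every \<open>\<bar>\<phi> q t\<bar>\<close> is a lower bound for the difference quotients of \<open>\<beta>\<close> in
  the limit. Conversely \<open>D (\<beta> s) (\<beta> t)\<close> is the supremum of the increments
  \<open>\<bar>D (\<beta> t) (\<beta> q) - D (\<beta> s) (\<beta> q)\<bar>\<close>, because \<open>q\<close> may approach \<open>s\<close>; so it is bounded by the integral of
  \<open>m\<close>, and Lebesgue differentiation of that integral makes \<open>m t\<close> an upper bound as well.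
\<close>
lemma metric_derivative:
  fixes D :: "'a \<Rightarrow> 'a \<Rightarrow> real" and \<beta> :: "real \<Rightarrow> 'a"
  assumes D: "Metric_space UNIV D" and ac: "abs_cont D a b \<beta>" and ab: "a < b"
  obtains m where "integrable lebesgue m" "\<And>t. 0 \<le> m t"
    "AE t in lebesgue. t \<in> {a<..<b} \<longrightarrow> ((\<lambda>\<delta>. D (\<beta> (t + \<delta>)) (\<beta> t) / \<bar>\<delta>\<bar>) \<longlongrightarrow> m t) (at 0)"
    "\<And>s t. a \<le> s \<Longrightarrow> s \<le> t \<Longrightarrow> t \<le> b \<Longrightarrow> D (\<beta> s) (\<beta> t) \<le> (LINT u:{s..t}|lebesgue. m u)"
proof -
  interpret D: Metric_space UNIV D by (rule D)
  have tri: "D x z \<le> D x y + D y z" and sym: "D x y = D y x" and nn: "0 \<le> D x y" for x y z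
    using D.triangle D.commute D.nonneg by auto
  obtain g where g: "set_integrable lebesgue {a..b} g"
    and Dg: "\<And>s t. a \<le> s \<Longrightarrow> s \<le> t \<Longrightarrow> t \<le> b \<Longrightarrow> D (\<beta> s) (\<beta> t) \<le> (LINT u:{s..t}|lebesgue. g u)"
    using ac unfolding abs_cont_def by blast
  define Q where "Q = {a..b} \<inter> \<rat>"
  have Q: "countable Q" "Q \<subseteq> {a..b}" by (auto simp: Q_def countable_rat)
  obtain q0 where q0: "q0 \<in> Q" using Rats_dense_in_real[OF ab] by (force simp: Q_def)
  have rev_tri: "\<bar>D x z - D y z\<bar> \<le> D x y" for x y z
    using tri[of x z y] tri[of y z x] sym[of x y] by (simp add: abs_le_iff)
  have "\<exists>\<phi>. integrable lebesgue \<phi> \<and>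
      (\<forall>s t. a \<le> s \<longrightarrow> s \<le> t \<longrightarrow> t \<le> b \<longrightarrow> D (\<beta> t) (\<beta> q) - D (\<beta> s) (\<beta> q) = (LINT u:{s..t}|lebesgue. \<phi> u))" for q
  proof (rule abs_cont_real_imp_integral[OF g, where f = "\<lambda>t. D (\<beta> t) (\<beta> q)"])
    fix s t assume "a \<le> s" "s \<le> t" "t \<le> b"
    then show "\<bar>D (\<beta> t) (\<beta> q) - D (\<beta> s) (\<beta> q)\<bar> \<le> (LINT u:{s..t}|lebesgue. g u)"
      using rev_tri[of "\<beta> s" "\<beta> q" "\<beta> t"] Dg[of s t] by (simp add: abs_minus_commute)
  qed (use ab in auto)
  then obtain \<phi> where \<phi>: "\<And>q. integrable lebesgue (\<phi> q)"
    "\<And>q s t. a \<le> s \<Longrightarrow> s \<le> t \<Longrightarrow> t \<le> b \<Longrightarrow> D (\<beta> t) (\<beta> q) - D (\<beta> s) (\<beta> q) = (LINT u:{s..t}|lebesgue. \<phi> q u)"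
    by metis
  have [measurable]: "\<phi> q \<in> borel_measurable lebesgue" for q using \<phi>(1) by auto
  define gg where "gg u = indicator {a..b} u * g u" for u
  have gg: "integrable lebesgue gg" using g by (simp add: set_integrable_def gg_def[abs_def])
  define Gg where "Gg t = (LINT u:{a..t}|lebesgue. gg u)" for t
  have Gg: "Gg t - Gg s = (LINT u:{s..t}|lebesgue. gg u)" if "a \<le> s" "s \<le> t" for s t
    unfolding Gg_def by (rule set_integral_Icc_diff[OF integrable_imp_set_integrable[OF gg] that]) simp
  have ggg: "(LINT u:{s..t}|lebesgue. g u) = (LINT u:{s..t}|lebesgue. gg u)" if "a \<le> s" "t \<le> b" for s t
    by (rule set_lebesgue_integral_cong) (use that in \<open>auto simp: gg_def\<close>)
  have derG: "AE t in lebesgue. t \<in> {a<..<b} \<longrightarrow> (Gg has_real_derivative gg t) (at t)"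
    by (rule AE_has_derivative_of_integral[OF gg]) (use Gg in auto)
  have "AE t in lebesgue. t \<in> {a<..<b} \<longrightarrow> ((\<lambda>t. D (\<beta> t) (\<beta> q)) has_real_derivative \<phi> q t) (at t)" for q
    by (rule AE_has_derivative_of_integral[OF \<phi>(1)]) (use \<phi>(2) in auto)
  then have der\<phi>: "AE t in lebesgue. \<forall>q\<in>Q. t \<in> {a<..<b} \<longrightarrow> ((\<lambda>t. D (\<beta> t) (\<beta> q)) has_real_derivative \<phi> q t) (at t)"
    by (subst AE_ball_countable[OF Q(1)]) blast
  have quot: "((\<lambda>\<delta>. \<bar>f (t + \<delta>) - f t\<bar> / \<bar>\<delta>\<bar>) \<longlongrightarrow> \<bar>c\<bar>) (at 0)"
    if "(f has_real_derivative c) (at t)" for f :: "real \<Rightarrow> real" and c t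
    using tendsto_rabs[OF that[unfolded DERIV_def]] by (simp add: abs_divide)
  note near0 = eventually_at_0_shift[of _ a b]
  have absint: "D (\<beta> (t + \<delta>)) (\<beta> t) \<le> \<bar>F (t + \<delta>) - F t\<bar>"
    if "t \<in> {a<..<b}" "t + \<delta> \<in> {a<..<b}"
      "\<And>s t. a \<le> s \<Longrightarrow> s \<le> t \<Longrightarrow> t \<le> b \<Longrightarrow> D (\<beta> s) (\<beta> t) \<le> F t - F s" for F t \<delta>
    using that(1,2) that(3)[of t "t + \<delta>"] that(3)[of "t + \<delta>" t] sym[of "\<beta> t" "\<beta> (t + \<delta>)"]
    by (cases "0 \<le> \<delta>") auto
  have lower: "\<bar>D (\<beta> (t + \<delta>)) (\<beta> q) - D (\<beta> t) (\<beta> q)\<bar> \<le> D (\<beta> (t + \<delta>)) (\<beta> t)" for t \<delta> q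
    by (rule rev_tri)
  have bound: "AE t in lebesgue. t \<in> {a<..<b} \<longrightarrow> (\<forall>q\<in>Q. \<bar>\<phi> q t\<bar> \<le> \<bar>gg t\<bar>)"
    using derG der\<phi>
  proof eventually_elim
    case (elim t)
    show ?case
    proof (intro impI ballI)
      fix q assume t: "t \<in> {a<..<b}" and q: "q \<in> Q"
      have 1: "((\<lambda>\<delta>. \<bar>D (\<beta> (t + \<delta>)) (\<beta> q) - D (\<beta> t) (\<beta> q)\<bar> / \<bar>\<delta>\<bar>) \<longlongrightarrow> \<bar>\<phi> q t\<bar>) (at 0)"
        using elim t q by (intro quot[of "\<lambda>t. D (\<beta> t) (\<beta> q)"]) auto
      have 2: "((\<lambda>\<delta>. \<bar>Gg (t + \<delta>) - Gg t\<bar> / \<bar>\<delta>\<bar>) \<longlongrightarrow> \<bar>gg t\<bar>) (at 0)"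
        using elim t by (intro quot) auto
      show "\<bar>\<phi> q t\<bar> \<le> \<bar>gg t\<bar>"
      proof (rule tendsto_le[OF _ 2 1])
        show "\<forall>\<^sub>F \<delta> in at 0. \<bar>D (\<beta> (t + \<delta>)) (\<beta> q) - D (\<beta> t) (\<beta> q)\<bar> / \<bar>\<delta>\<bar> \<le> \<bar>Gg (t + \<delta>) - Gg t\<bar> / \<bar>\<delta>\<bar>"
          using near0[OF t]
        proof eventually_elim
          case (elim \<delta>)
          have "D (\<beta> (t + \<delta>)) (\<beta> t) \<le> \<bar>Gg (t + \<delta>) - Gg t\<bar>"
            using t elim Dg Gg ggg by (intro absint) auto
          then show ?case using lower[of t \<delta> q] by (intro divide_right_mono) auto
        qed
      qed simp
    qed
  qed
  define S where "S t = (SUP q\<in>Q. ereal \<bar>\<phi> q t\<bar>)" for t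
  have [measurable]: "S \<in> borel_measurable lebesgue"
    unfolding S_def using Q(1) by (intro borel_measurable_SUP) auto
  define m where "m t = indicator {a<..<b} t * real_of_ereal (S t)" for t
  have S: "ereal \<bar>\<phi> q t\<bar> \<le> S t" if "q \<in> Q" for q t unfolding S_def using that by (rule SUP_upper)
  have S0: "0 \<le> S t" for t using S[OF q0, of t] by (rule order_trans[rotated]) simp
  have m0: "0 \<le> m t" for t using S0[of t] by (auto simp: m_def real_of_ereal_pos)
  have SB: "AE t in lebesgue. t \<in> {a<..<b} \<longrightarrow> S t = ereal (m t) \<and> m t \<le> \<bar>gg t\<bar>"
    using bound
  proof eventually_elim
    case (elim t)
    show ?case
    proof
      assume t: "t \<in> {a<..<b}"
      then have "S t \<le> ereal \<bar>gg t\<bar>" using elim unfolding S_def by (intro SUP_least) auto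
      then show "S t = ereal (m t) \<and> m t \<le> \<bar>gg t\<bar>"
        using S0[of t] t by (cases "S t") (auto simp: m_def)
    qed
  qed
  have mint: "integrable lebesgue m"
  proof (rule Bochner_Integration.integrable_bound[OF gg])
    show "m \<in> borel_measurable lebesgue" unfolding m_def[abs_def]
      by (intro borel_measurable_times borel_measurable_indicator borel_measurable_real_of_ereal) auto
    show "AE t in lebesgue. norm (m t) \<le> norm (gg t)"
      using SB by eventually_elim (use m0 in \<open>auto simp: m_def indicator_def\<close>)
  qed
  have \<phi>m: "AE t in lebesgue. t \<in> {a<..<b} \<longrightarrow> \<bar>\<phi> q t\<bar> \<le> m t" if "q \<in> Q" for q
    using SB by eventually_elim (metis S[OF that] ereal_less_eq(3))
  have mI: "set_integrable lebesgue A m" if "A \<in> sets lebesgue" for A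
    unfolding set_integrable_def real_scaleR_def by (intro integrable_indicator_times mint that)
  have Dm: "D (\<beta> s) (\<beta> t) \<le> (LINT u:{s..t}|lebesgue. m u)" if st: "a \<le> s" "s \<le> t" "t \<le> b" for s t
  proof (rule field_le_epsilon)
    fix e :: real assume e: "0 < e"
    then have "0 < e / 2" by simp
    then obtain \<delta> where \<delta>: "0 < \<delta>"
      "\<And>s t. a \<le> s \<Longrightarrow> s \<le> t \<Longrightarrow> t \<le> b \<Longrightarrow> t - s < \<delta> \<Longrightarrow> (LINT u:{s..t}|lebesgue. g u) < e / 2"
      using set_integral_eps_small[OF g] by metis
    \<comment> \<open>Moving the reference point from \<open>\<beta> s\<close> to \<open>\<beta> q\<close>, with \<open>q\<close> rational and this close to \<open>s\<close>, changes
      each distance by at most \<open>e / 2\<close>.\<close>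
    have "max a (s - \<delta>) < min b (s + \<delta>)" using ab st \<delta>(1) by auto
    then obtain q where q: "q \<in> \<rat>" "max a (s - \<delta>) < q" "q < min b (s + \<delta>)"
      using Rats_dense_in_real by blast
    then have qQ: "q \<in> Q" by (auto simp: Q_def)
    have "D (\<beta> s) (\<beta> q) < e / 2"
      using q st Dg[of s q] Dg[of q s] \<delta>(2)[of s q] \<delta>(2)[of q s] sym[of "\<beta> s" "\<beta> q"]
      by (cases "s \<le> q") auto
    moreover have "D (\<beta> t) (\<beta> q) - D (\<beta> s) (\<beta> q) \<le> (LINT u:{s..t}|lebesgue. m u)"
      unfolding \<phi>(2)[OF st]
    proof (rule set_integral_mono_AE)
      show "set_integrable lebesgue {s..t} (\<phi> q)"
        unfolding set_integrable_def real_scaleR_def by (intro integrable_indicator_times \<phi>(1)) simp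
      show "AE u\<in>{s..t} in lebesgue. \<phi> q u \<le> m u"
        using \<phi>m[OF qQ] AE_lebesgue_neq_real[of a] AE_lebesgue_neq_real[of b]
        by eventually_elim (use st in auto)
    qed (auto intro: mI)
    ultimately show "D (\<beta> s) (\<beta> t) \<le> (LINT u:{s..t}|lebesgue. m u) + e"
      using tri[of "\<beta> s" "\<beta> t" "\<beta> q"] sym[of "\<beta> q" "\<beta> t"] by simp
  qed
  define Mm where "Mm t = (LINT u:{a..t}|lebesgue. m u)" for t
  have Mm: "Mm t - Mm s = (LINT u:{s..t}|lebesgue. m u)" if "a \<le> s" "s \<le> t" for s t
    unfolding Mm_def by (rule set_integral_Icc_diff[OF integrable_imp_set_integrable[OF mint] that]) simp
  have derM: "AE t in lebesgue. t \<in> {a<..<b} \<longrightarrow> (Mm has_real_derivative m t) (at t)"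
    by (rule AE_has_derivative_of_integral[OF mint]) (use Mm in auto)
  have "AE t in lebesgue. t \<in> {a<..<b} \<longrightarrow> ((\<lambda>\<delta>. D (\<beta> (t + \<delta>)) (\<beta> t) / \<bar>\<delta>\<bar>) \<longlongrightarrow> m t) (at 0)"
    using derM der\<phi> SB
  proof eventually_elim
    case (elim t)
    show ?case
    proof
      assume t: "t \<in> {a<..<b}"
      show "((\<lambda>\<delta>. D (\<beta> (t + \<delta>)) (\<beta> t) / \<bar>\<delta>\<bar>) \<longlongrightarrow> m t) (at 0)"
      proof (rule order_tendstoI)
        fix l assume "l < m t"
        then have "ereal l < S t" using elim t by auto
        then obtain q where q: "q \<in> Q" "l < \<bar>\<phi> q t\<bar>" unfolding S_def by (auto simp: less_SUP_iff)
        have "((\<lambda>\<delta>. \<bar>D (\<beta> (t + \<delta>)) (\<beta> q) - D (\<beta> t) (\<beta> q)\<bar> / \<bar>\<delta>\<bar>) \<longlongrightarrow> \<bar>\<phi> q t\<bar>) (at 0)"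
          using elim t q by (intro quot[of "\<lambda>t. D (\<beta> t) (\<beta> q)"]) auto
        from order_tendstoD(1)[OF this q(2)]
        show "\<forall>\<^sub>F \<delta> in at 0. l < D (\<beta> (t + \<delta>)) (\<beta> t) / \<bar>\<delta>\<bar>"
          by eventually_elim (rule less_le_trans, assumption, rule divide_right_mono, use lower in auto)
      next
        fix r assume r: "m t < r"
        have "((\<lambda>\<delta>. \<bar>Mm (t + \<delta>) - Mm t\<bar> / \<bar>\<delta>\<bar>) \<longlongrightarrow> \<bar>m t\<bar>) (at 0)"
          using elim t by (intro quot) auto
        then have "\<forall>\<^sub>F \<delta> in at 0. \<bar>Mm (t + \<delta>) - Mm t\<bar> / \<bar>\<delta>\<bar> < r"
          using r m0[of t] by (intro order_tendstoD) auto
        then show "\<forall>\<^sub>F \<delta> in at 0. D (\<beta> (t + \<delta>)) (\<beta> t) / \<bar>\<delta>\<bar> < r"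
          using near0[OF t]
        proof eventually_elim
          case (elim \<delta>)
          have "D (\<beta> (t + \<delta>)) (\<beta> t) \<le> \<bar>Mm (t + \<delta>) - Mm t\<bar>"
            using t elim Dm Mm by (intro absint) auto
          then have "D (\<beta> (t + \<delta>)) (\<beta> t) / \<bar>\<delta>\<bar> \<le> \<bar>Mm (t + \<delta>) - Mm t\<bar> / \<bar>\<delta>\<bar>"
            by (intro divide_right_mono) auto
          then show ?case using elim by simp
        qed
      qed
    qed
  qed
  from that[OF mint m0 this Dm] show thesis by blast
qed

text \<open>
  The last property puts the averages in the definition of the generalized speed, for either sign of
  \<open>\<delta>\<close>, in terms of the integrable function \<open>m\<close>. The metric speed equals \<open>m\<close> only almost everywhere, and
  at the other points it may be anything; the completeness of Lebesgue measure makes it measurable.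
\<close>
lemma abs_cont_metric_speed:
  fixes D :: "'a \<Rightarrow> 'a \<Rightarrow> real" and \<beta> :: "real \<Rightarrow> 'a"
  assumes D: "Metric_space UNIV D" and ac: "abs_cont D a b \<beta>" and ab: "a < b"
  obtains m where "integrable lebesgue m" "\<And>t. 0 \<le> m t"
    "AE t in lebesgue. t \<in> {a<..<b} \<longrightarrow> ((\<lambda>\<delta>. D (\<beta> (t + \<delta>)) (\<beta> t) / \<bar>\<delta>\<bar>) \<longlongrightarrow> m t) (at 0)"
    "\<And>s t. a \<le> s \<Longrightarrow> s \<le> t \<Longrightarrow> t \<le> b \<Longrightarrow> D (\<beta> s) (\<beta> t) \<le> (LINT u:{s..t}|lebesgue. m u)"
    "\<And>t \<delta>. t \<in> {a<..<b} \<Longrightarrow> \<delta> \<noteq> 0 \<Longrightarrow> t + \<delta> \<in> {a<..<b} \<Longrightarrow>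
       1 / \<delta> * interval_lebesgue_integral lebesgue (ereal t) (ereal (t + \<delta>)) (metric_speed D \<beta>)
         = (LINT u:{min t (t + \<delta>)..max t (t + \<delta>)}|lebesgue. m u) / \<bar>\<delta>\<bar>"
proof -
  obtain m where m: "integrable lebesgue m" "\<And>t. 0 \<le> m t"
    and lim: "AE t in lebesgue. t \<in> {a<..<b} \<longrightarrow> ((\<lambda>\<delta>. D (\<beta> (t + \<delta>)) (\<beta> t) / \<bar>\<delta>\<bar>) \<longlongrightarrow> m t) (at 0)"
    and Dm: "\<And>s t. a \<le> s \<Longrightarrow> s \<le> t \<Longrightarrow> t \<le> b \<Longrightarrow> D (\<beta> s) (\<beta> t) \<le> (LINT u:{s..t}|lebesgue. m u)"
    by (rule metric_derivative[OF D ac ab]) (rule that)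
  have speed: "AE t in lebesgue. t \<in> {a<..<b} \<longrightarrow> metric_speed D \<beta> t = m t"
    using lim by eventually_elim (auto simp: metric_speed_def intro!: tendsto_Lim)
  have Ioo: "(LINT u:{x<..<y}|lebesgue. metric_speed D \<beta> u) = (LINT u:{x..y}|lebesgue. m u)"
    if "a \<le> x" "y \<le> b" for x y
  proof -
    have AE: "AE u in lebesgue. indicator {x..y} u *\<^sub>R m u = indicator {x<..<y} u *\<^sub>R metric_speed D \<beta> u"
      using speed AE_lebesgue_neq_real[of x] AE_lebesgue_neq_real[of y]
      by eventually_elim (use that in \<open>auto simp: indicator_def\<close>)
    have meas: "(\<lambda>u. indicator {x..y} u *\<^sub>R m u) \<in> borel_measurable lebesgue"
      by (intro borel_measurable_integrable integrable_mult_indicator m) simp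
    have "integral\<^sup>L lebesgue (\<lambda>u. indicator {x..y} u *\<^sub>R m u)
        = integral\<^sup>L lebesgue (\<lambda>u. indicator {x<..<y} u *\<^sub>R metric_speed D \<beta> u)"
      by (rule integral_cong_AE[OF meas borel_measurable_AE[OF meas AE] AE])
    then show ?thesis by (simp add: set_lebesgue_integral_def)
  qed
  have avg: "1 / \<delta> * interval_lebesgue_integral lebesgue (ereal t) (ereal (t + \<delta>)) (metric_speed D \<beta>)
         = (LINT u:{min t (t + \<delta>)..max t (t + \<delta>)}|lebesgue. m u) / \<bar>\<delta>\<bar>"
    if "t \<in> {a<..<b}" "\<delta> \<noteq> 0" "t + \<delta> \<in> {a<..<b}" for t \<delta>
  proof (cases "0 < \<delta>")
    case True
    then show ?thesis using Ioo[of t "t + \<delta>"] that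
      by (simp add: interval_lebesgue_integral_def einterval_eq min_def max_def)
  next
    case False
    then have "\<delta> < 0" using that(2) by simp
    then show ?thesis using Ioo[of "t + \<delta>" t] that
      by (simp add: interval_lebesgue_integral_def einterval_eq min_def max_def)
  qed
  show thesis by (rule that[OF m lim Dm avg])
qed

text \<open>
  The value of \<open>deriv \<alpha>\<close> carries information only where the derivative exists, which is almost
  everywhere.
\<close>
lemma abs_cont_real_derivative:
  fixes \<alpha> :: "real \<Rightarrow> real"
  assumes ac: "abs_cont dist a b \<alpha>" and ab: "a < b"
  shows "set_integrable lebesgue {a..b} (deriv \<alpha>)"
    and "\<And>s t. a \<le> s \<Longrightarrow> s \<le> t \<Longrightarrow> t \<le> b \<Longrightarrow> \<alpha> t - \<alpha> s = (LINT u:{s..t}|lebesgue. deriv \<alpha> u)"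
proof -
  obtain g where g: "set_integrable lebesgue {a..b} g"
      "\<And>s t. a \<le> s \<Longrightarrow> s \<le> t \<Longrightarrow> t \<le> b \<Longrightarrow> dist (\<alpha> s) (\<alpha> t) \<le> (LINT u:{s..t}|lebesgue. g u)"
    using ac unfolding abs_cont_def by blast
  have "\<exists>\<phi>. integrable lebesgue \<phi> \<and>
    (\<forall>s t. a \<le> s \<longrightarrow> s \<le> t \<longrightarrow> t \<le> b \<longrightarrow> \<alpha> t - \<alpha> s = (LINT u:{s..t}|lebesgue. \<phi> u))"
    by (rule abs_cont_real_imp_integral[OF g(1), of \<alpha>])
      (use ab g(2) in \<open>auto simp: dist_real_def abs_minus_commute\<close>)
  then obtain \<phi> where \<phi>: "integrable lebesgue \<phi>"
    "\<And>s t. a \<le> s \<Longrightarrow> s \<le> t \<Longrightarrow> t \<le> b \<Longrightarrow> \<alpha> t - \<alpha> s = (LINT u:{s..t}|lebesgue. \<phi> u)"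
    by blast
  have der: "AE t in lebesgue. t \<in> {a<..<b} \<longrightarrow> deriv \<alpha> t = \<phi> t"
    using AE_has_derivative_of_integral[OF \<phi>, of a b] by (auto elim!: eventually_mono intro: DERIV_imp_deriv)
  have AE: "AE u in lebesgue. indicator {s..t} u *\<^sub>R \<phi> u = indicator {s..t} u *\<^sub>R deriv \<alpha> u"
    if "a \<le> s" "t \<le> b" for s t
    using der AE_lebesgue_neq_real[of a] AE_lebesgue_neq_real[of b]
    by eventually_elim (use that in \<open>auto simp: indicator_def\<close>)
  have meas: "(\<lambda>u. indicator {s..t} u *\<^sub>R \<phi> u) \<in> borel_measurable lebesgue" for s t
    by (intro borel_measurable_integrable integrable_mult_indicator \<phi>) simp
  note meas' = borel_measurable_AE[OF meas AE]
  have "integrable lebesgue (\<lambda>u. indicator {a..b} u *\<^sub>R \<phi> u)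
      = integrable lebesgue (\<lambda>u. indicator {a..b} u *\<^sub>R deriv \<alpha> u)"
    by (rule integrable_cong_AE[OF meas meas' AE]) auto
  then show "set_integrable lebesgue {a..b} (deriv \<alpha>)"
    unfolding set_integrable_def using integrable_mult_indicator[OF _ \<phi>(1), of "{a..b}"] by simp
  show "\<alpha> t - \<alpha> s = (LINT u:{s..t}|lebesgue. deriv \<alpha> u)" if "a \<le> s" "s \<le> t" "t \<le> b" for s t
    unfolding \<phi>(2)[OF that] set_lebesgue_integral_def
    by (rule integral_cong_AE[OF meas meas' AE]) (use that in auto)
qed

text \<open>
  A continuous primitive of the integrable bound is easier to reparametrize than the bound itself.
\<close>
lemma abs_cont_primitive:
  assumes "abs_cont D a b c"
  obtains F where "continuous_on {a..b} F"
    "\<And>s t. a \<le> s \<Longrightarrow> s \<le> t \<Longrightarrow> t \<le> b \<Longrightarrow> D (c s) (c t) \<le> F t - F s"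
proof -
  obtain g where g: "set_integrable lebesgue {a..b} g"
      "\<And>s t. a \<le> s \<Longrightarrow> s \<le> t \<Longrightarrow> t \<le> b \<Longrightarrow> D (c s) (c t) \<le> (LINT u:{s..t}|lebesgue. g u)"
    using assms unfolding abs_cont_def by blast
  define F where "F t = (LINT u:{a..t}|lebesgue. g u)" for t
  have F: "F t - F s = (LINT u:{s..t}|lebesgue. g u)" if "a \<le> s" "s \<le> t" "t \<le> b" for s t
    unfolding F_def
    by (rule set_integral_Icc_diff[OF set_integrable_subset[OF g(1)]]) (use that in auto)
  have "continuous_on {a..b} F"
    unfolding continuous_on_iff
  proof (intro ballI allI impI)
    fix x e :: real assume x: "x \<in> {a..b}" and e: "0 < e"
    have "set_integrable lebesgue {a..b} (\<lambda>u. \<bar>g u\<bar>)" using g(1) by (rule set_integrable_abs)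
    from set_integral_eps_small[OF this e]
    obtain \<delta> where \<delta>: "0 < \<delta>"
      "\<And>s t. a \<le> s \<Longrightarrow> s \<le> t \<Longrightarrow> t \<le> b \<Longrightarrow> t - s < \<delta> \<Longrightarrow> (LINT u:{s..t}|lebesgue. \<bar>g u\<bar>) < e"
      by metis
    have small: "\<bar>F t - F s\<bar> < e" if "a \<le> s" "s \<le> t" "t \<le> b" "t - s < \<delta>" for s t
    proof -
      have "set_integrable lebesgue {s..t} g" by (rule set_integrable_subset[OF g(1)]) (use that in auto)
      then have "\<bar>LINT u:{s..t}|lebesgue. g u\<bar> \<le> (LINT u:{s..t}|lebesgue. \<bar>g u\<bar>)"
        unfolding set_integrable_def set_lebesgue_integral_def
        using integral_norm_bound[of lebesgue "\<lambda>u. indicator {s..t} u *\<^sub>R g u"] by (simp add: abs_mult)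
      then show ?thesis using \<delta>(2)[OF that] F[of s t] that by simp
    qed
    show "\<exists>\<delta>>0. \<forall>x'\<in>{a..b}. dist x' x < \<delta> \<longrightarrow> dist (F x') (F x) < e"
    proof (intro exI[of _ \<delta>] conjI ballI impI \<delta>(1))
      fix y assume y: "y \<in> {a..b}" "dist y x < \<delta>"
      then show "dist (F y) (F x) < e"
        using small[of x y] small[of y x] x by (cases "x \<le> y") (auto simp: dist_real_def abs_minus_commute)
    qed
  qed
  then show thesis using that F g(2) by simp
qed

lemma abs_cont_real_continuous_on:
  fixes c :: "real \<Rightarrow> real"
  assumes "abs_cont dist a b c"
  shows "continuous_on {a..b} c"
proof -
  obtain F where F: "continuous_on {a..b} F"
    "\<And>s t. a \<le> s \<Longrightarrow> s \<le> t \<Longrightarrow> t \<le> b \<Longrightarrow> dist (c s) (c t) \<le> F t - F s"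
    using abs_cont_primitive[OF assms] by metis
  have le: "dist (c y) (c x) \<le> dist (F y) (F x)" if "x \<in> {a..b}" "y \<in> {a..b}" for x y
    using F(2)[of x y] F(2)[of y x] that by (cases "x \<le> y") (auto simp: dist_real_def)
  show ?thesis
    unfolding continuous_on_iff
  proof (intro ballI allI impI)
    fix x e :: real assume x: "x \<in> {a..b}" and "0 < e"
    then obtain \<delta> where "0 < \<delta>" "\<And>y. y \<in> {a..b} \<Longrightarrow> dist y x < \<delta> \<Longrightarrow> dist (F y) (F x) < e"
      using F(1) unfolding continuous_on_iff by blast
    then show "\<exists>\<delta>>0. \<forall>y\<in>{a..b}. dist y x < \<delta> \<longrightarrow> dist (c y) (c x) < e"
      using le[OF x] le_less_trans by blast
  qed
qed

section \<open>Length metrics\<close>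

lemma le_length_metric: "ennreal (D x y) \<le> length_metric D x y"
  unfolding length_metric_def
proof (rule Inf_greatest)
  fix l assume "l \<in> {curve_length D 0 1 c | c. continuous_map (top_of_set {0..1}) (Metric_space.mtopology UNIV D) c
    \<and> c 0 = x \<and> c 1 = y}"
  then obtain c where c: "l = curve_length D 0 1 c" "c 0 = x" "c 1 = y" by blast
  have "(\<Sum>i<1. ennreal (D (c (of_nat i)) (c (of_nat (Suc i))))) \<le> curve_length D 0 1 c"
    unfolding curve_length_def
    by (rule Sup_upper) (auto intro!: exI[of _ "1::nat"] exI[of _ "of_nat :: nat \<Rightarrow> real"] simp: partition_points_def)
  then show "ennreal (D x y) \<le> l" using c by simp
qed

lemma partition_points_mono:
  assumes "partition_points a b N t" "i \<le> j" "j \<le> N"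
  shows "t i \<le> t j"
  using assms(2,3)
proof (induction j rule: dec_induct)
  case (step n)
  then have "t n < t (Suc n)" using assms(1) by (auto simp: partition_points_def)
  then show ?case using step by simp
qed simp

text \<open>
  The sums in the length of \<open>c\<close> are bounded by telescoping sums of increments of \<open>F\<close>.
\<close>
lemma length_metric_le:
  fixes c :: "real \<Rightarrow> 'a"
  assumes D: "Metric_space UNIV D"
    and c: "\<And>s t. 0 \<le> s \<Longrightarrow> s \<le> t \<Longrightarrow> t \<le> 1 \<Longrightarrow> D (c s) (c t) \<le> F t - F s"
    and F: "continuous_on {0..1} F"
  shows "length_metric D (c 0) (c 1) \<le> ennreal (F 1 - F 0)"
proof -
  interpret D: Metric_space UNIV D by (rule D)
  have "continuous_map (top_of_set {0..1}) D.mtopology c"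
    unfolding D.continuous_map_to_metric
  proof (intro ballI allI impI)
    fix x e :: real assume x: "x \<in> topspace (top_of_set {0..1})" and e: "0 < e"
    then have x: "x \<in> {0..1}" by simp
    obtain \<delta> where \<delta>: "0 < \<delta>" "\<And>y. y \<in> {0..1} \<Longrightarrow> dist y x < \<delta> \<Longrightarrow> dist (F y) (F x) < e"
      using F x e unfolding continuous_on_iff by blast
    have mem: "c y \<in> D.mball (c x) e" if "y \<in> {0..1} \<inter> ball x \<delta>" for y
    proof -
      have "D (c x) (c y) \<le> \<bar>F y - F x\<bar>"
        using c[of x y] c[of y x] that x D.commute[of "c x" "c y"] by (cases "x \<le> y") auto
      then show ?thesis using \<delta>(2)[of y] that by (auto simp: dist_commute dist_real_def)
    qed
    show "\<exists>U. openin (top_of_set {0..1}) U \<and> x \<in> U \<and> (\<forall>y\<in>U. c y \<in> D.mball (c x) e)"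
      by (intro exI[of _ "{0..1} \<inter> ball x \<delta>"]) (use x \<delta>(1) mem in auto)
  qed
  then have "length_metric D (c 0) (c 1) \<le> curve_length D 0 1 c"
    unfolding length_metric_def by (intro Inf_lower) blast
  also have "\<dots> \<le> ennreal (F 1 - F 0)"
    unfolding curve_length_def
  proof (rule Sup_least)
    fix l assume "l \<in> {\<Sum>i<N. ennreal (D (c (t i)) (c (t (Suc i)))) |N t. partition_points 0 1 N t}"
    then obtain N t where l: "l = (\<Sum>i<N. ennreal (D (c (t i)) (c (t (Suc i)))))" and t: "partition_points 0 1 N t"
      by blast
    have tt: "0 \<le> t i" "t i \<le> t (Suc i)" "t (Suc i) \<le> 1" if "i < N" for i
      using partition_points_mono[OF t, of 0 i] partition_points_mono[OF t, of i "Suc i"]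
        partition_points_mono[OF t, of "Suc i" N] that t by (auto simp: partition_points_def)
    have "l = ennreal (\<Sum>i<N. D (c (t i)) (c (t (Suc i))))"
      unfolding l by (rule sum_ennreal) simp
    also have "\<dots> \<le> ennreal (\<Sum>i<N. F (t (Suc i)) - F (t i))"
      using c tt by (intro ennreal_leI sum_mono) auto
    also have "(\<Sum>i<N. F (t (Suc i)) - F (t i)) = F 1 - F 0"
      using t sum_lessThan_telescope[of "\<lambda>i. F (t i)" N] by (simp add: partition_points_def)
    finally show "l \<le> ennreal (F 1 - F 0)" .
  qed
  finally show ?thesis .
qed

section \<open>Speed bounds\<close>

text \<open>
  The log-Lipschitz condition multiplied out, which avoids quotients with a vanishing denominator.
\<close>
definition log_lipschitz_on :: "(real \<Rightarrow> 'a \<Rightarrow> 'a \<Rightarrow> real) \<Rightarrow> real set \<Rightarrow> 'a set \<Rightarrow> real \<Rightarrow> real \<Rightarrow> bool" where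
  "log_lipschitz_on d J K C r \<longleftrightarrow> 0 < C \<and> 0 < r \<and> (\<forall>s\<in>J. \<forall>s'\<in>J. \<forall>x\<in>K. \<forall>y\<in>K.
     d s' x y < r \<longrightarrow> d s x y \<le> exp (C * \<bar>s - s'\<bar>) * d s' x y)"

lemma log_lipschitz_onD:
  assumes "log_lipschitz_on d J K C r"
  shows "0 < C" "0 < r"
    "s \<in> J \<Longrightarrow> s' \<in> J \<Longrightarrow> x \<in> K \<Longrightarrow> y \<in> K \<Longrightarrow> d s' x y < r \<Longrightarrow> d s x y \<le> exp (C * \<bar>s - s'\<bar>) * d s' x y"
  using assms unfolding log_lipschitz_on_def by blast+

text \<open>
  An upper bound \<open>B\<close> for the pointwise Lipschitz constant of \<open>\<beta>\<close>, where the distance to \<open>\<beta> t\<close> is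
  measured by the metric at the time \<open>\<alpha> t\<close>. The bound is imposed at every point and involves no
  integrals, so no derivatives have to be controlled when curves converge. Continuity is a separate
  requirement because the topology of the space may be finer than that of the metric \<open>d (\<alpha> t)\<close>.
\<close>
definition speed_bound :: "(real \<Rightarrow> 'a \<Rightarrow> 'a \<Rightarrow> real) \<Rightarrow> (real \<Rightarrow> real) \<Rightarrow> (real \<Rightarrow> 'a::topological_space) \<Rightarrow>
    real set \<Rightarrow> (real \<Rightarrow> real) \<Rightarrow> bool" where
  "speed_bound d \<alpha> \<beta> S B \<longleftrightarrow> continuous_on S \<beta> \<and>
     (\<forall>t\<in>S. \<forall>e>0. \<exists>\<delta>>0. \<forall>t'\<in>S. \<bar>t' - t\<bar> < \<delta> \<longrightarrow> d (\<alpha> t) (\<beta> t) (\<beta> t') \<le> (B t + e) * \<bar>t' - t\<bar>)"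

lemma speed_bound_continuous: "speed_bound d \<alpha> \<beta> S B \<Longrightarrow> continuous_on S \<beta>"
  by (simp add: speed_bound_def)

lemma speed_bound_subset: "speed_bound d \<alpha> \<beta> S B \<Longrightarrow> T \<subseteq> S \<Longrightarrow> speed_bound d \<alpha> \<beta> T B"
  unfolding speed_bound_def by (meson continuous_on_subset subsetD)

section \<open>The topology of the base space\<close>

text \<open>
  The interval is nonempty so that there is at least one metric to separate points.
\<close>
locale cone_data =
  fixes I :: "real set" and h :: "real \<Rightarrow> 'a::topological_space \<Rightarrow> real" and d :: "real \<Rightarrow> 'a \<Rightarrow> 'a \<Rightarrow> real"
  assumes X: "locally_compact_space (euclidean :: 'a topology)"
    and I: "open I" "is_interval I"
    and I_ne: "I \<noteq> {}"
    and h_cont: "continuous_on (I \<times> UNIV) (\<lambda>(s, x). h s x)"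
    and h_pos: "\<And>s x. s \<in> I \<Longrightarrow> 0 < h s x"
    and d_metric: "\<And>s. s \<in> I \<Longrightarrow> Metric_space UNIV (d s)"
    and d_top: "\<And>s. s \<in> I \<Longrightarrow> generates_topology (length_metric (d s))"
    and d_log_lipschitz:
      "\<And>J K. compact J \<Longrightarrow> J \<subseteq> I \<Longrightarrow> compact K \<Longrightarrow>
         \<exists>C>0. \<exists>r>0. \<forall>s\<in>J. \<forall>s'\<in>J. \<forall>x\<in>K. \<forall>y\<in>K.
           x \<noteq> y \<and> (INF u\<in>J. d u x y) < r \<longrightarrow>
           \<bar>ln (d s x y / d s' x y)\<bar> \<le> C * \<bar>s - s'\<bar>"
begin

lemma d_nonneg: "s \<in> I \<Longrightarrow> 0 \<le> d s x y"
  and d_sym: "s \<in> I \<Longrightarrow> d s x y = d s y x"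
  and d_tri: "s \<in> I \<Longrightarrow> d s x z \<le> d s x y + d s y z"
  and d_eq_0: "s \<in> I \<Longrightarrow> d s x y = 0 \<longleftrightarrow> x = y"
proof -
  assume "s \<in> I"
  then interpret M: Metric_space UNIV "d s" by (rule d_metric)
  show "0 \<le> d s x y" "d s x y = d s y x" "d s x z \<le> d s x y + d s y z" "d s x y = 0 \<longleftrightarrow> x = y"
    using M.commute M.triangle by auto
qed

lemma d_self: "s \<in> I \<Longrightarrow> d s x x = 0"
  using d_eq_0 by simp

text \<open>
  A length metric dominates the metric it comes from, so its topology is the finer one.
\<close>
lemma open_d_ball:
  assumes s: "s \<in> I"
  shows "open {y. d s x y < e}"
proof -
  have "\<exists>e'>0. {z. length_metric (d s) y z < e'} \<subseteq> {y. d s x y < e}" if y: "d s x y < e" for y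
  proof (intro exI[of _ "ennreal (e - d s x y)"] conjI subsetI CollectI)
    fix z assume "z \<in> {z. length_metric (d s) y z < ennreal (e - d s x y)}"
    then have "ennreal (d s y z) < ennreal (e - d s x y)"
      using le_length_metric[of "d s" y z] by simp
    then have "d s y z < e - d s x y" using d_nonneg[OF s] by (simp add: ennreal_less_iff)
    then show "d s x z < e" using d_tri[OF s, of x z y] by simp
  qed (use y in simp)
  then show ?thesis using d_top[OF s] unfolding generates_topology_def by simp
qed

lemma d_tendsto_0:
  assumes s: "s \<in> I" and f: "(f \<longlongrightarrow> l) F"
  shows "((\<lambda>u. d s (f u) l) \<longlongrightarrow> 0) F"
proof (rule tendstoI)
  fix e :: real assume "0 < e"
  then have "\<forall>\<^sub>F u in F. f u \<in> {y. d s l y < e}"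
    using open_d_ball[OF s] f d_self[OF s] by (intro topological_tendstoD) auto
  then show "\<forall>\<^sub>F u in F. dist (d s (f u) l) 0 < e"
    by eventually_elim (use d_nonneg[OF s] d_sym[OF s] in simp)
qed

lemma d_tendsto:
  assumes s: "s \<in> I" and f: "(f \<longlongrightarrow> l) F" and g: "(g \<longlongrightarrow> k) F"
  shows "((\<lambda>u. d s (f u) (g u)) \<longlongrightarrow> d s l k) F"
proof (rule Lim_transform2[OF tendsto_const])
  show "((\<lambda>u. d s l k - d s (f u) (g u)) \<longlongrightarrow> 0) F"
  proof (rule tendsto_0_le[where K = 1])
    show "((\<lambda>u. d s (f u) l + d s (g u) k) \<longlongrightarrow> 0) F"
      using tendsto_add[OF d_tendsto_0[OF s f] d_tendsto_0[OF s g]] by simp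
    show "\<forall>\<^sub>F u in F. norm (d s l k - d s (f u) (g u)) \<le> norm (d s (f u) l + d s (g u) k) * 1"
    proof (rule always_eventually, intro allI)
      fix u
      show "norm (d s l k - d s (f u) (g u)) \<le> norm (d s (f u) l + d s (g u) k) * 1"
        using d_tri[OF s, of l k "f u"] d_tri[OF s, of "f u" k "g u"] d_tri[OF s, of "f u" "g u" l] d_tri[OF s, of l "g u" k]
          d_sym[OF s, of l "f u"] d_sym[OF s, of k "g u"] d_nonneg[OF s]
        by (simp add: abs_le_iff)
    qed
  qed
qed

lemma d_shift_tendsto_0:
  fixes t :: real
  assumes s: "s \<in> I" and cont: "continuous_on {a..b} \<beta>" and t: "t \<in> {a<..<b}"
  shows "((\<lambda>\<delta>. d s (\<beta> (t + \<delta>)) (\<beta> t)) \<longlongrightarrow> 0) (at 0)"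
proof (rule d_tendsto_0[OF s])
  have "(\<beta> \<longlongrightarrow> \<beta> t) (at t within {a<..<b})"
    using cont t unfolding continuous_on_def
    by (intro tendsto_within_subset[where S = "{a..b}" and T = "{a<..<b}"]) auto
  then have "(\<beta> \<longlongrightarrow> \<beta> t) (at t)"
    using t at_within_open[of t "{a<..<b}"] by simp
  then show "((\<lambda>\<delta>. \<beta> (t + \<delta>)) \<longlongrightarrow> \<beta> t) (at 0)"
    by (rule LIM_offset_zero)
qed

lemma Hausdorff: "Hausdorff_space (euclidean :: 'a topology)"
  unfolding Hausdorff_space_def
proof (intro allI impI)
  fix x y :: 'a assume xy: "x \<in> topspace euclidean \<and> y \<in> topspace euclidean \<and> x \<noteq> y"
  obtain s where s: "s \<in> I" using I_ne by blast
  define e where "e = d s x y / 2"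
  have e: "0 < e" using xy d_nonneg[OF s, of x y] d_eq_0[OF s, of x y] by (auto simp: e_def)
  have "disjnt {z. d s x z < e} {z. d s y z < e}"
  proof -
    have False if "d s x z < e" "d s y z < e" for z
      using that d_tri[OF s, of x y z] d_sym[OF s, of y z] by (simp add: e_def)
    then show ?thesis by (auto simp: disjnt_iff)
  qed
  then show "\<exists>U V. openin euclidean U \<and> openin euclidean V \<and> x \<in> U \<and> y \<in> V \<and> disjnt U V"
    using open_d_ball[OF s] e d_self[OF s]
    by (intro exI[of _ "{z. d s x z < e}"] exI[of _ "{z. d s y z < e}"]) auto
qed

lemma compact_closed: "compact (K :: 'a set) \<Longrightarrow> closed K"
  using compactin_imp_closedin[OF Hausdorff, of K] by simp

lemma compact_neighbourhood:
  assumes "compact (K :: 'a set)"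
  obtains U L where "open U" "compact L" "closed L" "K \<subseteq> U" "U \<subseteq> L"
proof -
  have "compactin euclidean K" using assms by simp
  then obtain U L where "openin euclidean U" "compactin euclidean L" "closedin euclidean L" "K \<subseteq> U" "U \<subseteq> L"
    using X unfolding locally_compact_space_compact_closed_compact[OF disjI1[OF Hausdorff]] by blast
  then show thesis using that by simp
qed

text \<open>
  On a compact set the topology of the space and that of each single metric agree: outside \<open>U\<close> the
  distance to \<open>z\<close> is bounded below.
\<close>
lemma compact_d_small_imp_in_open:
  assumes s: "s \<in> I" and K: "compact K" and U: "open U" "z \<in> U"
  obtains e where "0 < e" "\<And>y. y \<in> K \<Longrightarrow> d s z y < e \<Longrightarrow> y \<in> U"
proof (cases "K - U = {}")
  case True
  then show ?thesis using that[of 1] by auto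
next
  case False
  have "compact (K - U)" using K U(1) by (rule compact_diff)
  moreover have "continuous_on (K - U) (\<lambda>y. d s z y)"
    unfolding continuous_on_def by (intro ballI d_tendsto[OF s] tendsto_const tendsto_ident_at)
  ultimately obtain y where y: "y \<in> K - U" "\<And>w. w \<in> K - U \<Longrightarrow> d s z y \<le> d s z w"
    using continuous_attains_inf[OF _ False] by meson
  have "0 < d s z y" using y(1) U d_nonneg[OF s, of z y] d_eq_0[OF s, of z y] by auto
  moreover have "w \<in> U" if "w \<in> K" "d s z w < d s z y" for w
    using y(2)[of w] that by auto
  ultimately show ?thesis using that by blast
qed

lemma tendsto_if_d_tendsto_0:
  assumes s: "s \<in> I" and K: "compact K" and fK: "\<forall>\<^sub>F u in F. f u \<in> K"
    and f: "((\<lambda>u. d s (f u) l) \<longlongrightarrow> 0) F"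
  shows "(f \<longlongrightarrow> l) F"
proof (rule topological_tendstoI)
  fix U assume "open U" "l \<in> U"
  then obtain e where e: "0 < e" "\<And>y. y \<in> K \<Longrightarrow> d s l y < e \<Longrightarrow> y \<in> U"
    using compact_d_small_imp_in_open[OF s K] by metis
  show "\<forall>\<^sub>F u in F. f u \<in> U"
    using order_tendstoD(2)[OF f e(1)] fK
    by eventually_elim (use e(2) d_sym[OF s] in auto)
qed

text \<open>
  The topology is that of the length metric, and the curve itself joins \<open>\<beta> x\<close> to \<open>\<beta> y\<close>: their length
  distance is at most the increment of a primitive. The sign of \<open>y - x\<close> accounts for the case where this
  piece of the curve is run backwards.
\<close>
lemma abs_cont_imp_continuous_on:
  assumes s: "s \<in> I" and ac: "abs_cont (d s) a b \<beta>"
  shows "continuous_on {a..b} \<beta>"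
  unfolding continuous_on_topological
proof (intro ballI allI impI)
  fix x B assume x: "x \<in> {a..b}" and B: "open B" "\<beta> x \<in> B"
  have "open B \<longleftrightarrow> (\<forall>x\<in>B. \<exists>e>0. {y. length_metric (d s) x y < e} \<subseteq> B)"
    using d_top[OF s] unfolding generates_topology_def by (rule spec)
  then have "\<forall>x\<in>B. \<exists>e>0. {y. length_metric (d s) x y < e} \<subseteq> B"
    using B(1) by (rule iffD1)
  from this[rule_format, OF B(2)] obtain e
    where e: "e > 0" "{y. length_metric (d s) (\<beta> x) y < e} \<subseteq> B"
    by (elim exE conjE)
  obtain F where F: "continuous_on {a..b} F"
    "\<And>s' t. a \<le> s' \<Longrightarrow> s' \<le> t \<Longrightarrow> t \<le> b \<Longrightarrow> d s (\<beta> s') (\<beta> t) \<le> F t - F s'"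
    using abs_cont_primitive[OF ac] by metis
  have le: "length_metric (d s) (\<beta> x) (\<beta> y) \<le> ennreal \<bar>F y - F x\<bar>" if y: "y \<in> {a..b}" for y
  proof -
    define p where "p u = x + u * (y - x)" for u
    have p: "p u \<in> {a..b}" if "u \<in> {0..1}" for u
    proof -
      have "p u = (1 - u) * x + u * y" by (simp add: p_def algebra_simps)
      then show ?thesis
        using that convexD_alt[OF convex_real_interval(5) x y, of u] by simp
    qed
    have cp: "continuous_on {0..1} (\<lambda>u. F (p u))"
    proof (rule continuous_on_compose2[OF F(1)])
      show "continuous_on {0..1} p" unfolding p_def by (intro continuous_intros)
    qed (use p in blast)
    have "length_metric (d s) (\<beta> (p 0)) (\<beta> (p 1)) \<le> ennreal (sgn (y - x) * F (p 1) - sgn (y - x) * F (p 0))"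
    proof (rule length_metric_le[OF d_metric[OF s]])
      fix u v :: real assume uv: "0 \<le> u" "u \<le> v" "v \<le> 1"
      have mono: "x \<le> y \<Longrightarrow> p u \<le> p v" "y \<le> x \<Longrightarrow> p v \<le> p u"
        using uv by (simp_all add: p_def mult_right_mono mult_right_mono_neg)
      show "d s (\<beta> (p u)) (\<beta> (p v)) \<le> sgn (y - x) * F (p v) - sgn (y - x) * F (p u)"
      proof (cases "x < y")
        case True
        then show ?thesis using F(2)[of "p u" "p v"] p[of u] p[of v] uv mono(1) by simp
      next
        case False
        show ?thesis
        proof (cases "x = y")
          case True
          then show ?thesis using d_self[OF s] by (simp add: p_def)
        next
          case neq: False
          with False have "y < x" by simp
          then show ?thesis
            using F(2)[of "p v" "p u"] p[of u] p[of v] uv mono(2) d_sym[OF s] by simp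
        qed
      qed
    qed (intro continuous_intros cp)
    also have "\<dots> \<le> ennreal \<bar>F y - F x\<bar>"
      by (rule ennreal_leI) (auto simp: p_def sgn_if)
    finally show ?thesis by (simp add: p_def)
  qed
  have "((\<lambda>y. F y - F x) \<longlongrightarrow> F x - F x) (at x within {a..b})"
    using F(1) x by (intro tendsto_intros) (auto simp: continuous_on_def)
  then have "((\<lambda>y. \<bar>F y - F x\<bar>) \<longlongrightarrow> 0) (at x within {a..b})"
    using tendsto_rabs_zero by simp
  then have "((\<lambda>y. ennreal \<bar>F y - F x\<bar>) \<longlongrightarrow> ennreal 0) (at x within {a..b})"
    by (rule tendsto_ennrealI)
  then have "\<forall>\<^sub>F y in at x within {a..b}. ennreal \<bar>F y - F x\<bar> < e"
    using e(1) by (intro order_tendstoD) auto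
  then obtain A where A: "open A" "x \<in> A" "\<And>y. y \<in> A \<Longrightarrow> y \<noteq> x \<Longrightarrow> y \<in> {a..b} \<Longrightarrow> ennreal \<bar>F y - F x\<bar> < e"
    unfolding eventually_at_topological by auto
  show "\<exists>A. open A \<and> x \<in> A \<and> (\<forall>y\<in>{a..b}. y \<in> A \<longrightarrow> \<beta> y \<in> B)"
  proof (intro exI[of _ A] conjI ballI impI A(1,2))
    fix y assume y: "y \<in> {a..b}" "y \<in> A"
    show "\<beta> y \<in> B"
    proof (cases "y = x")
      case False
      then have "length_metric (d s) (\<beta> x) (\<beta> y) < e" using A(3)[OF y(2) _ y(1)] le[OF y(1)] by (auto intro: le_less_trans)
      then show ?thesis using e(2) by blast
    qed (use B in simp)
  qed
qed

end

section \<open>Distances and generalized speed under a speed bound\<close>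

context cone_data
begin

lemma ex_log_lipschitz_on:
  assumes J: "compact J" "J \<subseteq> I" and K: "compact K"
  obtains C r where "log_lipschitz_on d J K C r"
proof -
  from d_log_lipschitz[OF J K] obtain C r where Cr: "0 < C" "0 < r"
    and ll: "\<forall>s\<in>J. \<forall>s'\<in>J. \<forall>x\<in>K. \<forall>y\<in>K. x \<noteq> y \<and> (INF u\<in>J. d u x y) < r \<longrightarrow>
      \<bar>ln (d s x y / d s' x y)\<bar> \<le> C * \<bar>s - s'\<bar>"
    by (elim exE conjE)
  have "d s x y \<le> exp (C * \<bar>s - s'\<bar>) * d s' x y"
    if s: "s \<in> J" "s' \<in> J" and xy: "x \<in> K" "y \<in> K" "d s' x y < r" for s s' x y
  proof (cases "x = y")
    case True
    then show ?thesis using s by (simp add: d_self subsetD[OF J(2)])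
  next
    case False
    have sI: "s \<in> I" "s' \<in> I" using s J(2) by auto
    have pos: "0 < d s x y" "0 < d s' x y"
      using d_nonneg[of s x y] d_nonneg[of s' x y] d_eq_0[of s x y] d_eq_0[of s' x y] False sI by auto
    have "bdd_below ((\<lambda>u. d u x y) ` J)"
      using d_nonneg J(2) by (intro bdd_belowI2[of _ 0]) auto
    then have "(INF u\<in>J. d u x y) \<le> d s' x y" using s(2) by (rule cINF_lower)
    then have "ln (d s x y / d s' x y) \<le> C * \<bar>s - s'\<bar>"
      using bspec[OF bspec[OF bspec[OF bspec[OF ll s(1)] s(2)] xy(1)] xy(2)] xy(3) False by auto
    then have "exp (ln (d s x y / d s' x y)) \<le> exp (C * \<bar>s - s'\<bar>)" by simp
    then have "d s x y / d s' x y \<le> exp (C * \<bar>s - s'\<bar>)" using pos by simp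
    then show ?thesis using pos by (simp add: field_simps)
  qed
  then have "log_lipschitz_on d J K C r" using Cr by (simp add: log_lipschitz_on_def)
  then show thesis by (rule that)
qed

text \<open>
  From infinitesimal to actual distances. Near a parameter \<open>x\<close> the curve moves, measured by
  \<open>d (\<alpha> x)\<close>, by at most \<open>B x + \<eta>\<close> times the change of the parameter, hence by at most
  \<open>exp (C * \<delta>) * (H + \<eta>)\<close> times that change in the fixed metric \<open>d s\<close>. Being estimates in a single
  metric, these local bounds can be chained by the triangle inequality.
\<close>
lemma d_le_of_speed_bound:
  assumes ll: "log_lipschitz_on d J K C r" and J: "J \<subseteq> I" and sb: "speed_bound d \<alpha> \<beta> {c..e} B" and ce: "c \<le> e"
    and K: "\<beta> ` {c..e} \<subseteq> K" and \<alpha>: "\<alpha> ` {c..e} \<subseteq> J"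
    and H: "\<And>u. u \<in> {c..e} \<Longrightarrow> B u \<le> H" and s: "s \<in> J" and \<delta>: "\<And>u. u \<in> {c..e} \<Longrightarrow> \<bar>s - \<alpha> u\<bar> \<le> \<delta>"
  shows "d s (\<beta> c) (\<beta> e) \<le> exp (C * \<delta>) * H * (e - c)"
proof -
  note C = log_lipschitz_onD[OF ll]
  have sI: "s \<in> I" using s J by auto
  have approx: "d s (\<beta> c) (\<beta> e) \<le> exp (C * \<delta>) * (H + \<eta>) * (e - c)" if \<eta>: "0 < \<eta>" for \<eta>
  proof -
    let ?L = "exp (C * \<delta>) * (H + \<eta>)"
    define P where "P x y \<longleftrightarrow> (c \<le> x \<longrightarrow> y \<le> e \<longrightarrow> d s (\<beta> x) (\<beta> y) \<le> ?L * (y - x))" for x y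
    have "P c e"
      using ce
    proof (induction rule: Bolzano)
      case (trans x y z)
      show ?case
        unfolding P_def
      proof (intro impI)
        assume xz: "c \<le> x" "z \<le> e"
        then have "d s (\<beta> x) (\<beta> y) \<le> ?L * (y - x)" "d s (\<beta> y) (\<beta> z) \<le> ?L * (z - y)"
          using trans xz by (auto simp: P_def)
        moreover have "?L * (y - x) + ?L * (z - y) = ?L * (z - x)" by (simp add: algebra_simps)
        ultimately show "d s (\<beta> x) (\<beta> z) \<le> ?L * (z - x)"
          using d_tri[OF sI, of "\<beta> x" "\<beta> z" "\<beta> y"] by linarith
      qed
    next
      case (local x)
      then have x: "x \<in> {c..e}" by simp
      have \<alpha>x: "\<alpha> x \<in> J" "\<alpha> x \<in> I" using x \<alpha> J by (auto simp: image_subset_iff)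
      obtain \<delta>1 where \<delta>1: "0 < \<delta>1" "\<And>t'. t' \<in> {c..e} \<Longrightarrow> \<bar>t' - x\<bar> < \<delta>1 \<Longrightarrow>
          d (\<alpha> x) (\<beta> x) (\<beta> t') \<le> (B x + \<eta>) * \<bar>t' - x\<bar>"
        using sb x \<eta> unfolding speed_bound_def by meson
      have "(\<beta> \<longlongrightarrow> \<beta> x) (at x within {c..e})"
        using speed_bound_continuous[OF sb] x by (simp add: continuous_on_def)
      then have "((\<lambda>t. d (\<alpha> x) (\<beta> t) (\<beta> x)) \<longlongrightarrow> 0) (at x within {c..e})"
        by (rule d_tendsto_0[OF \<alpha>x(2)])
      then have "\<forall>\<^sub>F t in at x within {c..e}. d (\<alpha> x) (\<beta> t) (\<beta> x) < r"
        using C(2) by (rule order_tendstoD)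
      then obtain \<delta>2 where \<delta>2: "0 < \<delta>2" "\<And>t. t \<in> {c..e} \<Longrightarrow> t \<noteq> x \<Longrightarrow> \<bar>t - x\<bar> < \<delta>2 \<Longrightarrow> d (\<alpha> x) (\<beta> t) (\<beta> x) < r"
        unfolding eventually_at dist_real_def by blast
      have step: "d s (\<beta> x) (\<beta> t) \<le> ?L * \<bar>t - x\<bar>" if t: "t \<in> {c..e}" "\<bar>t - x\<bar> < min \<delta>1 \<delta>2" for t
      proof -
        have "d (\<alpha> x) (\<beta> x) (\<beta> t) < r"
          using \<delta>2(2)[of t] t C(2) d_self[OF \<alpha>x(2)] d_sym[OF \<alpha>x(2)] by (cases "t = x") auto
        then have "d s (\<beta> x) (\<beta> t) \<le> exp (C * \<bar>s - \<alpha> x\<bar>) * d (\<alpha> x) (\<beta> x) (\<beta> t)"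
          using x t K \<alpha>x s by (intro C(3)) auto
        also have "\<dots> \<le> exp (C * \<delta>) * d (\<alpha> x) (\<beta> x) (\<beta> t)"
          using \<delta>[OF x] C(1) d_nonneg[OF \<alpha>x(2)] by (intro mult_right_mono) auto
        also have "\<dots> \<le> exp (C * \<delta>) * ((H + \<eta>) * \<bar>t - x\<bar>)"
        proof (rule mult_left_mono)
          have "d (\<alpha> x) (\<beta> x) (\<beta> t) \<le> (B x + \<eta>) * \<bar>t - x\<bar>" using \<delta>1(2) t by auto
          also have "\<dots> \<le> (H + \<eta>) * \<bar>t - x\<bar>" using H[OF x] by (intro mult_right_mono) auto
          finally show "d (\<alpha> x) (\<beta> x) (\<beta> t) \<le> (H + \<eta>) * \<bar>t - x\<bar>" .
        qed simp
        finally show ?thesis by (simp add: mult.assoc)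
      qed
      show ?case
        unfolding P_def
      proof (intro exI[of _ "min \<delta>1 \<delta>2"] conjI allI impI)
        fix y z assume yz: "y \<le> x \<and> x \<le> z \<and> z - y < min \<delta>1 \<delta>2" and cyz: "c \<le> y" "z \<le> e"
        have 1: "d s (\<beta> x) (\<beta> y) \<le> ?L * (x - y)" using step[of y] yz cyz x by auto
        have 2: "d s (\<beta> x) (\<beta> z) \<le> ?L * (z - x)" using step[of z] yz cyz x by auto
        have "?L * (x - y) + ?L * (z - x) = ?L * (z - y)" by (simp add: algebra_simps)
        then show "d s (\<beta> y) (\<beta> z) \<le> ?L * (z - y)"
          using 1 2 d_tri[OF sI, of "\<beta> y" "\<beta> z" "\<beta> x"] d_sym[OF sI, of "\<beta> x" "\<beta> y"] by linarith
      qed (use \<delta>1(1) \<delta>2(1) in simp)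
    qed
    then show ?thesis by (simp add: P_def)
  qed
  show ?thesis
  proof (rule tendsto_lowerbound)
    show "((\<lambda>\<eta>. exp (C * \<delta>) * (H + \<eta>) * (e - c)) \<longlongrightarrow> exp (C * \<delta>) * H * (e - c)) (at_right 0)"
      by (auto intro!: tendsto_eq_intros)
    show "\<forall>\<^sub>F \<eta> in at_right 0. d s (\<beta> c) (\<beta> e) \<le> exp (C * \<delta>) * (H + \<eta>) * (e - c)"
      using approx by (auto simp: eventually_at_filter)
  qed simp
qed

lemma speed_bound_lipschitz:
  assumes ab: "a \<le> b" and \<alpha>: "continuous_on {a..b} \<alpha>" "\<alpha> ` {a..b} \<subseteq> I" and sb: "speed_bound d \<alpha> \<beta> {a..b} B"
    and B: "continuous_on {a..b} B" and s: "s \<in> I"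
  obtains L where "\<And>x y. a \<le> x \<Longrightarrow> x \<le> y \<Longrightarrow> y \<le> b \<Longrightarrow> d s (\<beta> x) (\<beta> y) \<le> L * (y - x)"
proof -
  let ?J = "insert s (\<alpha> ` {a..b})"
  have J: "compact ?J" "?J \<subseteq> I" using \<alpha> s by (auto intro!: compact_insert compact_continuous_image)
  have K: "compact (\<beta> ` {a..b})"
    using speed_bound_continuous[OF sb] by (intro compact_continuous_image) auto
  obtain C r where ll: "log_lipschitz_on d ?J (\<beta> ` {a..b}) C r" by (rule ex_log_lipschitz_on[OF J K])
  have ne: "{a..b} \<noteq> {}" using ab by simp
  obtain u0 where u0: "\<And>u. u \<in> {a..b} \<Longrightarrow> B u \<le> B u0"
    using continuous_attains_sup[OF compact_Icc ne B] by blast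
  have "continuous_on {a..b} (\<lambda>u. \<bar>s - \<alpha> u\<bar>)" by (intro continuous_intros \<alpha>)
  from continuous_attains_sup[OF compact_Icc ne this]
  obtain u1 where u1: "\<And>u. u \<in> {a..b} \<Longrightarrow> \<bar>s - \<alpha> u\<bar> \<le> \<bar>s - \<alpha> u1\<bar>" by blast
  show thesis
  proof (rule that)
    fix x y assume xy: "a \<le> x" "x \<le> y" "y \<le> b"
    then have sub: "{x..y} \<subseteq> {a..b}" by auto
    show "d s (\<beta> x) (\<beta> y) \<le> exp (C * \<bar>s - \<alpha> u1\<bar>) * B u0 * (y - x)"
      by (rule d_le_of_speed_bound[OF ll J(2) speed_bound_subset[OF sb sub] xy(2)])
        (use sub u0 u1 in \<open>auto simp: image_subset_iff\<close>)
  qed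
qed

lemma speed_bound_abs_cont:
  assumes ab: "a \<le> b" and \<alpha>: "continuous_on {a..b} \<alpha>" "\<alpha> ` {a..b} \<subseteq> I" and sb: "speed_bound d \<alpha> \<beta> {a..b} B"
    and B: "continuous_on {a..b} B" and s: "s \<in> I"
  shows "abs_cont (d s) a b \<beta>"
proof -
  obtain L where L: "\<And>x y. a \<le> x \<Longrightarrow> x \<le> y \<Longrightarrow> y \<le> b \<Longrightarrow> d s (\<beta> x) (\<beta> y) \<le> L * (y - x)"
    using speed_bound_lipschitz[OF assms] by blast
  show ?thesis
    unfolding abs_cont_def
    by (intro exI[of _ "\<lambda>_. L"]) (use ab L set_integral_const_Icc in auto)
qed

text \<open>
  At almost every \<open>u\<close> the metric speed for \<open>d (\<alpha> t)\<close> is at most \<open>f u = exp (C * \<bar>\<alpha> t - \<alpha> u\<bar>) * B u\<close>.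
  Since \<open>f\<close> is continuous with \<open>f t = B t\<close>, the averages over small intervals at \<open>t\<close> have upper limit at
  most \<open>B t\<close>, for every \<open>t\<close> in the interior.
\<close>
lemma gen_speed_bounds:
  assumes ab: "a < b" and \<alpha>: "continuous_on {a..b} \<alpha>" "\<alpha> ` {a..b} \<subseteq> I" and sb: "speed_bound d \<alpha> \<beta> {a..b} B"
    and B: "continuous_on {a..b} B" and t: "t \<in> {a<..<b}"
  shows "0 \<le> gen_speed d \<beta> (\<alpha> t) t" and "gen_speed d \<beta> (\<alpha> t) t \<le> ereal (B t)"
proof -
  let ?J = "\<alpha> ` {a..b}" and ?K = "\<beta> ` {a..b}"
  have J: "compact ?J" "?J \<subseteq> I" using \<alpha> by (auto intro!: compact_continuous_image)
  have K: "compact ?K"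
    using speed_bound_continuous[OF sb] by (intro compact_continuous_image) auto
  obtain C r where ll: "log_lipschitz_on d ?J ?K C r" by (rule ex_log_lipschitz_on[OF J K])
  note C = log_lipschitz_onD[OF ll]
  define s where "s = \<alpha> t"
  have s: "s \<in> I" "s \<in> ?J" using t \<alpha> by (auto simp: s_def)
  obtain m where m: "integrable lebesgue m" "\<And>t. 0 \<le> m t"
    and lim: "AE t in lebesgue. t \<in> {a<..<b} \<longrightarrow> ((\<lambda>\<delta>. d s (\<beta> (t + \<delta>)) (\<beta> t) / \<bar>\<delta>\<bar>) \<longlongrightarrow> m t) (at 0)"
    and avg: "\<And>t \<delta>. t \<in> {a<..<b} \<Longrightarrow> \<delta> \<noteq> 0 \<Longrightarrow> t + \<delta> \<in> {a<..<b} \<Longrightarrow>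
       1 / \<delta> * interval_lebesgue_integral lebesgue (ereal t) (ereal (t + \<delta>)) (metric_speed (d s) \<beta>)
         = (LINT u:{min t (t + \<delta>)..max t (t + \<delta>)}|lebesgue. m u) / \<bar>\<delta>\<bar>"
    by (rule abs_cont_metric_speed[OF d_metric[OF s(1)] speed_bound_abs_cont[OF less_imp_le[OF ab] \<alpha> sb B s(1)] ab])
      (rule that)
  define f where "f u = exp (C * \<bar>s - \<alpha> u\<bar>) * B u" for u
  have f: "continuous_on {a..b} f" unfolding f_def by (intro continuous_intros \<alpha> B)
  have mf: "AE u in lebesgue. u \<in> {a<..<b} \<longrightarrow> m u \<le> f u"
    using lim
  proof eventually_elim
    case (elim u)
    show ?case
    proof
      assume u: "u \<in> {a<..<b}"
      then have u': "u \<in> {a..b}" by simp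
      have \<alpha>u: "\<alpha> u \<in> I" "\<alpha> u \<in> ?J" using u \<alpha>(2) by auto
      note near = eventually_at_0_shift[OF u]
      have bound: "m u \<le> exp (C * \<bar>s - \<alpha> u\<bar>) * (B u + \<eta>)" if \<eta>: "0 < \<eta>" for \<eta>
      proof (rule tendsto_upperbound)
        show "((\<lambda>\<delta>. d s (\<beta> (u + \<delta>)) (\<beta> u) / \<bar>\<delta>\<bar>) \<longlongrightarrow> m u) (at 0)" using elim u by blast
        obtain \<delta>1 where \<delta>1: "0 < \<delta>1" "\<And>t'. t' \<in> {a..b} \<Longrightarrow> \<bar>t' - u\<bar> < \<delta>1 \<Longrightarrow>
            d (\<alpha> u) (\<beta> u) (\<beta> t') \<le> (B u + \<eta>) * \<bar>t' - u\<bar>"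
          using sb u' \<eta> unfolding speed_bound_def by meson
        have small: "\<forall>\<^sub>F \<delta> in at 0. d (\<alpha> u) (\<beta> (u + \<delta>)) (\<beta> u) < r"
          using d_shift_tendsto_0[OF \<alpha>u(1) speed_bound_continuous[OF sb] u] C(2) by (rule order_tendstoD)
        have "\<forall>\<^sub>F \<delta> in at 0. \<bar>\<delta>\<bar> < \<delta>1"
          using \<delta>1(1) by (auto simp: eventually_at dist_real_def)
        moreover have "\<forall>\<^sub>F \<delta> in at (0::real). \<delta> \<noteq> 0" by (simp add: eventually_at_filter)
        ultimately show "\<forall>\<^sub>F \<delta> in at 0. d s (\<beta> (u + \<delta>)) (\<beta> u) / \<bar>\<delta>\<bar> \<le> exp (C * \<bar>s - \<alpha> u\<bar>) * (B u + \<eta>)"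
          using small near
        proof eventually_elim
          case (elim \<delta>)
          have "d s (\<beta> (u + \<delta>)) (\<beta> u) \<le> exp (C * \<bar>s - \<alpha> u\<bar>) * d (\<alpha> u) (\<beta> (u + \<delta>)) (\<beta> u)"
            using elim u' \<alpha>u s by (intro C(3)) auto
          also have "\<dots> \<le> exp (C * \<bar>s - \<alpha> u\<bar>) * ((B u + \<eta>) * \<bar>\<delta>\<bar>)"
            using \<delta>1(2)[of "u + \<delta>"] elim d_sym[OF \<alpha>u(1)] by (intro mult_left_mono) auto
          finally show ?case using elim by (simp add: divide_le_eq mult.assoc)
        qed
      qed simp
      show "m u \<le> f u"
      proof (rule tendsto_lowerbound)
        show "((\<lambda>\<eta>. exp (C * \<bar>s - \<alpha> u\<bar>) * (B u + \<eta>)) \<longlongrightarrow> f u) (at_right 0)"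
          unfolding f_def by (auto intro!: tendsto_eq_intros)
        show "\<forall>\<^sub>F \<eta> in at_right 0. m u \<le> exp (C * \<bar>s - \<alpha> u\<bar>) * (B u + \<eta>)"
          using bound by (auto simp: eventually_at_filter)
      qed simp
    qed
  qed
  have near: "\<forall>\<^sub>F \<delta> in at 0. t + \<delta> \<in> {a<..<b} \<and> \<delta> \<noteq> 0"
    using eventually_at_0_shift[OF t] by (rule eventually_conj) (simp add: eventually_at_filter)
  let ?avg = "\<lambda>\<delta>. 1 / \<delta> * interval_lebesgue_integral lebesgue (ereal t) (ereal (t + \<delta>)) (metric_speed (d s) \<beta>)"
  have nn: "\<forall>\<^sub>F \<delta> in at 0. 0 \<le> ereal (?avg \<delta>)"
    using near
  proof eventually_elim
    case (elim \<delta>)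
    have "0 \<le> (LINT u:{min t (t + \<delta>)..max t (t + \<delta>)}|lebesgue. m u)"
      unfolding set_lebesgue_integral_def by (rule Bochner_Integration.integral_nonneg) (simp add: m)
    then show ?case using avg[OF t] elim by simp
  qed
  show "0 \<le> gen_speed d \<beta> (\<alpha> t) t"
    unfolding gen_speed_def s_def[symmetric] using nn by (intro le_Limsup) auto
  have "Limsup (at 0) (\<lambda>\<delta>. ereal (?avg \<delta>)) \<le> ereal (B t) + ereal \<eta>" if \<eta>: "0 < \<eta>" for \<eta>
  proof (rule Limsup_bounded)
    have "f t < B t + \<eta>" using \<eta> by (simp add: f_def s_def)
    moreover have "(f \<longlongrightarrow> f t) (at t within {a..b})"
      using f t by (simp add: continuous_on_def)
    ultimately have "\<forall>\<^sub>F u in at t within {a..b}. f u < B t + \<eta>" by (auto intro: order_tendstoD)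
    then obtain \<delta>0 where \<delta>0: "0 < \<delta>0" "\<And>u. u \<in> {a..b} \<Longrightarrow> u \<noteq> t \<Longrightarrow> \<bar>u - t\<bar> < \<delta>0 \<Longrightarrow> f u < B t + \<eta>"
      unfolding eventually_at dist_real_def by blast
    then have fB: "f u \<le> B t + \<eta>" if "u \<in> {a..b}" "\<bar>u - t\<bar> < \<delta>0" for u
      using that \<open>f t < B t + \<eta>\<close> by (cases "u = t") (auto intro: less_imp_le)
    have "\<forall>\<^sub>F \<delta> in at 0. \<bar>\<delta>\<bar> < \<delta>0"
      using \<delta>0(1) by (auto simp: eventually_at dist_real_def)
    then show "\<forall>\<^sub>F \<delta> in at 0. ereal (?avg \<delta>) \<le> ereal (B t) + ereal \<eta>"
      using near
    proof eventually_elim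
      case (elim \<delta>)
      let ?x = "min t (t + \<delta>)" and ?y = "max t (t + \<delta>)"
      have xy: "?x \<le> ?y" "a \<le> ?x" "?y \<le> b" "?y - ?x = \<bar>\<delta>\<bar>" using elim t by auto
      have "(LINT u:{?x..?y}|lebesgue. m u) \<le> (LINT u:{?x..?y}|lebesgue. B t + \<eta>)"
      proof (rule set_integral_mono_AE)
        show "set_integrable lebesgue {?x..?y} m" using m(1) by (rule integrable_imp_set_integrable) simp
        show "set_integrable lebesgue {?x..?y} (\<lambda>u. B t + \<eta>)" using xy(1) by (rule set_integral_const_Icc)
        show "AE u\<in>{?x..?y} in lebesgue. m u \<le> B t + \<eta>"
          using mf AE_lebesgue_neq_real[of a] AE_lebesgue_neq_real[of b]
        proof eventually_elim
          case (elim u)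
          show ?case
          proof
            assume u: "u \<in> {?x..?y}"
            then have "u \<in> {a..b}" "\<bar>u - t\<bar> < \<delta>0" using xy \<open>\<bar>\<delta>\<bar> < \<delta>0\<close> by auto
            then have "u \<in> {a<..<b}" using elim(2,3) by auto
            then have "m u \<le> f u" using elim(1) by (rule rev_mp)
            also have "f u \<le> B t + \<eta>" using \<open>u \<in> {a..b}\<close> \<open>\<bar>u - t\<bar> < \<delta>0\<close> by (rule fB)
            finally show "m u \<le> B t + \<eta>" .
          qed
        qed
      qed
      also have "\<dots> = (B t + \<eta>) * \<bar>\<delta>\<bar>" using set_integral_const_Icc(1)[OF xy(1), of "B t + \<eta>"] xy(4) by simp
      finally have "?avg \<delta> \<le> B t + \<eta>" using avg[OF t, of \<delta>] elim by (simp add: divide_le_eq)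
      then show ?case by simp
    qed
  qed
  then show "gen_speed d \<beta> (\<alpha> t) t \<le> ereal (B t)"
    unfolding gen_speed_def s_def[symmetric] by (rule ereal_le_epsilon2)
qed

lemma h_continuous_on:
  assumes "continuous_on S \<alpha>" "continuous_on S \<beta>" "\<alpha> ` S \<subseteq> I"
  shows "continuous_on S (\<lambda>u. h (\<alpha> u) (\<beta> u))"
proof -
  have "continuous_on S (\<lambda>u. (case (\<alpha> u, \<beta> u) of (s, x) \<Rightarrow> h s x))"
    by (rule continuous_on_compose2[OF h_cont]) (use assms in \<open>auto intro: continuous_on_Pair\<close>)
  then show ?thesis by simp
qed

end

section \<open>Causal curves parametrized by time\<close>

lemma ereal_sq_le_imp_le:
  fixes x :: ereal
  assumes "ereal c \<le> x" "0 \<le> c" "x\<^sup>2 \<le> ereal (k\<^sup>2)" "0 \<le> k"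
  shows "c \<le> k"
proof (cases x)
  case (real y)
  then have "y\<^sup>2 \<le> k\<^sup>2" "c \<le> y" using assms by auto
  then show ?thesis using assms(4) power2_le_imp_le by fastforce
qed (use assms in auto)

lemma future_causal_curveD:
  assumes fc: "future_causal_curve I h d a b \<alpha> \<beta>"
  shows "a < b" "\<alpha> ` {a..b} \<subseteq> I" "abs_cont dist a b \<alpha>" "\<And>s. s \<in> I \<Longrightarrow> abs_cont (d s) a b \<beta>"
    "AE t in lebesgue. t \<in> {a..b} \<longrightarrow> 0 < deriv \<alpha> t"
    "AE t in lebesgue. t \<in> {a..b} \<longrightarrow>
        (gen_speed d \<beta> (\<alpha> t) t)\<^sup>2 \<le> ereal ((h (\<alpha> t) (\<beta> t))\<^sup>2 * (deriv \<alpha> t)\<^sup>2)"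
proof -
  note fc' = fc[unfolded future_causal_curve_def abs_cont_family_def]
  show "a < b" "\<alpha> ` {a..b} \<subseteq> I" "abs_cont dist a b \<alpha>"
    "AE t in lebesgue. t \<in> {a..b} \<longrightarrow> 0 < deriv \<alpha> t"
    "AE t in lebesgue. t \<in> {a..b} \<longrightarrow>
        (gen_speed d \<beta> (\<alpha> t) t)\<^sup>2 \<le> ereal ((h (\<alpha> t) (\<beta> t))\<^sup>2 * (deriv \<alpha> t)\<^sup>2)"
    using fc' by blast+
  show "abs_cont (d s) a b \<beta>" if "s \<in> I" for s
    using fc' that by (elim conjE) (rule bspec)
qed

context cone_data
begin

text \<open>
  For a causal curve the metric at which the generalized speed is taken changes with the parameter, so
  null sets that depend on this metric would be useless. The lemma compares with one fixed metric \<open>d s\<close>: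
  the condition \<open>mean\<close> on \<open>u\<close> involves only the metric derivative \<open>m\<close> for \<open>d s\<close>, whereas \<open>s'\<close> is
  arbitrary.
\<close>
lemma gen_speed_ge_metric_speed:
  assumes s: "s \<in> I" and s': "s' \<in> I" and u: "u \<in> {a<..<b}"
    and ac: "abs_cont (d s) a b \<beta>" "abs_cont (d s') a b \<beta>"
    and ll: "log_lipschitz_on d J (\<beta> ` {a..b}) C r" "s \<in> J" "s' \<in> J"
    and m: "integrable lebesgue m"
    and lim: "AE t in lebesgue. t \<in> {a<..<b} \<longrightarrow> ((\<lambda>\<delta>. d s (\<beta> (t + \<delta>)) (\<beta> t) / \<bar>\<delta>\<bar>) \<longlongrightarrow> m t) (at 0)"
    and mean: "((\<lambda>\<delta>. (LINT w:{min u (u + \<delta>)..max u (u + \<delta>)}|lebesgue. m w) / \<bar>\<delta>\<bar>) \<longlongrightarrow> m u) (at 0)"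
  shows "ereal (m u / exp (C * \<bar>s - s'\<bar>)) \<le> gen_speed d \<beta> s' u"
proof -
  note C = log_lipschitz_onD[OF ll(1)]
  define E where "E = exp (C * \<bar>s - s'\<bar>)"
  have E: "0 < E" by (simp add: E_def)
  have ab: "a < b" using u by auto
  obtain m' where m': "integrable lebesgue m'" "\<And>t. 0 \<le> m' t"
    and lim': "AE t in lebesgue. t \<in> {a<..<b} \<longrightarrow> ((\<lambda>\<delta>. d s' (\<beta> (t + \<delta>)) (\<beta> t) / \<bar>\<delta>\<bar>) \<longlongrightarrow> m' t) (at 0)"
    and avg: "\<And>t \<delta>. t \<in> {a<..<b} \<Longrightarrow> \<delta> \<noteq> 0 \<Longrightarrow> t + \<delta> \<in> {a<..<b} \<Longrightarrow>
       1 / \<delta> * interval_lebesgue_integral lebesgue (ereal t) (ereal (t + \<delta>)) (metric_speed (d s') \<beta>)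
         = (LINT u:{min t (t + \<delta>)..max t (t + \<delta>)}|lebesgue. m' u) / \<bar>\<delta>\<bar>"
    by (rule abs_cont_metric_speed[OF d_metric[OF s'] ac(2) ab]) (rule that)
  have cont: "continuous_on {a..b} \<beta>" by (rule abs_cont_imp_continuous_on[OF s ac(1)])
  have le: "AE t in lebesgue. t \<in> {a<..<b} \<longrightarrow> m t \<le> E * m' t"
    using lim lim'
  proof eventually_elim
    case (elim t)
    show ?case
    proof
      assume t: "t \<in> {a<..<b}"
      have small: "\<forall>\<^sub>F \<delta> in at 0. d s' (\<beta> (t + \<delta>)) (\<beta> t) < r"
        using d_shift_tendsto_0[OF s' cont t] C(2) by (rule order_tendstoD)
      note near = eventually_at_0_shift[OF t]
      show "m t \<le> E * m' t"
      proof (rule tendsto_le)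
        show "((\<lambda>\<delta>. d s (\<beta> (t + \<delta>)) (\<beta> t) / \<bar>\<delta>\<bar>) \<longlongrightarrow> m t) (at 0)" using elim(1) t by blast
        show "((\<lambda>\<delta>. E * (d s' (\<beta> (t + \<delta>)) (\<beta> t) / \<bar>\<delta>\<bar>)) \<longlongrightarrow> E * m' t) (at 0)"
          using elim(2) t by (intro tendsto_mult_left) blast
        show "\<forall>\<^sub>F \<delta> in at 0. d s (\<beta> (t + \<delta>)) (\<beta> t) / \<bar>\<delta>\<bar> \<le> E * (d s' (\<beta> (t + \<delta>)) (\<beta> t) / \<bar>\<delta>\<bar>)"
          using small near
        proof eventually_elim
          case (elim \<delta>)
          have "d s (\<beta> (t + \<delta>)) (\<beta> t) \<le> E * d s' (\<beta> (t + \<delta>)) (\<beta> t)"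
          proof -
            have "t \<in> {a..b}" "t + \<delta> \<in> {a..b}" using elim t by auto
            then show ?thesis unfolding E_def using elim(1) by (intro C(3) ll(2,3) imageI)
          qed
          then show ?case by (simp add: divide_right_mono)
        qed
      qed simp
    qed
  qed
  let ?mean = "\<lambda>f \<delta>. (LINT w:{min u (u + \<delta>)..max u (u + \<delta>)}|lebesgue. f w) / \<bar>\<delta>\<bar>"
  note near = eventually_at_0_shift[OF u]
  have nz: "\<forall>\<^sub>F \<delta> in at (0::real). \<delta> \<noteq> 0" by (simp add: eventually_at_filter)
  have "((\<lambda>\<delta>. ?mean m \<delta> / E) \<longlongrightarrow> m u / E) (at 0)"
    by (intro tendsto_divide mean tendsto_const) (use E in simp)
  then have "((\<lambda>\<delta>. ereal (?mean m \<delta> / E)) \<longlongrightarrow> ereal (m u / E)) (at 0)" by (rule tendsto_ereal)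
  then have "ereal (m u / E) = Limsup (at 0) (\<lambda>\<delta>. ereal (?mean m \<delta> / E))"
    by (rule lim_imp_Limsup[symmetric, rotated]) simp
  also have "\<dots> \<le> gen_speed d \<beta> s' u"
    unfolding gen_speed_def
  proof (rule Limsup_mono)
    show "\<forall>\<^sub>F \<delta> in at 0. ereal (?mean m \<delta> / E) \<le> ereal (1 / \<delta> *
        interval_lebesgue_integral lebesgue (ereal u) (ereal (u + \<delta>)) (metric_speed (d s') \<beta>))"
      using near nz
    proof eventually_elim
      case (elim \<delta>)
      let ?A = "{min u (u + \<delta>)..max u (u + \<delta>)}"
      have sub: "?A \<subseteq> {a<..<b}" using u elim by auto
      have "(LINT w:?A|lebesgue. m w) \<le> (LINT w:?A|lebesgue. E * m' w)"
      proof (rule set_integral_mono_AE)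
        show "set_integrable lebesgue ?A m" using m by (rule integrable_imp_set_integrable) simp
        show "set_integrable lebesgue ?A (\<lambda>w. E * m' w)"
          using m'(1) by (intro integrable_imp_set_integrable integrable_mult_right) auto
        show "AE w\<in>?A in lebesgue. m w \<le> E * m' w"
          using le by eventually_elim (use sub in blast)
      qed
      then have "(LINT w:?A|lebesgue. m w) \<le> E * (LINT w:?A|lebesgue. m' w)" by simp
      then have "(LINT w:?A|lebesgue. m w) / E \<le> (LINT w:?A|lebesgue. m' w)"
        using E by (simp add: divide_le_eq mult.commute)
      then have "(LINT w:?A|lebesgue. m w) / E / \<bar>\<delta>\<bar> \<le> (LINT w:?A|lebesgue. m' w) / \<bar>\<delta>\<bar>"
        by (rule divide_right_mono) simp
      moreover have "u + \<delta> \<in> {a<..<b}" using u elim by auto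
      ultimately show ?case using avg[OF u, of \<delta>] elim by (simp add: mult.commute)
    qed
  qed
  finally show ?thesis by (simp add: E_def)
qed

text \<open>
  The metric derivative for \<open>d s\<close> is at most \<open>exp (C * \<bar>s - \<alpha> u\<bar>) * h (\<alpha> u) (\<beta> u) * deriv \<alpha> u\<close> almost
  everywhere, and \<open>\<alpha>\<close> is the integral of its derivative.
\<close>
lemma causal_curve_d_le:
  assumes fc: "future_causal_curve I h d a b \<alpha> \<beta>"
    and ll: "log_lipschitz_on d (\<alpha> ` {a..b}) (\<beta> ` {a..b}) C r"
    and t: "a \<le> t0" "t0 \<le> t1" "t1 \<le> b" and s: "s \<in> \<alpha> ` {a..b}"
    and H: "\<And>u. u \<in> {t0..t1} \<Longrightarrow> exp (C * \<bar>s - \<alpha> u\<bar>) * h (\<alpha> u) (\<beta> u) \<le> H"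
  shows "d s (\<beta> t0) (\<beta> t1) \<le> H * (\<alpha> t1 - \<alpha> t0)"
proof -
  have ab: "a < b" and \<alpha>I: "\<alpha> ` {a..b} \<subseteq> I" and ac\<alpha>: "abs_cont dist a b \<alpha>"
    and ac\<beta>: "\<And>s. s \<in> I \<Longrightarrow> abs_cont (d s) a b \<beta>"
    and pos: "AE t in lebesgue. t \<in> {a..b} \<longrightarrow> 0 < deriv \<alpha> t"
    and speed: "AE t in lebesgue. t \<in> {a..b} \<longrightarrow>
        (gen_speed d \<beta> (\<alpha> t) t)\<^sup>2 \<le> ereal ((h (\<alpha> t) (\<beta> t))\<^sup>2 * (deriv \<alpha> t)\<^sup>2)"
    by (rule future_causal_curveD[OF fc]; assumption)+
  have sI: "s \<in> I" using s \<alpha>I by auto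
  obtain m where m: "integrable lebesgue m" "\<And>t. 0 \<le> m t"
    and lim: "AE t in lebesgue. t \<in> {a<..<b} \<longrightarrow> ((\<lambda>\<delta>. d s (\<beta> (t + \<delta>)) (\<beta> t) / \<bar>\<delta>\<bar>) \<longlongrightarrow> m t) (at 0)"
    and Dm: "\<And>t t'. a \<le> t \<Longrightarrow> t \<le> t' \<Longrightarrow> t' \<le> b \<Longrightarrow> d s (\<beta> t) (\<beta> t') \<le> (LINT u:{t..t'}|lebesgue. m u)"
    by (rule abs_cont_metric_speed[OF d_metric[OF sI] ac\<beta>[OF sI] ab]) (rule that)
  have bound: "AE u in lebesgue. u \<in> {t0..t1} \<longrightarrow> m u \<le> H * deriv \<alpha> u"
    using AE_interval_averages_tendsto[OF m(1), of a b] pos speed AE_lebesgue_neq_real[of a] AE_lebesgue_neq_real[of b]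
  proof eventually_elim
    case (elim u)
    show ?case
    proof
      assume u: "u \<in> {t0..t1}"
      then have uab: "u \<in> {a<..<b}" "u \<in> {a..b}" using elim(4,5) t by auto
      then have \<alpha>u: "\<alpha> u \<in> I" "\<alpha> u \<in> \<alpha> ` {a..b}" using \<alpha>I by auto
      let ?E = "exp (C * \<bar>s - \<alpha> u\<bar>)"
      have ge: "ereal (m u / ?E) \<le> gen_speed d \<beta> (\<alpha> u) u"
        using elim(1) uab(1)
        by (intro gen_speed_ge_metric_speed[OF sI \<alpha>u(1) uab(1) ac\<beta>[OF sI] ac\<beta>[OF \<alpha>u(1)] ll s \<alpha>u(2) m(1) lim]) blast
      have sq: "(gen_speed d \<beta> (\<alpha> u) u)\<^sup>2 \<le> ereal ((h (\<alpha> u) (\<beta> u) * deriv \<alpha> u)\<^sup>2)"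
        using elim(3) uab(2) by (simp add: power_mult_distrib)
      have d0: "0 < deriv \<alpha> u" using elim(2) uab(2) by blast
      have "m u / ?E \<le> h (\<alpha> u) (\<beta> u) * deriv \<alpha> u"
      proof (rule ereal_sq_le_imp_le[OF ge _ sq])
        show "0 \<le> m u / ?E" using m(2) by simp
        show "0 \<le> h (\<alpha> u) (\<beta> u) * deriv \<alpha> u"
          using d0 h_pos[OF \<alpha>u(1), of "\<beta> u"] by simp
      qed
      then have "m u \<le> (?E * h (\<alpha> u) (\<beta> u)) * deriv \<alpha> u"
        by (simp add: divide_le_eq mult_ac)
      also have "\<dots> \<le> H * deriv \<alpha> u" using H[OF u] d0 by (intro mult_right_mono) auto
      finally show "m u \<le> H * deriv \<alpha> u" .
    qed
  qed
  have int: "set_integrable lebesgue {t0..t1} (deriv \<alpha>)"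
    by (rule set_integrable_subset[OF abs_cont_real_derivative(1)[OF ac\<alpha> ab]]) (use t in auto)
  have "d s (\<beta> t0) (\<beta> t1) \<le> (LINT u:{t0..t1}|lebesgue. m u)" using t by (rule Dm)
  also have "\<dots> \<le> (LINT u:{t0..t1}|lebesgue. H * deriv \<alpha> u)"
  proof (rule set_integral_mono_AE)
    show "set_integrable lebesgue {t0..t1} m" using m(1) by (rule integrable_imp_set_integrable) simp
    show "set_integrable lebesgue {t0..t1} (\<lambda>u. H * deriv \<alpha> u)"
      using int by (intro set_integrable_mult_right) simp
  qed (rule bound)
  also have "\<dots> = H * (\<alpha> t1 - \<alpha> t0)"
    using abs_cont_real_derivative(2)[OF ac\<alpha> ab t] by simp
  finally show ?thesis .
qed

lemma causal_curve_strict_mono: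
  assumes fc: "future_causal_curve I h d a b \<alpha> \<beta>" and t: "a \<le> t0" "t0 < t1" "t1 \<le> b"
  shows "\<alpha> t0 < \<alpha> t1"
proof -
  have ab: "a < b" and ac\<alpha>: "abs_cont dist a b \<alpha>" and pos: "AE t in lebesgue. t \<in> {a..b} \<longrightarrow> 0 < deriv \<alpha> t"
    by (rule future_causal_curveD[OF fc]; assumption)+
  have eq: "\<alpha> t1 - \<alpha> t0 = (LINT u:{t0..t1}|lebesgue. deriv \<alpha> u)"
    using t by (intro abs_cont_real_derivative(2)[OF ac\<alpha> ab]) auto
  have int: "integrable lebesgue (\<lambda>u. indicator {t0..t1} u *\<^sub>R deriv \<alpha> u)"
    unfolding set_integrable_def[symmetric]
    by (rule set_integrable_subset[OF abs_cont_real_derivative(1)[OF ac\<alpha> ab]]) (use t in auto)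
  have nn: "AE u in lebesgue. 0 \<le> indicator {t0..t1} u *\<^sub>R deriv \<alpha> u"
    using pos by eventually_elim (use t in \<open>auto simp: indicator_def\<close>)
  have "\<alpha> t1 - \<alpha> t0 \<noteq> 0"
  proof
    assume "\<alpha> t1 - \<alpha> t0 = 0"
    then have "(LINT u|lebesgue. indicator {t0..t1} u *\<^sub>R deriv \<alpha> u) = 0"
      using eq by (simp add: set_lebesgue_integral_def)
    then have "AE u in lebesgue. indicator {t0..t1} u *\<^sub>R deriv \<alpha> u = 0"
      using integral_nonneg_eq_0_iff_AE[OF int nn] by simp
    then have "AE u in lebesgue. u \<notin> {t0..t1}"
      using pos by eventually_elim (use t in \<open>auto simp: indicator_def split: if_splits\<close>)
    then have "{t0..t1} \<in> null_sets lebesgue" by (simp add: AE_iff_null_sets)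
    then have "emeasure lebesgue {t0..t1} = 0" by (rule null_setsD1)
    then show False using t(2) by simp
  qed
  moreover have "0 \<le> \<alpha> t1 - \<alpha> t0"
    unfolding eq set_lebesgue_integral_def using nn by (rule integral_nonneg_AE)
  ultimately show ?thesis by simp
qed

text \<open>
  The space component of a causal curve that is parametrized by its time coordinate. Standing still is
  allowed, and so is a single instant; this makes the relation obtained from these curves reflexive.
\<close>
definition timed_curve :: "real \<Rightarrow> real \<Rightarrow> (real \<Rightarrow> 'a) \<Rightarrow> bool" where
  "timed_curve s0 s1 b \<longleftrightarrow> speed_bound d (\<lambda>t. t) b {s0..s1} (\<lambda>t. h t (b t))"

lemma Icc_subset_I: "s0 \<in> I \<Longrightarrow> s1 \<in> I \<Longrightarrow> {s0..s1} \<subseteq> I"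
  using I(2) by (meson atLeastAtMost_iff is_interval_1 subsetI)

text \<open>
  The time coordinate is a homeomorphism onto its image, so the curve can be parametrized by time. On
  short time intervals the supremum of \<open>exp (C * \<bar>t - u\<bar>) * h u (c u)\<close> is close to \<open>h t (c t)\<close>, and the
  preceding distance estimate becomes the pointwise bound.
\<close>
lemma causal_curve_imp_timed_curve:
  assumes fc: "future_causal_curve I h d a b \<alpha> \<beta>"
  obtains c where "timed_curve (\<alpha> a) (\<alpha> b) c" "\<And>t. t \<in> {a..b} \<Longrightarrow> c (\<alpha> t) = \<beta> t" "\<alpha> a < \<alpha> b" "\<alpha> ` {a..b} = {\<alpha> a..\<alpha> b}"
proof -
  have ab: "a < b" and \<alpha>I: "\<alpha> ` {a..b} \<subseteq> I" and ac\<alpha>: "abs_cont dist a b \<alpha>"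
    and ac\<beta>: "\<And>s. s \<in> I \<Longrightarrow> abs_cont (d s) a b \<beta>"
    by (rule future_causal_curveD[OF fc]; assumption)+
  note sm = causal_curve_strict_mono[OF fc]
  have le: "\<alpha> x \<le> \<alpha> y" if "a \<le> x" "x \<le> y" "y \<le> b" for x y
    using sm[of x y] that by (cases "x = y") auto
  have inj: "inj_on \<alpha> {a..b}"
  proof (rule inj_onI)
    fix x y assume "x \<in> {a..b}" "y \<in> {a..b}" "\<alpha> x = \<alpha> y"
    then show "x = y" using sm[of x y] sm[of y x] by (cases x y rule: linorder_cases) auto
  qed
  have cont\<alpha>: "continuous_on {a..b} \<alpha>" using ac\<alpha> by (rule abs_cont_real_continuous_on)
  have aI: "\<alpha> a \<in> I" using \<alpha>I ab by auto
  have cont\<beta>: "continuous_on {a..b} \<beta>" by (rule abs_cont_imp_continuous_on[OF aI ac\<beta>[OF aI]])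
  have img: "\<alpha> ` {a..b} = {\<alpha> a..\<alpha> b}"
  proof (intro equalityI subsetI)
    fix y assume "y \<in> {\<alpha> a..\<alpha> b}"
    then show "y \<in> \<alpha> ` {a..b}" using IVT'[OF _ _ less_imp_le[OF ab] cont\<alpha>, of y] by auto
  qed (use le in auto)
  define \<xi> where "\<xi> = the_inv_into {a..b} \<alpha>"
  have \<xi>: "\<xi> (\<alpha> t) = t" if "t \<in> {a..b}" for t
    unfolding \<xi>_def using the_inv_into_f_f[OF inj that] .
  have \<alpha>\<xi>: "\<xi> y \<in> {a..b}" "\<alpha> (\<xi> y) = y" if "y \<in> {\<alpha> a..\<alpha> b}" for y
    using that unfolding img[symmetric] by (auto simp: \<xi>)
  have cont\<xi>: "continuous_on {\<alpha> a..\<alpha> b} \<xi>"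
    unfolding img[symmetric] \<xi>_def using cont\<alpha> inj by (intro continuous_on_inv_into) auto
  define c where "c = \<beta> \<circ> \<xi>"
  have contc: "continuous_on {\<alpha> a..\<alpha> b} c"
    unfolding c_def comp_def
    by (rule continuous_on_compose2[OF cont\<beta> cont\<xi>]) (use \<alpha>\<xi> in auto)
  have JI: "{\<alpha> a..\<alpha> b} \<subseteq> I" using \<alpha>I by (simp add: img)
  have K: "compact (\<beta> ` {a..b})" using cont\<beta> by (intro compact_continuous_image) auto
  have J: "compact (\<alpha> ` {a..b})" by (simp add: img)
  obtain C r where ll: "log_lipschitz_on d (\<alpha> ` {a..b}) (\<beta> ` {a..b}) C r"
    by (rule ex_log_lipschitz_on[OF J \<alpha>I K])
  have "timed_curve (\<alpha> a) (\<alpha> b) c"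
    unfolding timed_curve_def speed_bound_def
  proof (intro conjI contc ballI allI impI)
    fix t e :: real assume t: "t \<in> {\<alpha> a..\<alpha> b}" and e: "0 < e"
    define f where "f u = exp (C * \<bar>t - u\<bar>) * h u (c u)" for u
    have contf: "continuous_on {\<alpha> a..\<alpha> b} f"
      unfolding f_def by (intro continuous_intros h_continuous_on contc) (use JI in auto)
    have ft: "f t < h t (c t) + e" using e by (simp add: f_def)
    have "(f \<longlongrightarrow> f t) (at t within {\<alpha> a..\<alpha> b})" using contf t by (simp add: continuous_on_def)
    then have "\<forall>\<^sub>F u in at t within {\<alpha> a..\<alpha> b}. f u < h t (c t) + e" using ft by (rule order_tendstoD)
    then obtain \<delta> where \<delta>: "0 < \<delta>" "\<And>u. u \<in> {\<alpha> a..\<alpha> b} \<Longrightarrow> u \<noteq> t \<Longrightarrow> \<bar>u - t\<bar> < \<delta> \<Longrightarrow> f u < h t (c t) + e"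
      unfolding eventually_at dist_real_def by blast
    have fle: "f u \<le> h t (c t) + e" if "u \<in> {\<alpha> a..\<alpha> b}" "\<bar>u - t\<bar> < \<delta>" for u
      using \<delta>(2)[of u] ft that by (cases "u = t") (auto intro: less_imp_le)
    have tI: "t \<in> I" using t JI by auto
    have *: "d t (c x) (c y) \<le> (h t (c t) + e) * (y - x)"
      if xy: "x \<in> {\<alpha> a..\<alpha> b}" "y \<in> {\<alpha> a..\<alpha> b}" "x \<le> y" "\<And>u. u \<in> {x..y} \<Longrightarrow> \<bar>u - t\<bar> < \<delta>" for x y
    proof -
      have \<xi>xy: "\<xi> x \<le> \<xi> y"
        using \<alpha>\<xi>[OF xy(1)] \<alpha>\<xi>[OF xy(2)] xy(3) sm[of "\<xi> y" "\<xi> x"] by (cases "\<xi> x \<le> \<xi> y") auto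
      have "d t (\<beta> (\<xi> x)) (\<beta> (\<xi> y)) \<le> (h t (c t) + e) * (\<alpha> (\<xi> y) - \<alpha> (\<xi> x))"
      proof (rule causal_curve_d_le[OF fc ll])
        fix u assume u: "u \<in> {\<xi> x..\<xi> y}"
        have uab: "u \<in> {a..b}" using u \<alpha>\<xi>(1)[OF xy(1)] \<alpha>\<xi>(1)[OF xy(2)] by auto
        have "\<alpha> u \<in> {x..y}"
          using le[of "\<xi> x" u] le[of u "\<xi> y"] u \<alpha>\<xi>[OF xy(1)] \<alpha>\<xi>[OF xy(2)] uab by auto
        then have "f (\<alpha> u) \<le> h t (c t) + e"
          using xy uab img by (intro fle) auto
        then show "exp (C * \<bar>t - \<alpha> u\<bar>) * h (\<alpha> u) (\<beta> u) \<le> h t (c t) + e"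
          using \<xi>[OF uab] by (simp add: f_def c_def)
      qed (use \<alpha>\<xi>[OF xy(1)] \<alpha>\<xi>[OF xy(2)] \<xi>xy t img in auto)
      then show ?thesis using \<alpha>\<xi>(2)[OF xy(1)] \<alpha>\<xi>(2)[OF xy(2)] by (simp add: c_def)
    qed
    show "\<exists>\<delta>>0. \<forall>t'\<in>{\<alpha> a..\<alpha> b}. \<bar>t' - t\<bar> < \<delta> \<longrightarrow> d t (c t) (c t') \<le> (h t (c t) + e) * \<bar>t' - t\<bar>"
    proof (intro exI[of _ \<delta>] conjI \<delta>(1) ballI impI)
      fix t' assume t': "t' \<in> {\<alpha> a..\<alpha> b}" "\<bar>t' - t\<bar> < \<delta>"
      show "d t (c t) (c t') \<le> (h t (c t) + e) * \<bar>t' - t\<bar>"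
      proof (cases "t \<le> t'")
        case True
        then show ?thesis using *[OF t t'(1)] t'(2) by auto
      next
        case False
        then show ?thesis using *[OF t'(1) t] t'(2) d_sym[OF tI, of "c t"] by auto
      qed
    qed
  qed
  moreover have "c (\<alpha> t) = \<beta> t" if "t \<in> {a..b}" for t using \<xi>[OF that] by (simp add: c_def)
  moreover have "\<alpha> a < \<alpha> b" using sm[of a b] ab by simp
  ultimately show thesis using img by (rule that)
qed

lemma timed_curve_subset: "timed_curve s0 s1 b \<Longrightarrow> s0 \<le> t0 \<Longrightarrow> t1 \<le> s1 \<Longrightarrow> timed_curve t0 t1 b"
  unfolding timed_curve_def by (erule speed_bound_subset) auto

lemma timed_curve_continuous: "timed_curve s0 s1 b \<Longrightarrow> continuous_on {s0..s1} b"
  unfolding timed_curve_def by (rule speed_bound_continuous)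

lemma timed_curve_const:
  assumes "{s0..s1} \<subseteq> I"
  shows "timed_curve s0 s1 (\<lambda>_. x)"
  unfolding timed_curve_def speed_bound_def
proof (intro conjI ballI allI impI)
  fix t e :: real assume t: "t \<in> {s0..s1}" "0 < e"
  then have "t \<in> I" using assms by auto
  then show "\<exists>\<delta>>0. \<forall>t'\<in>{s0..s1}. \<bar>t' - t\<bar> < \<delta> \<longrightarrow> d t x x \<le> (h t x + e) * \<bar>t' - t\<bar>"
    using h_pos[of t x] t(2) by (intro exI[of _ 1]) (auto simp: d_self intro!: mult_nonneg_nonneg)
qed simp

lemma timed_curve_cong:
  assumes "timed_curve s0 s1 b" "\<And>t. t \<in> {s0..s1} \<Longrightarrow> b t = c t"
  shows "timed_curve s0 s1 c"
proof -
  have "continuous_on {s0..s1} c \<longleftrightarrow> continuous_on {s0..s1} b"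
    using assms(2) by (intro continuous_on_cong) auto
  then show ?thesis using assms unfolding timed_curve_def speed_bound_def by simp
qed

text \<open>
  The speed bound compares a point of the curve with nearby points only, never two nearby points with
  each other. At the joint it is thus the conjunction of the bounds from the two sides.
\<close>
lemma timed_curve_join:
  assumes b: "timed_curve s0 s1 b" and c: "timed_curve s1 s2 c" and eq: "b s1 = c s1"
    and s: "s0 \<le> s1" "s1 \<le> s2" "{s0..s2} \<subseteq> I"
  shows "timed_curve s0 s2 (\<lambda>t. if t \<le> s1 then b t else c t)" (is "timed_curve s0 s2 ?j")
  unfolding timed_curve_def speed_bound_def
proof (intro conjI ballI allI impI)
  have "continuous_on ({s0..s1} \<union> {s1..s2}) ?j"
    using timed_curve_continuous[OF b] timed_curve_continuous[OF c] eq
    by (intro continuous_on_cases) auto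
  moreover have "{s0..s1} \<union> {s1..s2} = {s0..s2}" using s by auto
  ultimately show "continuous_on {s0..s2} ?j" by simp
  fix t e :: real assume t: "t \<in> {s0..s2}" and e: "0 < e"
  have jc: "?j u = c u" if "s1 \<le> u" for u using that eq by (cases "u = s1") auto
  have jb: "?j u = b u" if "u \<le> s1" for u using that by simp
  obtain \<delta>1 where \<delta>1: "0 < \<delta>1" "\<And>t'. t \<le> s1 \<Longrightarrow> t' \<in> {s0..s1} \<Longrightarrow> \<bar>t' - t\<bar> < \<delta>1 \<Longrightarrow>
      d t (?j t) (?j t') \<le> (h t (?j t) + e) * \<bar>t' - t\<bar>"
  proof (cases "t \<le> s1")
    case True
    then have "t \<in> {s0..s1}" using t by simp
    with b e obtain \<delta> where "0 < \<delta>" "\<forall>t'\<in>{s0..s1}. \<bar>t' - t\<bar> < \<delta> \<longrightarrow> d t (b t) (b t') \<le> (h t (b t) + e) * \<bar>t' - t\<bar>"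
      unfolding timed_curve_def speed_bound_def by meson
    then show ?thesis using that[of \<delta>] True by simp
  qed (use that[of 1] in simp)
  obtain \<delta>2 where \<delta>2: "0 < \<delta>2" "\<And>t'. s1 \<le> t \<Longrightarrow> t' \<in> {s1..s2} \<Longrightarrow> \<bar>t' - t\<bar> < \<delta>2 \<Longrightarrow>
      d t (?j t) (?j t') \<le> (h t (?j t) + e) * \<bar>t' - t\<bar>"
  proof (cases "s1 \<le> t")
    case True
    then have "t \<in> {s1..s2}" using t by simp
    with c e obtain \<delta> where "0 < \<delta>" "\<forall>t'\<in>{s1..s2}. \<bar>t' - t\<bar> < \<delta> \<longrightarrow> d t (c t) (c t') \<le> (h t (c t) + e) * \<bar>t' - t\<bar>"
      unfolding timed_curve_def speed_bound_def by meson
    then show ?thesis using that[of \<delta>] True jc by (auto simp del: if_split)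
  qed (use that[of 1] in simp)
  \<comment> \<open>Away from the joint, \<open>\<delta>\<close> keeps \<open>t'\<close> on the same side as \<open>t\<close>.\<close>
  define \<delta> where "\<delta> = min (min \<delta>1 \<delta>2) (if t = s1 then 1 else \<bar>t - s1\<bar>)"
  show "\<exists>\<delta>>0. \<forall>t'\<in>{s0..s2}. \<bar>t' - t\<bar> < \<delta> \<longrightarrow> d t (?j t) (?j t') \<le> (h t (?j t) + e) * \<bar>t' - t\<bar>"
  proof (intro exI[of _ \<delta>] conjI ballI impI)
    show "0 < \<delta>" using \<delta>1(1) \<delta>2(1) by (simp add: \<delta>_def)
    fix t' assume t': "t' \<in> {s0..s2}" "\<bar>t' - t\<bar> < \<delta>"
    then have d12: "\<bar>t' - t\<bar> < \<delta>1" "\<bar>t' - t\<bar> < \<delta>2" and side: "t = s1 \<or> \<bar>t' - t\<bar> < \<bar>t - s1\<bar>"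
      by (auto simp: \<delta>_def split: if_splits)
    show "d t (?j t) (?j t') \<le> (h t (?j t) + e) * \<bar>t' - t\<bar>"
    proof (cases "t \<le> s1 \<and> t' \<le> s1")
      case True
      then show ?thesis using t' d12 by (intro \<delta>1(2)) auto
    next
      case False
      then have "s1 \<le> t \<and> s1 \<le> t'" using side by (auto simp: abs_if split: if_splits)
      then show ?thesis using t' d12 by (intro \<delta>2(2)) auto
    qed
  qed
qed

lemma timed_curve_imp_causal_curve:
  assumes c: "timed_curve s0 s1 c" and s: "s0 < s1" "{s0..s1} \<subseteq> I"
  shows "future_causal_curve I h d s0 s1 (\<lambda>t. t) c"
  unfolding future_causal_curve_def abs_cont_family_def
proof (intro conjI ballI)
  have cont: "continuous_on {s0..s1} (\<lambda>t. t)" by (rule continuous_on_id)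
  have hc: "continuous_on {s0..s1} (\<lambda>t. h t (c t))"
    using timed_curve_continuous[OF c] s(2) by (intro h_continuous_on cont) auto
  show "abs_cont dist s0 s1 (\<lambda>t. t)"
    unfolding abs_cont_def
    by (intro exI[of _ "\<lambda>_. 1"]) (use s(1) set_integral_const_Icc[of _ _ 1] in \<open>auto simp: dist_real_def\<close>)
  show "abs_cont (d s) s0 s1 c" if "s \<in> I" for s
    using s c that hc unfolding timed_curve_def by (intro speed_bound_abs_cont[OF _ cont]) auto
  show "AE t in lebesgue. t \<in> {s0..s1} \<longrightarrow>
     (gen_speed d c t t)\<^sup>2 \<le> ereal ((h t (c t))\<^sup>2 * (deriv (\<lambda>t. t) t)\<^sup>2)"
    using AE_lebesgue_neq_real[of s0] AE_lebesgue_neq_real[of s1]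
  proof eventually_elim
    case (elim t)
    show ?case
    proof
      assume "t \<in> {s0..s1}"
      with elim have t: "t \<in> {s0<..<s1}" by auto
      then have "t \<in> I" using s(2) by auto
      have "0 \<le> gen_speed d c t t" "gen_speed d c t t \<le> ereal (h t (c t))"
        using gen_speed_bounds[OF s(1) cont _ c[unfolded timed_curve_def] hc t] s(2) by auto
      then show "(gen_speed d c t t)\<^sup>2 \<le> ereal ((h t (c t))\<^sup>2 * (deriv (\<lambda>t. t) t)\<^sup>2)"
        using h_pos[OF \<open>t \<in> I\<close>, of "c t"]
        by (cases "gen_speed d c t t") (auto intro!: power_mono)
    qed
  qed
qed (use s in auto)

text \<open>
  The causal relation without derivatives and null sets.
\<close>
lemma cone_le_iff:
  "cone_le I h d p q \<longleftrightarrow> fst p \<in> I \<and> fst q \<in> I \<and> fst p \<le> fst q \<and>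
     (\<exists>c. timed_curve (fst p) (fst q) c \<and> c (fst p) = snd p \<and> c (fst q) = snd q)" (is "_ \<longleftrightarrow> ?R")
proof
  assume "cone_le I h d p q"
  then consider (eq) "fst p \<in> I" "p = q" |
    (curve) a b \<alpha> \<beta> where "future_causal_curve I h d a b \<alpha> \<beta>" "(\<alpha> a, \<beta> a) = p" "(\<alpha> b, \<beta> b) = q"
    unfolding cone_le_def by blast
  then show ?R
  proof cases
    case eq
    then show ?thesis using timed_curve_const[of "fst p" "fst p" "snd p"] by auto
  next
    case curve
    obtain c where c: "timed_curve (\<alpha> a) (\<alpha> b) c" "\<And>t. t \<in> {a..b} \<Longrightarrow> c (\<alpha> t) = \<beta> t" "\<alpha> a < \<alpha> b"
        "\<alpha> ` {a..b} = {\<alpha> a..\<alpha> b}"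
      by (rule causal_curve_imp_timed_curve[OF curve(1)]) (rule that)
    have "\<alpha> a \<in> I" "\<alpha> b \<in> I" "c (\<alpha> a) = \<beta> a" "c (\<alpha> b) = \<beta> b"
      using future_causal_curveD(1,2)[OF curve(1)] c(2) by auto
    then show ?thesis using c(1,3) curve(2,3) by (auto intro!: exI[of _ c])
  qed
next
  assume R: ?R
  then obtain c where c: "timed_curve (fst p) (fst q) c" "c (fst p) = snd p" "c (fst q) = snd q" by blast
  show "cone_le I h d p q"
  proof (cases "fst p = fst q")
    case True
    then show ?thesis using R c by (simp add: cone_le_def prod_eq_iff)
  next
    case False
    then have "future_causal_curve I h d (fst p) (fst q) (\<lambda>t. t) c"
      using R Icc_subset_I by (intro timed_curve_imp_causal_curve[OF c(1)]) auto
    then show ?thesis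
      unfolding cone_le_def using c(2,3)
      by (intro disjI2 exI[of _ "fst p"] exI[of _ "fst q"] exI[of _ "\<lambda>t. t"] exI[of _ c]) auto
  qed
qed

end

section \<open>Escape and limits of timed curves\<close>

lemma compact_function_box:
  fixes K :: "'i \<Rightarrow> 'b::topological_space set"
  assumes "\<And>t. compact (K t)"
  shows "compact {b. \<forall>t. b t \<in> K t}"
proof -
  have "compactin (product_topology (\<lambda>i. euclidean) UNIV) (PiE UNIV K)"
    unfolding compactin_PiE using assms by simp
  moreover have "PiE UNIV K = {b. \<forall>t. b t \<in> K t}" by (auto simp: PiE_UNIV_domain)
  ultimately show ?thesis by (simp add: euclidean_product_topology)
qed

text \<open>
  Tychonoff's theorem in place of the theorem of Arzela and Ascoli. No subsequences are extracted: the
  cluster point comes with a filter along which all evaluations converge.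
\<close>
lemma function_box_cluster_point:
  fixes K :: "'i \<Rightarrow> 'b::topological_space set"
  assumes K: "\<And>t. compact (K t)" and F: "F \<noteq> bot" and ev: "\<forall>\<^sub>F b in F. \<forall>t. b t \<in> K t"
  obtains \<beta> where "inf (nhds \<beta>) F \<noteq> bot" "\<And>t. ((\<lambda>b. b t) \<longlongrightarrow> \<beta> t) (inf (nhds \<beta>) F)" "\<And>t. \<beta> t \<in> K t"
proof -
  have P: "compact {b. \<forall>t. b t \<in> K t}" using K by (rule compact_function_box)
  have "\<forall>\<^sub>F b in F. b \<in> {b. \<forall>t. b t \<in> K t}" using ev by simp
  then obtain \<beta> where \<beta>: "\<beta> \<in> {b. \<forall>t. b t \<in> K t}" "inf (nhds \<beta>) F \<noteq> bot"
    using P[unfolded compact_filter] F by blast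
  show thesis
  proof (rule that[OF \<beta>(2)])
    show "((\<lambda>b. b t) \<longlongrightarrow> \<beta> t) (inf (nhds \<beta>) F)" for t
    proof (rule filterlim_mono)
      show "filterlim (\<lambda>b. b t) (nhds (\<beta> t)) (nhds \<beta>)"
      proof (rule topological_tendstoI)
        fix S assume "open S" "\<beta> t \<in> S"
        then have "open ((\<lambda>b. b t) -` S)" "\<beta> \<in> (\<lambda>b. b t) -` S"
          by (auto intro!: open_vimage continuous_on_product_coordinates)
        then show "\<forall>\<^sub>F b in nhds \<beta>. b t \<in> S" unfolding eventually_nhds by blast
      qed
    qed auto
  qed (use \<beta> in auto)
qed

context cone_data
begin

lemma h_bounded:
  assumes J: "compact J" "J \<subseteq> I" and K: "compact K"
  obtains H where "0 < H" "\<And>u x. u \<in> J \<Longrightarrow> x \<in> K \<Longrightarrow> h u x \<le> H"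
proof (cases "J \<times> K = {}")
  case True
  show ?thesis by (rule that[of 1]) (use True in auto)
next
  case False
  have "continuous_on (J \<times> K) (\<lambda>(s, x). h s x)" using J by (intro continuous_on_subset[OF h_cont]) auto
  then obtain p where p: "p \<in> J \<times> K" "\<And>q. q \<in> J \<times> K \<Longrightarrow> (case q of (s, x) \<Rightarrow> h s x) \<le> (case p of (s, x) \<Rightarrow> h s x)"
    using continuous_attains_sup[OF compact_Times[OF J(1) K] False] by blast
  show ?thesis
  proof (rule that)
    show "0 < (case p of (s, x) \<Rightarrow> h s x)" using p(1) J h_pos by auto
    fix u x assume "u \<in> J" "x \<in> K"
    then show "h u x \<le> (case p of (s, x) \<Rightarrow> h s x)" using p(2)[of "(u, x)"] by simp
  qed
qed

lemma timed_curve_d_le: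
  assumes ll: "log_lipschitz_on d {j0..j1} K C r" and J: "{j0..j1} \<subseteq> I"
    and c: "timed_curve x y c" "x \<le> y" "{x..y} \<subseteq> {j0..j1}" "c ` {x..y} \<subseteq> K"
    and H: "\<And>u. u \<in> {x..y} \<Longrightarrow> h u (c u) \<le> H" and s: "s \<in> {j0..j1}" "\<And>u. u \<in> {x..y} \<Longrightarrow> \<bar>s - u\<bar> \<le> \<delta>"
  shows "d s (c x) (c y) \<le> exp (C * \<delta>) * H * (y - x)"
  by (rule d_le_of_speed_bound[OF ll J c(1)[unfolded timed_curve_def] c(2,4)]) (use c H s in auto)

lemma timed_curves_equi_lipschitz:
  assumes J: "{j0..j1} \<subseteq> I" and K: "compact K"
  obtains M where "0 < M" "\<And>s x y c. s \<in> {j0..j1} \<Longrightarrow> timed_curve x y c \<Longrightarrow> x \<le> y \<Longrightarrow> {x..y} \<subseteq> {j0..j1} \<Longrightarrow>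
      c ` {x..y} \<subseteq> K \<Longrightarrow> d s (c x) (c y) \<le> M * (y - x)"
proof -
  obtain C r where ll: "log_lipschitz_on d {j0..j1} K C r" by (rule ex_log_lipschitz_on[OF compact_Icc J K])
  obtain H where H: "0 < H" "\<And>u x. u \<in> {j0..j1} \<Longrightarrow> x \<in> K \<Longrightarrow> h u x \<le> H"
    by (rule h_bounded[OF compact_Icc J K]) (rule that)
  show thesis
  proof (rule that)
    show "0 < exp (C * (j1 - j0)) * H" using H(1) by simp
    fix s x y c assume *: "s \<in> {j0..j1}" "timed_curve x y c" "x \<le> y" "{x..y} \<subseteq> {j0..j1}" "c ` {x..y} \<subseteq> K"
    show "d s (c x) (c y) \<le> exp (C * (j1 - j0)) * H * (y - x)"
    proof (rule timed_curve_d_le[OF ll J *(2-5)])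
      fix u assume u: "u \<in> {x..y}"
      then show "h u (c u) \<le> H" using * by (intro H(2)) auto
      have "u \<in> {j0..j1}" using u *(4) by blast
      then show "\<bar>s - u\<bar> \<le> j1 - j0" using *(1) by auto
    qed (rule *(1))
  qed
qed

text \<open>
  To leave the neighbourhood \<open>L\<close>, a curve that starts in \<open>K\<close> first has to reach \<open>L - U\<close>, where \<open>U\<close> is an
  open set between \<open>K\<close> and \<open>L\<close>. That compact set has a positive distance \<open>D0\<close> from \<open>K\<close>, and inside \<open>L\<close>
  the timed curves are equi-Lipschitz with a constant \<open>M\<close>, so this takes at least the time \<open>D0 / M\<close>.
\<close>
lemma timed_curve_escape:
  assumes J: "{j0..j1} \<subseteq> I" and K: "compact K"
  obtains L \<eta> where "compact L" "K \<subseteq> L" "0 < \<eta>"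
    "\<And>x y c. timed_curve x y c \<Longrightarrow> {x..y} \<subseteq> {j0..j1} \<Longrightarrow> x \<le> y \<Longrightarrow> y - x < \<eta> \<Longrightarrow> c x \<in> K \<Longrightarrow> c ` {x..y} \<subseteq> L"
proof (cases "j0 \<le> j1")
  case False
  show ?thesis by (rule that[of K 1]) (use K False in auto)
next
  case True
  then have j0: "j0 \<in> I" "j0 \<in> {j0..j1}" using J by auto
  obtain U L where U: "open U" "compact L" "closed L" "K \<subseteq> U" "U \<subseteq> L"
    using compact_neighbourhood[OF K] by metis
  obtain D0 where D0: "0 < D0" "\<And>x y. x \<in> K \<Longrightarrow> y \<in> L - U \<Longrightarrow> D0 \<le> d j0 x y"
  proof (cases "K \<times> (L - U) = {}")
    case True
    show ?thesis by (rule that[of 1]) (use True in auto)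
  next
    case False
    have "compact (K \<times> (L - U))" using K U by (intro compact_Times compact_diff)
    moreover have "continuous_on (K \<times> (L - U)) (\<lambda>p. d j0 (fst p) (snd p))"
      unfolding continuous_on_def by (intro ballI d_tendsto[OF j0(1)] tendsto_intros)
    ultimately obtain p where p: "p \<in> K \<times> (L - U)" "\<And>q. q \<in> K \<times> (L - U) \<Longrightarrow> d j0 (fst p) (snd p) \<le> d j0 (fst q) (snd q)"
      using continuous_attains_inf[OF _ False] by blast
    show ?thesis
    proof (rule that)
      have "fst p \<noteq> snd p" using p(1) U(4) by auto
      then show "0 < d j0 (fst p) (snd p)" using d_nonneg[OF j0(1), of "fst p" "snd p"] d_eq_0[OF j0(1)] by force
      fix x y assume "x \<in> K" "y \<in> L - U"
      then show "d j0 (fst p) (snd p) \<le> d j0 x y" using p(2)[of "(x, y)"] by simp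
    qed
  qed
  obtain M where M: "0 < M" "\<And>s x y c. s \<in> {j0..j1} \<Longrightarrow> timed_curve x y c \<Longrightarrow> x \<le> y \<Longrightarrow> {x..y} \<subseteq> {j0..j1} \<Longrightarrow>
      c ` {x..y} \<subseteq> L \<Longrightarrow> d s (c x) (c y) \<le> M * (y - x)"
    by (rule timed_curves_equi_lipschitz[OF J U(2)]) (rule that)
  show ?thesis
  proof (rule that[OF U(2)])
    show "K \<subseteq> L" using U by blast
    show "0 < D0 / M" using D0(1) M(1) by simp
    fix x y c assume c: "timed_curve x y c" and xy: "{x..y} \<subseteq> {j0..j1}" "x \<le> y" "y - x < D0 / M" and cx: "c x \<in> K"
    have "c ` {x..y} \<subseteq> U"
    proof (rule ccontr)
      assume "\<not> c ` {x..y} \<subseteq> U"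
      define W where "W = {w \<in> {x..y}. c w \<in> - U}"
      have Wne: "W \<noteq> {}" using \<open>\<not> c ` {x..y} \<subseteq> U\<close> by (auto simp: W_def)
      have "closed W"
        unfolding W_def using timed_curve_continuous[OF c] U(1)
        by (intro continuous_closed_preimage[unfolded vimage_def Int_def mem_Collect_eq] ) (auto simp: closed_Compl)
      moreover have bdd: "bdd_below W" by (auto simp: W_def)
      ultimately have wW: "Inf W \<in> W" using Wne by (intro closed_contains_Inf)
      define w where "w = Inf W"
      have w: "w \<in> {x..y}" "c w \<notin> U" using wW by (auto simp: w_def W_def)
      have before: "c u \<in> U" if "u \<in> {x..<w}" for u
      proof (rule ccontr)
        assume "c u \<notin> U"
        then have "u \<in> W" using that w by (auto simp: W_def)
        then have "w \<le> u" unfolding w_def using bdd by (rule cInf_lower)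
        then show False using that by simp
      qed
      have xw: "x < w" using w cx U(4) by (cases "x = w") auto
      have cl: "closure {x..<w} = {x..w}" using xw by simp
      have cxw: "c ` {x..w} \<subseteq> L"
      proof -
        have "continuous_on (closure {x..<w}) c"
          unfolding cl using timed_curve_continuous[OF c] w by (auto elim: continuous_on_subset)
        moreover have "c ` {x..<w} \<subseteq> L" using before U(5) by blast
        ultimately have "c ` closure {x..<w} \<subseteq> L" using U(3) by (intro image_closure_subset)
        then show ?thesis by (simp only: cl)
      qed
      have "{x..w} \<subseteq> {j0..j1}" using w(1) xy(1) by auto
      then have "d j0 (c x) (c w) \<le> M * (w - x)"
        using w xw cxw by (intro M(2) j0 timed_curve_subset[OF c]) auto
      also have "\<dots> \<le> M * (y - x)" using w M(1) by auto
      also have "\<dots> < D0" using xy(3) M(1) by (simp add: field_simps)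
      also have "D0 \<le> d j0 (c x) (c w)" using w cxw xw cx by (intro D0(2)) auto
      finally show False by simp
    qed
    then show "c ` {x..y} \<subseteq> L" using U(5) by blast
  qed
qed

text \<open>
  Timed curves in \<open>K\<close> are equi-Lipschitz, so their pointwise limit \<open>\<beta>\<close> is Lipschitz and the curves \<open>b\<close>
  near it stay close to \<open>\<beta> t\<close> for times near \<open>t\<close>. There \<open>h u (b u) \<le> h t (\<beta> t) + e / 2\<close> by the continuity
  of \<open>h\<close>. This gives distance estimates in the metric \<open>d t\<close> that are uniform in \<open>b\<close> and pass to the limit.
\<close>
lemma timed_curve_limit:
  assumes J: "{s0..s1} \<subseteq> I" and K: "compact K" and G: "G \<noteq> bot"
    and ev: "\<forall>\<^sub>F b in G. timed_curve s0 s1 b \<and> b ` {s0..s1} \<subseteq> K"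
    and lim: "\<And>t. t \<in> {s0..s1} \<Longrightarrow> ((\<lambda>b. b t) \<longlongrightarrow> \<beta> t) G"
    and \<beta>K: "\<beta> ` {s0..s1} \<subseteq> K"
  shows "timed_curve s0 s1 \<beta>"
proof -
  obtain M where M: "0 < M" "\<And>s x y c. s \<in> {s0..s1} \<Longrightarrow> timed_curve x y c \<Longrightarrow> x \<le> y \<Longrightarrow> {x..y} \<subseteq> {s0..s1} \<Longrightarrow>
      c ` {x..y} \<subseteq> K \<Longrightarrow> d s (c x) (c y) \<le> M * (y - x)"
    by (rule timed_curves_equi_lipschitz[OF J K]) (rule that)
  have lip: "d s (b x) (b y) \<le> M * \<bar>y - x\<bar>"
    if b: "timed_curve s0 s1 b" "b ` {s0..s1} \<subseteq> K" and xy: "x \<in> {s0..s1}" "y \<in> {s0..s1}" and s: "s \<in> {s0..s1}" for b s x y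
  proof -
    have *: "d s (b x) (b y) \<le> M * (y - x)" if "x \<in> {s0..s1}" "y \<in> {s0..s1}" "x \<le> y" for x y
    proof (rule M(2)[OF s _ that(3)])
      show "timed_curve x y b" using timed_curve_subset[OF b(1)] that by auto
      show "b ` {x..y} \<subseteq> K" using b(2) that by auto
    qed (use that in auto)
    have sI: "s \<in> I" using s J by auto
    show ?thesis
      using *[OF xy] *[OF xy(2,1)] d_sym[OF sI, of "b x" "b y"] by (cases "x \<le> y") auto
  qed
  have lipb: "d s (\<beta> x) (\<beta> y) \<le> M * \<bar>y - x\<bar>" if xy: "x \<in> {s0..s1}" "y \<in> {s0..s1}" and s: "s \<in> {s0..s1}" for s x y
  proof (rule tendsto_upperbound[OF _ _ G])
    have sI: "s \<in> I" using s J by auto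
    show "((\<lambda>b. d s (b x) (b y)) \<longlongrightarrow> d s (\<beta> x) (\<beta> y)) G" by (intro d_tendsto[OF sI] lim xy)
    show "\<forall>\<^sub>F b in G. d s (b x) (b y) \<le> M * \<bar>y - x\<bar>"
      using ev by eventually_elim (use lip xy s in auto)
  qed
  show ?thesis
    unfolding timed_curve_def speed_bound_def
  proof (intro conjI ballI allI impI)
    show "continuous_on {s0..s1} \<beta>"
      unfolding continuous_on_def
    proof
      fix t assume t: "t \<in> {s0..s1}"
      then have tI: "t \<in> I" using J by auto
      have "((\<lambda>u. d t (\<beta> u) (\<beta> t)) \<longlongrightarrow> 0) (at t within {s0..s1})"
      proof (rule tendsto_sandwich[OF _ _ tendsto_const])
        show "\<forall>\<^sub>F u in at t within {s0..s1}. 0 \<le> d t (\<beta> u) (\<beta> t)" using d_nonneg[OF tI] by simp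
        show "\<forall>\<^sub>F u in at t within {s0..s1}. d t (\<beta> u) (\<beta> t) \<le> M * \<bar>t - u\<bar>"
          using lipb t by (auto simp: eventually_at_filter)
        show "((\<lambda>u. M * \<bar>t - u\<bar>) \<longlongrightarrow> 0) (at t within {s0..s1})"
          by (auto intro!: tendsto_eq_intros)
      qed
      moreover have "\<forall>\<^sub>F u in at t within {s0..s1}. \<beta> u \<in> K"
        using \<beta>K unfolding eventually_at_filter by (intro always_eventually) blast
      ultimately show "(\<beta> \<longlongrightarrow> \<beta> t) (at t within {s0..s1})"
        by (intro tendsto_if_d_tendsto_0[OF tI K])
    qed
  next
    fix t e :: real assume t: "t \<in> {s0..s1}" and e: "0 < e"
    then have tI: "t \<in> I" using J by auto
    obtain C r where ll: "log_lipschitz_on d {s0..s1} K C r" by (rule ex_log_lipschitz_on[OF compact_Icc J K])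
    let ?h = "h t (\<beta> t)"
    \<comment> \<open>Near \<open>(t, \<beta> t)\<close> the speed limit is at most \<open>?h + e/2\<close>.\<close>
    have "((\<lambda>(s, x). h s x) \<longlongrightarrow> ?h) (at (t, \<beta> t) within I \<times> UNIV)"
      using h_cont tI by (auto simp: continuous_on_def)
    then have "\<forall>\<^sub>F p in at (t, \<beta> t) within I \<times> UNIV. (case p of (s, x) \<Rightarrow> h s x) < ?h + e / 2"
      using e by (intro order_tendstoD) auto
    then obtain S where S: "open S" "(t, \<beta> t) \<in> S"
      "\<And>p. p \<in> S \<Longrightarrow> p \<noteq> (t, \<beta> t) \<Longrightarrow> p \<in> I \<times> UNIV \<Longrightarrow> (case p of (s, x) \<Rightarrow> h s x) < ?h + e / 2"
      unfolding eventually_at_topological by blast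
    obtain A U where AU: "open A" "open U" "(t, \<beta> t) \<in> A \<times> U" "A \<times> U \<subseteq> S"
      by (rule open_prod_elim[OF S(1,2)])
    have hAU: "h u x \<le> ?h + e / 2" if "u \<in> A" "u \<in> I" "x \<in> U" for u x
      using S(3)[of "(u, x)"] AU(4) that e by (cases "(u, x) = (t, \<beta> t)") (auto intro: less_imp_le)
    obtain \<delta>1 where \<delta>1: "0 < \<delta>1" "\<And>u. \<bar>u - t\<bar> < \<delta>1 \<Longrightarrow> u \<in> A"
      using AU(1,3) unfolding open_dist dist_real_def by (metis mem_Sigma_iff)
    obtain e1 where e1: "0 < e1" "\<And>y. y \<in> K \<Longrightarrow> d t (\<beta> t) y < e1 \<Longrightarrow> y \<in> U"
      using compact_d_small_imp_in_open[OF tI K AU(2), of "\<beta> t"] AU(3) by (metis mem_Sigma_iff)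
    have "((\<lambda>\<delta>. exp (C * \<delta>) * (?h + e / 2)) \<longlongrightarrow> exp (C * 0) * (?h + e / 2)) (at 0)"
      by (intro tendsto_intros)
    then have "\<forall>\<^sub>F \<delta> in at 0. exp (C * \<delta>) * (?h + e / 2) < ?h + e"
      using e by (intro order_tendstoD) auto
    then obtain \<delta>2 where \<delta>2: "0 < \<delta>2" "\<And>\<delta>. \<delta> \<noteq> 0 \<Longrightarrow> \<bar>\<delta>\<bar> < \<delta>2 \<Longrightarrow> exp (C * \<delta>) * (?h + e / 2) < ?h + e"
      unfolding eventually_at dist_real_def by auto
    \<comment> \<open>The three terms keep the time in \<open>A\<close>, absorb the exponential factor into \<open>e / 2\<close>, and keep every
      curve within \<open>e1 / 2\<close> of its position at time \<open>t\<close>.\<close>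
    define \<delta> where "\<delta> = min \<delta>1 (min \<delta>2 (e1 / (2 * M)))"
    show "\<exists>\<delta>>0. \<forall>t'\<in>{s0..s1}. \<bar>t' - t\<bar> < \<delta> \<longrightarrow> d t (\<beta> t) (\<beta> t') \<le> (?h + e) * \<bar>t' - t\<bar>"
    proof (intro exI[of _ \<delta>] conjI ballI impI)
      show "0 < \<delta>" using \<delta>1(1) \<delta>2(1) e1(1) M(1) by (simp add: \<delta>_def)
      fix t' assume t': "t' \<in> {s0..s1}" "\<bar>t' - t\<bar> < \<delta>"
      show "d t (\<beta> t) (\<beta> t') \<le> (?h + e) * \<bar>t' - t\<bar>"
      proof (cases "t' = t")
        case True
        then show ?thesis by (simp add: d_self[OF tI])
      next
        case False
        show ?thesis
        proof (rule tendsto_upperbound[OF _ _ G])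
          show "((\<lambda>b. d t (b t) (b t')) \<longlongrightarrow> d t (\<beta> t) (\<beta> t')) G" by (intro d_tendsto[OF tI] lim t t'(1))
          have "\<forall>\<^sub>F b in G. d t (b t) (\<beta> t) < e1 / 2"
            using e1(1) by (intro order_tendstoD(2)[OF d_tendsto_0[OF tI lim[OF t]]]) simp
          then show "\<forall>\<^sub>F b in G. d t (b t) (b t') \<le> (?h + e) * \<bar>t' - t\<bar>"
            using ev
          proof eventually_elim
            case (elim b)
            have bU: "b u \<in> U" if u: "u \<in> {s0..s1}" "\<bar>u - t\<bar> \<le> \<bar>t' - t\<bar>" for u
            proof (rule e1(2))
              show "b u \<in> K" using elim u by auto
              have "M * \<bar>u - t\<bar> \<le> M * \<bar>t' - t\<bar>" using u(2) M(1) by simp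
              also have "\<dots> < M * (e1 / (2 * M))" using t'(2) M(1) by (intro mult_strict_left_mono) (auto simp: \<delta>_def)
              also have "\<dots> = e1 / 2" using M(1) by simp
              finally have "d t (b t) (b u) < e1 / 2"
                using lip[of b t u t] elim t u by auto
              then show "d t (\<beta> t) (b u) < e1"
                using elim(1) d_tri[OF tI, of "\<beta> t" "b u" "b t"] d_sym[OF tI, of "\<beta> t" "b t"] by simp
            qed
            define x where "x = min t t'"
            define y where "y = max t t'"
            have xy: "x \<le> y" "x \<in> {s0..s1}" "y \<in> {s0..s1}" "y - x = \<bar>t' - t\<bar>" "{x..y} \<subseteq> {s0..s1}"
              using t t' by (auto simp: x_def y_def)
            have "d t (b x) (b y) \<le> exp (C * \<bar>t' - t\<bar>) * (?h + e / 2) * (y - x)"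
            proof (rule timed_curve_d_le[OF ll J _ xy(1,5) _ _ t])
              show "timed_curve x y b" using elim xy by (auto intro: timed_curve_subset)
              show "b ` {x..y} \<subseteq> K" using elim xy(5) by blast
              fix u assume u: "u \<in> {x..y}"
              then show ut: "\<bar>t - u\<bar> \<le> \<bar>t' - t\<bar>" by (auto simp: x_def y_def)
              then show "h u (b u) \<le> ?h + e / 2"
                using u xy(5) J t'(2) by (intro hAU \<delta>1(2) bU) (auto simp: \<delta>_def)
            qed
            also have "\<dots> \<le> (?h + e) * (y - x)"
              using \<delta>2(2)[of "\<bar>t' - t\<bar>"] t'(2) False xy(1) by (intro mult_right_mono) (auto simp: \<delta>_def)
            finally have "d t (b x) (b y) \<le> (?h + e) * \<bar>t' - t\<bar>" using xy(4) by simp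
            then show ?case
              using d_sym[OF tI, of "b t" "b t'"] by (cases "t \<le> t'") (auto simp: x_def y_def)
          qed
        qed
      qed
    qed
  qed
qed

end

section \<open>Boundedness of the reach\<close>

text \<open>
  The filter of large compact sets plays the role of an exhaustion by compact sets.
\<close>
lemma compact_sets_filter:
  fixes F :: "'b::topological_space set filter"
  defines "F \<equiv> INF K\<in>{K. compact K}. principal {K'. compact K' \<and> K \<subseteq> K'}"
  shows "F \<noteq> bot" and "\<And>K. compact K \<Longrightarrow> \<forall>\<^sub>F K' in F. compact K' \<and> K \<subseteq> K'"
proof -
  have ev: "eventually P F \<longleftrightarrow> (\<exists>K\<in>{K. compact K}. eventually P (principal {K'. compact K' \<and> K \<subseteq> K'}))" for P
    unfolding F_def
  proof (rule eventually_INF_base)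
    show "{K. compact K} \<noteq> ({} :: 'b set set)" using compact_empty by blast
    fix K K' :: "'b set" assume "K \<in> {K. compact K}" "K' \<in> {K. compact K}"
    then show "\<exists>x\<in>{K. compact K}. principal {K'. compact K' \<and> x \<subseteq> K'}
        \<le> inf (principal {K'. compact K' \<and> K \<subseteq> K'}) (principal {K''. compact K'' \<and> K' \<subseteq> K''})"
      by (intro bexI[of _ "K \<union> K'"]) (auto intro: compact_Un)
  qed
  have "\<not> eventually (\<lambda>_. False) F"
    unfolding ev eventually_principal by blast
  then show "F \<noteq> bot" by (simp add: eventually_False)
  show "\<forall>\<^sub>F K' in F. compact K' \<and> K \<subseteq> K'" if "compact K" for K
    unfolding ev using that by (auto simp: eventually_principal)
qed

context cone_data
begin

text \<open>
  The chain rule for speed bounds.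
\<close>
lemma speed_bound_reparam:
  assumes c: "timed_curve s0 s1 c" and J: "{s0..s1} \<subseteq> I" and \<alpha>: "\<alpha> ` S \<subseteq> {s0..s1}"
    and der: "\<And>r. r \<in> S \<Longrightarrow> (\<alpha> has_real_derivative \<alpha>' r) (at r)" and nn: "\<And>r. r \<in> S \<Longrightarrow> 0 \<le> \<alpha>' r"
  shows "speed_bound d \<alpha> (\<lambda>r. c (\<alpha> r)) S (\<lambda>r. h (\<alpha> r) (c (\<alpha> r)) * \<alpha>' r)"
  unfolding speed_bound_def
proof (intro conjI ballI allI impI)
  have cont: "continuous_on S \<alpha>"
  proof (rule continuous_at_imp_continuous_on, rule ballI)
    show "isCont \<alpha> r" if "r \<in> S" for r using der[OF that] by (rule DERIV_isCont)
  qed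
  show "continuous_on S (\<lambda>r. c (\<alpha> r))"
    by (rule continuous_on_compose2[OF timed_curve_continuous[OF c] cont \<alpha>])
  fix r e :: real assume r: "r \<in> S" and e: "0 < e"
  let ?h = "h (\<alpha> r) (c (\<alpha> r))"
  \<comment> \<open>The slack \<open>x\<close> is spent twice: once on the speed bound of \<open>c\<close>, once on the derivative of \<open>\<alpha>\<close>.\<close>
  have "((\<lambda>x. (?h + x) * (\<alpha>' r + x)) \<longlongrightarrow> (?h + 0) * (\<alpha>' r + 0)) (at_right 0)"
    by (intro tendsto_intros)
  then have "\<forall>\<^sub>F x in at_right 0. (?h + x) * (\<alpha>' r + x) < ?h * \<alpha>' r + e"
    using e by (intro order_tendstoD) auto
  moreover have "\<forall>\<^sub>F x in at_right (0::real). 0 < x" by (simp add: eventually_at_filter)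
  ultimately have "\<forall>\<^sub>F x in at_right 0. 0 < x \<and> (?h + x) * (\<alpha>' r + x) < ?h * \<alpha>' r + e"
    by eventually_elim simp
  then obtain x where x: "0 < x" "(?h + x) * (\<alpha>' r + x) < ?h * \<alpha>' r + e"
    using eventually_happens'[of "at_right (0::real)"] by auto
  have \<alpha>r: "\<alpha> r \<in> {s0..s1}" "\<alpha> r \<in> I" using \<alpha> r J by auto
  obtain \<delta>1 where \<delta>1: "0 < \<delta>1" "\<And>t'. t' \<in> {s0..s1} \<Longrightarrow> \<bar>t' - \<alpha> r\<bar> < \<delta>1 \<Longrightarrow>
      d (\<alpha> r) (c (\<alpha> r)) (c t') \<le> (?h + x) * \<bar>t' - \<alpha> r\<bar>"
    using c \<alpha>r(1) x(1) unfolding timed_curve_def speed_bound_def by meson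
  have "((\<lambda>y. \<bar>(\<alpha> y - \<alpha> r) / (y - r)\<bar>) \<longlongrightarrow> \<bar>\<alpha>' r\<bar>) (at r)"
    using der[OF r] unfolding has_field_derivative_iff by (rule tendsto_rabs)
  then have "\<forall>\<^sub>F y in at r. \<bar>(\<alpha> y - \<alpha> r) / (y - r)\<bar> < \<alpha>' r + x"
    using x(1) nn[OF r] by (intro order_tendstoD) auto
  moreover have "\<forall>\<^sub>F y in at r. \<bar>\<alpha> y - \<alpha> r\<bar> < \<delta>1"
  proof -
    have "(\<alpha> \<longlongrightarrow> \<alpha> r) (at r)" using DERIV_isCont[OF der[OF r]] by (simp add: isCont_def)
    from tendstoD[OF this \<delta>1(1)] show ?thesis by (simp add: dist_real_def)
  qed
  ultimately have "\<forall>\<^sub>F y in at r. \<bar>(\<alpha> y - \<alpha> r) / (y - r)\<bar> < \<alpha>' r + x \<and> \<bar>\<alpha> y - \<alpha> r\<bar> < \<delta>1"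
    by (rule eventually_conj)
  then obtain \<delta> where \<delta>: "0 < \<delta>" "\<And>y. y \<noteq> r \<Longrightarrow> \<bar>y - r\<bar> < \<delta> \<Longrightarrow>
      \<bar>(\<alpha> y - \<alpha> r) / (y - r)\<bar> < \<alpha>' r + x \<and> \<bar>\<alpha> y - \<alpha> r\<bar> < \<delta>1"
    unfolding eventually_at dist_real_def by blast
  show "\<exists>\<delta>>0. \<forall>r'\<in>S. \<bar>r' - r\<bar> < \<delta> \<longrightarrow>
      d (\<alpha> r) (c (\<alpha> r)) (c (\<alpha> r')) \<le> (?h * \<alpha>' r + e) * \<bar>r' - r\<bar>"
  proof (intro exI[of _ \<delta>] conjI \<delta>(1) ballI impI)
    fix y assume y: "y \<in> S" "\<bar>y - r\<bar> < \<delta>"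
    show "d (\<alpha> r) (c (\<alpha> r)) (c (\<alpha> y)) \<le> (?h * \<alpha>' r + e) * \<bar>y - r\<bar>"
    proof (cases "y = r")
      case True
      then show ?thesis by (simp add: d_self[OF \<alpha>r(2)])
    next
      case False
      have quot: "\<bar>(\<alpha> y - \<alpha> r) / (y - r)\<bar> < \<alpha>' r + x" and near: "\<bar>\<alpha> y - \<alpha> r\<bar> < \<delta>1"
        using \<delta>(2)[OF False y(2)] by auto
      have "\<bar>\<alpha> y - \<alpha> r\<bar> \<le> (\<alpha>' r + x) * \<bar>y - r\<bar>"
        using quot False by (simp add: abs_divide divide_less_eq)
      then have "(?h + x) * \<bar>\<alpha> y - \<alpha> r\<bar> \<le> (?h + x) * ((\<alpha>' r + x) * \<bar>y - r\<bar>)"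
        using x(1) h_pos[OF \<alpha>r(2), of "c (\<alpha> r)"] by (intro mult_left_mono) auto
      also have "\<dots> \<le> (?h * \<alpha>' r + e) * \<bar>y - r\<bar>"
        using x(2) by (simp only: mult.assoc[symmetric]) (intro mult_right_mono; simp)
      finally show ?thesis using \<delta>1(2)[of "\<alpha> y"] near \<alpha> y(1) by (auto simp: image_subset_iff)
    qed
  qed
qed

definition reach_bounded :: "real \<Rightarrow> 'a \<Rightarrow> real \<Rightarrow> bool" where
  "reach_bounded s0 x0 T \<longleftrightarrow> (\<exists>K. compact K \<and> (\<forall>c. timed_curve s0 T c \<longrightarrow> c s0 = x0 \<longrightarrow> c ` {s0..T} \<subseteq> K))"

lemma reach_boundedI:
  assumes "compact K" and K: "\<And>c. timed_curve s0 T c \<Longrightarrow> c s0 = x0 \<Longrightarrow> c ` {s0..T} \<subseteq> K"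
  shows "reach_bounded s0 x0 T"
  unfolding reach_bounded_def
proof (intro exI[of _ K] conjI allI impI)
  show "compact K" by fact
  show "c ` {s0..T} \<subseteq> K" if "timed_curve s0 T c" "c s0 = x0" for c using that by (rule K)
qed

lemma reach_boundedE:
  assumes "reach_bounded s0 x0 T"
  obtains K where "compact K" "\<And>c. timed_curve s0 T c \<Longrightarrow> c s0 = x0 \<Longrightarrow> c ` {s0..T} \<subseteq> K"
proof -
  obtain K where K: "compact K" and cK: "\<forall>c. timed_curve s0 T c \<longrightarrow> c s0 = x0 \<longrightarrow> c ` {s0..T} \<subseteq> K"
    using assms unfolding reach_bounded_def by (elim exE conjE)
  show thesis by (rule that[OF K cK[rule_format]])
qed

lemma reach_bounded_mono:
  assumes "reach_bounded s0 x0 T'" and T: "s0 \<le> T" "T \<le> T'" and J: "{s0..T'} \<subseteq> I"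
  shows "reach_bounded s0 x0 T"
proof -
  obtain K where K: "compact K" "\<And>c. timed_curve s0 T' c \<Longrightarrow> c s0 = x0 \<Longrightarrow> c ` {s0..T'} \<subseteq> K"
    by (rule reach_boundedE[OF assms(1)]) (rule that)
  have "c ` {s0..T} \<subseteq> K" if c: "timed_curve s0 T c" "c s0 = x0" for c
  proof -
    let ?c = "\<lambda>t. if t \<le> T then c t else c T"
    have "{T..T'} \<subseteq> I" using J T(1) by auto
    then have "timed_curve s0 T' ?c"
      by (intro timed_curve_join[OF c(1) timed_curve_const] refl T J)
    then have "?c ` {s0..T'} \<subseteq> K" using c(2) T(1) by (intro K(2)) auto
    then show ?thesis using T by (auto simp: image_subset_iff)
  qed
  with K(1) show ?thesis by (rule reach_boundedI)
qed

text \<open>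
  Every longer curve is at time \<open>T\<close> in the compact set \<open>K\<close>, and cannot go far from there in a short time.
\<close>
lemma reach_bounded_extend:
  assumes "reach_bounded s0 x0 T" and T: "s0 \<le> T" and J: "{s0..s1} \<subseteq> I"
  obtains \<eta> where "0 < \<eta>" "\<And>T'. T \<le> T' \<Longrightarrow> T' < T + \<eta> \<Longrightarrow> T' \<le> s1 \<Longrightarrow> reach_bounded s0 x0 T'"
proof -
  obtain K where K: "compact K" "\<And>c. timed_curve s0 T c \<Longrightarrow> c s0 = x0 \<Longrightarrow> c ` {s0..T} \<subseteq> K"
    by (rule reach_boundedE[OF assms(1)]) (rule that)
  obtain L \<eta> where L: "compact L" "K \<subseteq> L" "0 < \<eta>"
    "\<And>x y c. timed_curve x y c \<Longrightarrow> {x..y} \<subseteq> {s0..s1} \<Longrightarrow> x \<le> y \<Longrightarrow> y - x < \<eta> \<Longrightarrow> c x \<in> K \<Longrightarrow> c ` {x..y} \<subseteq> L"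
    by (rule timed_curve_escape[OF J K(1)]) (rule that)
  show thesis
  proof (rule that[OF L(3)])
    fix T' assume T': "T \<le> T'" "T' < T + \<eta>" "T' \<le> s1"
    have "c ` {s0..T'} \<subseteq> L" if c: "timed_curve s0 T' c" "c s0 = x0" for c
    proof -
      have 1: "c ` {s0..T} \<subseteq> K" using timed_curve_subset[OF c(1)] T' by (intro K(2) c(2)) auto
      have "timed_curve T T' c" using timed_curve_subset[OF c(1)] T by auto
      moreover have "c T \<in> K" using 1 T by auto
      ultimately have "c ` {T..T'} \<subseteq> L" using T T' by (intro L(4)) auto
      moreover have "{s0..T'} = {s0..T} \<union> {T..T'}" using T T' by auto
      ultimately show ?thesis using 1 L(2) by (simp only: image_Un) blast
    qed
    with L(1) show "reach_bounded s0 x0 T'" by (rule reach_boundedI)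
  qed
qed

text \<open>
  For every compact \<open>K\<close> some timed curve \<open>f K\<close> on \<open>[s0, T]\<close> leaves \<open>K\<close>. As \<open>K\<close> grows these curves have a
  pointwise cluster point \<open>\<beta>\<close> on \<open>[s0, T)\<close>. If \<open>\<beta>\<close> met a compact set \<open>Q\<close> at a time \<open>\<tau>\<close> very close to \<open>T\<close>,
  then arbitrarily large \<open>K\<close> would have \<open>f K\<close> near \<open>Q\<close> at time \<open>\<tau>\<close>. Such a curve is in the compact set
  \<open>R \<tau>\<close> before \<open>\<tau>\<close> and cannot escape from a compact neighbourhood of \<open>Q\<close> after \<open>\<tau>\<close>, which leaves no room to
  leave a large \<open>K\<close>.
\<close>
lemma lost_curve:
  assumes T: "s0 < T" and J: "{s0..T} \<subseteq> I" and bd: "\<And>t. s0 \<le> t \<Longrightarrow> t < T \<Longrightarrow> reach_bounded s0 x0 t"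
    and nbd: "\<not> reach_bounded s0 x0 T"
  obtains \<beta> where "\<And>t. s0 \<le> t \<Longrightarrow> t < T \<Longrightarrow> timed_curve s0 t \<beta>"
    "\<And>Q. compact Q \<Longrightarrow> \<exists>\<tau>. s0 \<le> \<tau> \<and> \<tau> < T \<and> (\<forall>t. \<tau> < t \<longrightarrow> t < T \<longrightarrow> \<beta> t \<notin> Q)"
proof -
  define f where "f K = (SOME c. timed_curve s0 T c \<and> c s0 = x0 \<and> \<not> c ` {s0..T} \<subseteq> K)" for K
  have f: "timed_curve s0 T (f K)" "f K s0 = x0" "\<not> f K ` {s0..T} \<subseteq> K" if "compact K" for K
  proof -
    have "\<exists>c. timed_curve s0 T c \<and> c s0 = x0 \<and> \<not> c ` {s0..T} \<subseteq> K"
    proof (rule ccontr)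
      assume "\<not> ?thesis"
      then have "reach_bounded s0 x0 T" by (intro reach_boundedI[OF that]) simp
      then show False using nbd by simp
    qed
    from someI_ex[OF this] show "timed_curve s0 T (f K)" "f K s0 = x0" "\<not> f K ` {s0..T} \<subseteq> K"
      unfolding f_def by simp_all
  qed
  define R where "R t = (SOME K. compact K \<and> (\<forall>c. timed_curve s0 t c \<longrightarrow> c s0 = x0 \<longrightarrow> c ` {s0..t} \<subseteq> K))" for t
  have R: "compact (R t)" "\<And>c. timed_curve s0 t c \<Longrightarrow> c s0 = x0 \<Longrightarrow> c ` {s0..t} \<subseteq> R t" if "s0 \<le> t \<and> t < T" for t
  proof -
    have "reach_bounded s0 x0 t" using bd that by simp
    from someI_ex[OF this[unfolded reach_bounded_def]]
    show "compact (R t)" "\<And>c. timed_curve s0 t c \<Longrightarrow> c s0 = x0 \<Longrightarrow> c ` {s0..t} \<subseteq> R t"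
      unfolding R_def by simp_all
  qed
  \<comment> \<open>Only the part before time \<open>T\<close> is controlled, so the curves are frozen outside \<open>[s0, T)\<close>.\<close>
  define g where "g K t = (if s0 \<le> t \<and> t < T then f K t else x0)" for K t
  define F where "F = (INF K\<in>{K::'a set. compact K}. principal {K'. compact K' \<and> K \<subseteq> K'})"
  note Fnb = compact_sets_filter(1)[where 'b = 'a, folded F_def]
  note Fev = compact_sets_filter(2)[where 'b = 'a, folded F_def]
  have fR: "f K ` {s0..t} \<subseteq> R t" if "compact K" "s0 \<le> t \<and> t < T" for K t
    using that by (intro R(2) f timed_curve_subset[OF f(1)]) auto
  have gb: "g K t \<in> (if s0 \<le> t \<and> t < T then R t else {x0})" if "compact K" for K t
  proof (cases "s0 \<le> t \<and> t < T")
    case True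
    then have "f K t \<in> f K ` {s0..t}" by simp
    then show ?thesis using fR[OF that True] True by (simp add: g_def subset_iff)
  next
    case False
    then show ?thesis unfolding g_def by (simp only: if_False) simp
  qed
  obtain \<beta> where cluster: "inf (nhds \<beta>) (filtermap g F) \<noteq> bot"
    "\<And>t. ((\<lambda>b. b t) \<longlongrightarrow> \<beta> t) (inf (nhds \<beta>) (filtermap g F))"
    "\<And>t. \<beta> t \<in> (if s0 \<le> t \<and> t < T then R t else {x0})"
  proof (rule function_box_cluster_point)
    show "compact (if s0 \<le> t \<and> t < T then R t else {x0})" for t using R(1) by simp
    show "filtermap g F \<noteq> bot" using Fnb by (simp add: filtermap_bot_iff)
    show "\<forall>\<^sub>F b in filtermap g F. \<forall>t. b t \<in> (if s0 \<le> t \<and> t < T then R t else {x0})"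
      unfolding eventually_filtermap using Fev[OF compact_empty] by eventually_elim (use gb in blast)
  qed (rule that)
  define G where "G = inf (nhds \<beta>) (filtermap g F)"
  have G: "G \<noteq> bot" "G \<le> filtermap g F" "\<And>t. ((\<lambda>b. b t) \<longlongrightarrow> \<beta> t) G"
    using cluster(1,2) by (simp_all add: G_def)
  have evG: "\<forall>\<^sub>F b in G. \<exists>K'. compact K' \<and> K \<subseteq> K' \<and> b = g K'" if "compact K" for K
  proof (rule filter_leD[OF G(2)])
    show "\<forall>\<^sub>F b in filtermap g F. \<exists>K'. compact K' \<and> K \<subseteq> K' \<and> b = g K'"
      unfolding eventually_filtermap using Fev[OF that] by eventually_elim blast
  qed
  have gcurve: "timed_curve s0 t (g K) \<and> g K ` {s0..t} \<subseteq> R t" if "compact K" "s0 \<le> t \<and> t < T" for K t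
  proof
    show "timed_curve s0 t (g K)"
      by (rule timed_curve_cong[OF timed_curve_subset[OF f(1)[OF that(1)]]]) (use that in \<open>auto simp: g_def\<close>)
    show "g K ` {s0..t} \<subseteq> R t" using fR[OF that] that by (auto simp: g_def image_subset_iff)
  qed
  have \<beta>: "timed_curve s0 t \<beta>" if t: "s0 \<le> t \<and> t < T" for t
  proof (rule timed_curve_limit[OF _ R(1)[OF t] G(1) _ G(3)])
    show "{s0..t} \<subseteq> I" using J t by auto
    show ev: "\<forall>\<^sub>F b in G. timed_curve s0 t b \<and> b ` {s0..t} \<subseteq> R t"
      using evG[OF compact_empty] by eventually_elim (use gcurve t in blast)
    show "\<beta> ` {s0..t} \<subseteq> R t"
    proof
      fix y assume "y \<in> \<beta> ` {s0..t}"
      then obtain u where u: "u \<in> {s0..t}" "y = \<beta> u" by blast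
      have "\<forall>\<^sub>F b in G. b u \<in> R t" using ev by eventually_elim (use u in auto)
      then have "\<beta> u \<in> R t"
        by (rule Lim_in_closed_set[OF compact_closed[OF R(1)[OF t]] _ G(1) G(3)])
      then show "y \<in> R t" using u by simp
    qed
  qed
  show thesis
  proof (rule that)
    show "timed_curve s0 t \<beta>" if "s0 \<le> t" "t < T" for t using \<beta> that by blast
    fix Q :: "'a set" assume Q: "compact Q"
    show "\<exists>\<tau>. s0 \<le> \<tau> \<and> \<tau> < T \<and> (\<forall>t. \<tau> < t \<longrightarrow> t < T \<longrightarrow> \<beta> t \<notin> Q)"
    proof (rule ccontr)
      assume neg: "\<not> ?thesis"
      obtain U N where N: "open U" "compact N" "Q \<subseteq> U" "U \<subseteq> N"
        by (rule compact_neighbourhood[OF Q]) (rule that)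
      obtain L \<eta> where L: "compact L" "N \<subseteq> L" "0 < \<eta>"
        "\<And>x y c. timed_curve x y c \<Longrightarrow> {x..y} \<subseteq> {s0..T} \<Longrightarrow> x \<le> y \<Longrightarrow> y - x < \<eta> \<Longrightarrow> c x \<in> N \<Longrightarrow> c ` {x..y} \<subseteq> L"
        by (rule timed_curve_escape[OF J N(2)]) (rule that)
      \<comment> \<open>After \<open>\<tau>0\<close> the remaining time is too short for an escape from \<open>N\<close> to the complement of \<open>L\<close>.\<close>
      define \<tau>0 where "\<tau>0 = max s0 (T - \<eta>)"
      have "s0 \<le> \<tau>0 \<and> \<tau>0 < T" using T L(3) by (simp add: \<tau>0_def)
      then obtain \<tau> where \<tau>: "\<tau>0 < \<tau>" "\<tau> < T" "\<beta> \<tau> \<in> Q" using neg by blast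
      then have \<tau>': "s0 \<le> \<tau> \<and> \<tau> < T" "T - \<tau> < \<eta>" by (auto simp: \<tau>0_def)
      have "\<forall>\<^sub>F b in G. b \<tau> \<in> U" using N(1,3) \<tau>(3) by (intro topological_tendstoD[OF G(3)]) auto
      moreover have "\<forall>\<^sub>F b in G. \<exists>K'. compact K' \<and> L \<union> R \<tau> \<subseteq> K' \<and> b = g K'"
        using L(1) R(1)[OF \<tau>'(1)] by (intro evG compact_Un)
      ultimately have "\<forall>\<^sub>F b in G. b \<tau> \<in> U \<and> (\<exists>K'. compact K' \<and> L \<union> R \<tau> \<subseteq> K' \<and> b = g K')"
        by (rule eventually_conj)
      from eventually_happens'[OF G(1) this]
      obtain K' where K': "compact K'" "L \<union> R \<tau> \<subseteq> K'" "g K' \<tau> \<in> U"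
        by (elim exE conjE) simp
      have "f K' \<tau> \<in> N" using K'(3) \<tau>'(1) N(4) by (auto simp: g_def)
      then have "f K' ` {\<tau>..T} \<subseteq> L"
        using \<tau>' by (intro L(4) timed_curve_subset[OF f(1)[OF K'(1)]]) auto
      moreover have "f K' ` {s0..\<tau>} \<subseteq> R \<tau>" by (rule fR[OF K'(1) \<tau>'(1)])
      moreover have "{s0..T} = {s0..\<tau>} \<union> {\<tau>..T}" using \<tau>' by auto
      ultimately have "f K' ` {s0..T} \<subseteq> K'" using K'(2) by (simp only: image_Un) blast
      then show False using f(3)[OF K'(1)] by simp
    qed
  qed
qed

end

locale divergent_cone_data = cone_data +
  assumes divergence:
      "\<And>\<alpha> \<beta>. (\<forall>T>0. abs_cont_family I d 0 T \<beta>) \<Longrightarrow> tends_to_infinity \<beta> \<Longrightarrow>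
         \<alpha> ` {0..} \<subseteq> I \<Longrightarrow> (\<forall>T>0. abs_cont dist 0 T \<alpha>) \<Longrightarrow>
         (\<integral>\<^sup>+t\<in>{0..}. (e2ennreal (gen_speed d \<beta> (\<alpha> t) t) / ennreal (h (\<alpha> t) (\<beta> t))) \<partial>lebesgue) = \<infinity>"
begin

text \<open>
  Parametrize \<open>\<beta>\<close> over \<open>[0, \<infinity>)\<close> by the time function \<open>\<alpha> r = T - (T - s0) * exp (- r)\<close>. Its generalized
  speed is at most \<open>h\<close> times \<open>\<alpha>'\<close>, so the integral that should diverge is at most that of \<open>\<alpha>'\<close>, which is
  \<open>T - s0\<close>.
\<close>
lemma no_lost_curve:
  assumes T: "s0 < T" and J: "{s0..T} \<subseteq> I" and \<beta>: "\<And>t. s0 \<le> t \<Longrightarrow> t < T \<Longrightarrow> timed_curve s0 t \<beta>"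
    and lost: "\<And>Q. compact Q \<Longrightarrow> \<exists>\<tau>. s0 \<le> \<tau> \<and> \<tau> < T \<and> (\<forall>t. \<tau> < t \<longrightarrow> t < T \<longrightarrow> \<beta> t \<notin> Q)"
  shows False
proof -
  define L where "L = T - s0"
  have L: "0 < L" using T by (simp add: L_def)
  define \<alpha> where "\<alpha> r = T - L * exp (- r)" for r
  define \<alpha>' where "\<alpha>' r = L * exp (- r)" for r
  define B where "B r = h (\<alpha> r) (\<beta> (\<alpha> r)) * \<alpha>' r" for r
  have der: "(\<alpha> has_real_derivative \<alpha>' r) (at r)" for r
    unfolding \<alpha>_def \<alpha>'_def by (auto intro!: derivative_eq_intros)
  have \<alpha>'0: "0 \<le> \<alpha>' r" for r using L by (simp add: \<alpha>'_def)
  have mono: "\<alpha> r \<le> \<alpha> r'" if "r \<le> r'" for r r' using that L by (simp add: \<alpha>_def)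
  have \<alpha>0: "\<alpha> 0 = s0" by (simp add: \<alpha>_def L_def)
  have \<alpha>T: "\<alpha> r < T" for r using L by (simp add: \<alpha>_def)
  have \<alpha>ge: "s0 \<le> \<alpha> r" if "0 \<le> r" for r using mono[OF that] \<alpha>0 by simp
  have \<alpha>I: "\<alpha> r \<in> I" if "0 \<le> r" for r using \<alpha>ge[OF that] \<alpha>T[of r] J by auto
  have cont\<alpha>: "continuous_on S \<alpha>" for S unfolding \<alpha>_def by (intro continuous_intros)
  have lim: "(\<alpha> \<longlongrightarrow> T) at_top"
  proof -
    have "((\<lambda>r. exp (- r)) \<longlongrightarrow> (0::real)) at_top"
      by (rule filterlim_compose[OF exp_at_bot filterlim_uminus_at_bot_at_top])
    then have "((\<lambda>r. T - L * exp (- r)) \<longlongrightarrow> T - L * 0) at_top" by (intro tendsto_intros)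
    then show ?thesis by (simp add: \<alpha>_def[abs_def])
  qed
  have sub: "{s0..\<alpha> b} \<subseteq> I" for b using J \<alpha>T[of b] by auto
  have sb: "speed_bound d \<alpha> (\<lambda>r. \<beta> (\<alpha> r)) {0..b} B" if b: "0 \<le> b" for b
    unfolding B_def
  proof (rule speed_bound_reparam[OF \<beta>[OF \<alpha>ge[OF b] \<alpha>T] sub _ der \<alpha>'0])
    show "\<alpha> ` {0..b} \<subseteq> {s0..\<alpha> b}" using mono \<alpha>ge by auto
  qed
  have contB: "continuous_on {0..b} B" if b: "0 \<le> b" for b
    unfolding B_def \<alpha>'_def
    using speed_bound_continuous[OF sb[OF b]] \<alpha>I by (intro continuous_intros h_continuous_on cont\<alpha>) auto
  have "(\<integral>\<^sup>+r\<in>{0..}. (e2ennreal (gen_speed d (\<lambda>r. \<beta> (\<alpha> r)) (\<alpha> r) r) / ennreal (h (\<alpha> r) (\<beta> (\<alpha> r)))) \<partial>lebesgue) = \<infinity>"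
  proof (rule divergence)
    show "\<forall>b>0. abs_cont_family I d 0 b (\<lambda>r. \<beta> (\<alpha> r))"
      unfolding abs_cont_family_def
    proof (intro allI impI ballI)
      fix b s :: real assume b: "0 < b" and s: "s \<in> I"
      show "abs_cont (d s) 0 b (\<lambda>r. \<beta> (\<alpha> r))"
        by (rule speed_bound_abs_cont[OF _ cont\<alpha> _ sb contB s]) (use b \<alpha>I in auto)
    qed
    show "tends_to_infinity (\<lambda>r. \<beta> (\<alpha> r))"
      unfolding tends_to_infinity_def
    proof (intro allI impI)
      fix Q :: "'a set" assume "compact Q"
      then obtain \<tau> where \<tau>: "s0 \<le> \<tau>" "\<tau> < T" "\<And>t. \<tau> < t \<Longrightarrow> t < T \<Longrightarrow> \<beta> t \<notin> Q" using lost by blast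
      have "\<forall>\<^sub>F r in at_top. \<tau> < \<alpha> r" using lim \<tau>(2) by (rule order_tendstoD)
      then obtain N where N: "\<And>r. N \<le> r \<Longrightarrow> \<tau> < \<alpha> r" unfolding eventually_at_top_linorder by blast
      show "\<exists>b>0. Q \<inter> (\<lambda>r. \<beta> (\<alpha> r)) ` {b..} = {}"
        by (intro exI[of _ "max N 1"]) (use N \<tau>(3) \<alpha>T in auto)
    qed
    show "\<alpha> ` {0..} \<subseteq> I" using \<alpha>I by auto
    have lip: "\<alpha> y - \<alpha> x \<le> L * (y - x)" if "0 \<le> x" "x \<le> y" for x y
    proof -
      have "exp (- x) - exp (- y) = exp (- x) * (1 - exp (- (y - x)))"
        by (simp add: algebra_simps flip: exp_add)
      also have "\<dots> \<le> 1 * (y - x)"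
      proof (rule mult_mono)
        show "1 - exp (- (y - x)) \<le> y - x" using exp_ge_add_one_self[of "- (y - x)"] by linarith
      qed (use that in auto)
      finally have "L * (exp (- x) - exp (- y)) \<le> L * (y - x)" using L by (intro mult_left_mono) auto
      then show ?thesis by (simp add: \<alpha>_def algebra_simps)
    qed
    show "\<forall>b>0. abs_cont dist 0 b \<alpha>"
      unfolding abs_cont_def
    proof (intro allI impI exI[of _ "\<lambda>_. L"] conjI)
      fix b s t :: real assume "0 < b"
      then show "set_integrable lebesgue {0..b} (\<lambda>_. L)" by (intro set_integral_const_Icc) simp
      assume st: "0 \<le> s \<and> s \<le> t \<and> t \<le> b"
      then show "dist (\<alpha> s) (\<alpha> t) \<le> (LINT u:{s..t}|lebesgue. L)"
        using lip[of s t] mono[of s t] by (simp add: set_integral_const_Icc dist_real_def)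
    qed
  qed
  moreover have "(\<integral>\<^sup>+r\<in>{0..}. (e2ennreal (gen_speed d (\<lambda>r. \<beta> (\<alpha> r)) (\<alpha> r) r) / ennreal (h (\<alpha> r) (\<beta> (\<alpha> r)))) \<partial>lebesgue)
      \<le> (\<integral>\<^sup>+r\<in>{0..}. ennreal (\<alpha>' r) \<partial>lebesgue)"
  proof (rule nn_integral_mono_AE)
    \<comment> \<open>At \<open>r = 0\<close> the generalized speed depends on the curve at negative parameters.\<close>
    show "AE r in lebesgue. (e2ennreal (gen_speed d (\<lambda>r. \<beta> (\<alpha> r)) (\<alpha> r) r) / ennreal (h (\<alpha> r) (\<beta> (\<alpha> r)))) * indicator {0..} r
      \<le> ennreal (\<alpha>' r) * indicator {0..} r"
      using AE_lebesgue_neq_real[of 0]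
    proof eventually_elim
      case (elim r)
      show ?case
      proof (cases "0 < r")
        case True
        then have b: "0 < r + 1" "0 \<le> r + 1" "r \<in> {0<..<r + 1}" by auto
        have img: "\<alpha> ` {0..r + 1} \<subseteq> I" using \<alpha>I by auto
        let ?v = "gen_speed d (\<lambda>r. \<beta> (\<alpha> r)) (\<alpha> r) r"
        have v: "0 \<le> ?v" "?v \<le> ereal (B r)"
          using gen_speed_bounds[OF b(1) cont\<alpha> img sb[OF b(2)] contB[OF b(2)] b(3)] by auto
        have hp: "0 < h (\<alpha> r) (\<beta> (\<alpha> r))" using \<alpha>I[of r] True by (intro h_pos) auto
        obtain w where w: "?v = ereal w" "0 \<le> w" "w \<le> B r" using v by (cases ?v) auto
        have "e2ennreal ?v / ennreal (h (\<alpha> r) (\<beta> (\<alpha> r))) = ennreal (w / h (\<alpha> r) (\<beta> (\<alpha> r)))"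
          unfolding w(1) e2ennreal_ereal using w(2) hp by (rule divide_ennreal)
        also have "\<dots> \<le> ennreal (\<alpha>' r)"
          using w(3) hp by (intro ennreal_leI) (simp add: B_def divide_le_eq mult.commute)
        finally show ?thesis by (simp add: indicator_def)
      qed (use elim in simp)
    qed
  qed
  moreover have "(\<integral>\<^sup>+r\<in>{0..}. ennreal (\<alpha>' r) \<partial>lebesgue) < \<infinity>"
  proof -
    have "(\<integral>\<^sup>+r\<in>{0..}. ennreal (\<alpha>' r) \<partial>lebesgue) = (\<integral>\<^sup>+r. ennreal (\<alpha>' r) * indicator {0..} r \<partial>lborel)"
      by (rule nn_integral_completion)
    also have "\<dots> = T - \<alpha> 0"
    proof (rule nn_integral_FTC_atLeast)
      show "\<alpha>' \<in> borel_measurable borel" unfolding \<alpha>'_def by measurable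
    qed (use der \<alpha>'0 lim in auto)
    also have "\<dots> < \<infinity>" by simp
    finally show ?thesis .
  qed
  ultimately show False by (simp add: top_unique)
qed

text \<open>
  The times up to which the reach is bounded form an interval. If its supremum \<open>T\<close> belongs to it, it
  can be extended beyond \<open>T\<close>; otherwise a curve is lost at \<open>T\<close>.
\<close>
lemma reach_is_bounded:
  assumes s: "s0 \<le> s1" and J: "{s0..s1} \<subseteq> I"
  shows "reach_bounded s0 x0 s1"
proof (rule ccontr)
  assume neg: "\<not> reach_bounded s0 x0 s1"
  define S where "S = {T \<in> {s0..s1}. reach_bounded s0 x0 T}"
  have "reach_bounded s0 x0 s0" by (rule reach_boundedI[of "{x0}"]) auto
  then have s0S: "s0 \<in> S" using s by (simp add: S_def)
  have bdd: "bdd_above S" by (auto simp: S_def)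
  define T where "T = Sup S"
  have T: "s0 \<le> T" unfolding T_def using s0S bdd by (rule cSup_upper)
  have T1: "T \<le> s1" unfolding T_def using s0S by (intro cSup_least) (auto simp: S_def)
  have below: "reach_bounded s0 x0 t" if t: "s0 \<le> t" "t < T" for t
  proof -
    have "S \<noteq> {}" using s0S by auto
    then obtain T' where T': "T' \<in> S" "t < T'" using t(2) less_cSupD[of S t] unfolding T_def by blast
    then have "reach_bounded s0 x0 T'" "t \<le> T'" "{s0..T'} \<subseteq> I" using J by (auto simp: S_def)
    then show ?thesis using reach_bounded_mono[OF _ t(1)] by simp
  qed
  show False
  proof (cases "reach_bounded s0 x0 T")
    case True
    obtain \<eta> where \<eta>: "0 < \<eta>" "\<And>T'. T \<le> T' \<Longrightarrow> T' < T + \<eta> \<Longrightarrow> T' \<le> s1 \<Longrightarrow> reach_bounded s0 x0 T'"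
      by (rule reach_bounded_extend[OF True T J]) (rule that)
    have Ts1: "T < s1" using True neg T1 by (cases "T = s1") auto
    define T' where "T' = min s1 (T + \<eta> / 2)"
    have "T < T'" "T' < T + \<eta>" "T' \<le> s1" using \<eta>(1) Ts1 by (auto simp: T'_def)
    then have "T' \<in> S" using \<eta>(2)[of T'] T by (auto simp: S_def)
    then have "T' \<le> T" unfolding T_def using bdd by (rule cSup_upper)
    then show False using \<open>T < T'\<close> by simp
  next
    case False
    have s0T: "s0 < T" using T False s0S by (cases "s0 = T") (auto simp: S_def)
    have JT: "{s0..T} \<subseteq> I" using J T1 by auto
    obtain \<beta> where "\<And>t. s0 \<le> t \<Longrightarrow> t < T \<Longrightarrow> timed_curve s0 t \<beta>"
      "\<And>Q. compact Q \<Longrightarrow> \<exists>\<tau>. s0 \<le> \<tau> \<and> \<tau> < T \<and> (\<forall>t. \<tau> < t \<longrightarrow> t < T \<longrightarrow> \<beta> t \<notin> Q)"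
      by (rule lost_curve[OF s0T JT _ False]) (erule (1) below, rule that)
    then show False by (rule no_lost_curve[OF s0T JT])
  qed
qed

end

section \<open>Causal diamonds and total non-imprisonment\<close>

lemma uniform_partition:
  assumes "a < (b::real)" "0 < \<delta>"
  obtains N t where "partition_points a b N t" "\<And>i. i < N \<Longrightarrow> t (Suc i) - t i < \<delta>" "\<And>i. i \<le> N \<Longrightarrow> t i \<in> {a..b}"
proof -
  obtain N :: nat where N: "(b - a) / \<delta> < real N" using reals_Archimedean2 by blast
  have Npos: "0 < real N" using N assms by (meson divide_pos_pos diff_gt_0_iff_gt order_less_trans)
  define w where "w = (b - a) / real N"
  define t where "t i = a + real i * w" for i
  have step: "t (Suc i) - t i = (b - a) / real N" for i by (simp add: t_def algebra_simps flip: w_def)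
  have pp: "partition_points a b N t"
    unfolding partition_points_def
  proof (intro conjI allI impI)
    show "t N = b" using Npos by (simp add: t_def w_def)
    have "0 < (b - a) / real N" using assms(1) Npos by simp
    then show "t i < t (Suc i)" for i using step[of i] by linarith
  qed (simp add: t_def)
  show thesis
  proof (rule that[OF pp])
    show "t (Suc i) - t i < \<delta>" for i
      unfolding step using N Npos assms by (simp add: field_simps)
    show "t i \<in> {a..b}" if "i \<le> N" for i
      using partition_points_mono[OF pp, of 0 i] partition_points_mono[OF pp, of i N] that pp
      by (auto simp: partition_points_def)
  qed
qed

context cone_data
begin

text \<open>
  The curves are frozen outside \<open>[s0, s1]\<close> so that, as functions on the whole line, they lie in a product
  of compact sets.
\<close>
definition timed_curves_between :: "real \<Rightarrow> real \<Rightarrow> 'a \<Rightarrow> 'a \<Rightarrow> (real \<Rightarrow> 'a) set" where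
  "timed_curves_between s0 s1 x0 x1 =
     {b. timed_curve s0 s1 b \<and> b s0 = x0 \<and> b s1 = x1 \<and> (\<forall>t. t \<notin> {s0..s1} \<longrightarrow> b t = x1)}"

lemma causal_diamond_eq_image:
  assumes s: "s0 \<le> s1" and J: "{s0..s1} \<subseteq> I"
  shows "causal_diamond (I \<times> UNIV) (cone_le I h d) (s0, x0) (s1, x1)
    = (\<lambda>(b, t). (t, b t)) ` (timed_curves_between s0 s1 x0 x1 \<times> {s0..s1})"
proof (intro equalityI subsetI)
  fix z assume "z \<in> causal_diamond (I \<times> UNIV) (cone_le I h d) (s0, x0) (s1, x1)"
  then have le: "cone_le I h d (s0, x0) z" "cone_le I h d z (s1, x1)" by (auto simp: causal_diamond_def)
  obtain t y where z: "z = (t, y)" by force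
  obtain b where b: "timed_curve s0 t b" "b s0 = x0" "b t = y" and t0: "s0 \<le> t"
    using le(1) unfolding z cone_le_iff by auto
  obtain c where c: "timed_curve t s1 c" "c t = y" "c s1 = x1" and t1: "t \<le> s1"
    using le(2) unfolding z cone_le_iff by auto
  \<comment> \<open>The concatenation through \<open>z\<close>, with the values outside \<open>[s0, s1]\<close> that membership requires.\<close>
  define j where "j u = (if u \<in> {s0..s1} then if u \<le> t then b u else c u else x1)" for u
  have "timed_curve s0 s1 (\<lambda>u. if u \<le> t then b u else c u)"
    using b(3) c(2) by (intro timed_curve_join[OF b(1) c(1)] t0 t1 J) simp
  then have "timed_curve s0 s1 j" by (rule timed_curve_cong) (simp add: j_def)
  moreover have "j s0 = x0" using b t0 s by (simp add: j_def)
  moreover have "j s1 = x1" using b c s t1 by (cases "s1 = t") (auto simp: j_def)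
  moreover have "j t = y" using b t0 t1 by (simp add: j_def)
  ultimately have "j \<in> timed_curves_between s0 s1 x0 x1" "z = (t, j t)"
    using z by (auto simp: timed_curves_between_def j_def)
  then show "z \<in> (\<lambda>(b, t). (t, b t)) ` (timed_curves_between s0 s1 x0 x1 \<times> {s0..s1})"
    using t0 t1 by (intro image_eqI[of _ _ "(j, t)"]) auto
next
  fix z assume "z \<in> (\<lambda>(b, t). (t, b t)) ` (timed_curves_between s0 s1 x0 x1 \<times> {s0..s1})"
  then obtain b t where b: "b \<in> timed_curves_between s0 s1 x0 x1" and t: "t \<in> {s0..s1}" and z: "z = (t, b t)"
    by auto
  have c: "timed_curve s0 s1 b" "b s0 = x0" "b s1 = x1" using b by (simp_all add: timed_curves_between_def)
  have tI: "t \<in> I" "s0 \<in> I" "s1 \<in> I" using t s J by auto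
  have "timed_curve s0 t b" "timed_curve t s1 b" using timed_curve_subset[OF c(1)] t by auto
  then show "z \<in> causal_diamond (I \<times> UNIV) (cone_le I h d) (s0, x0) (s1, x1)"
    using c(2,3) t tI unfolding z causal_diamond_def cone_le_iff by auto
qed

lemma timed_curves_between_compact:
  assumes J: "{s0..s1} \<subseteq> I" and K: "compact K"
    and CK: "\<And>b. b \<in> timed_curves_between s0 s1 x0 x1 \<Longrightarrow> b ` {s0..s1} \<subseteq> K"
  shows "compact (timed_curves_between s0 s1 x0 x1)" (is "compact ?C")
  unfolding compact_filter
proof (intro allI impI)
  fix F :: "(real \<Rightarrow> 'a) filter" assume F: "F \<noteq> bot" "\<forall>\<^sub>F b in F. b \<in> ?C"
  define B where "B t = (if t \<in> {s0..s1} then K else {x1})" for t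
  have bB: "b t \<in> B t" if "b \<in> ?C" for b t
    using CK[OF that] that by (auto simp: B_def timed_curves_between_def)
  have Bc: "compact (B t)" for t using K by (simp add: B_def)
  have "\<forall>\<^sub>F b in F. \<forall>t. b t \<in> B t" using F(2) by eventually_elim (use bB in blast)
  then obtain \<beta> where \<beta>: "inf (nhds \<beta>) F \<noteq> bot" "\<And>t. ((\<lambda>b. b t) \<longlongrightarrow> \<beta> t) (inf (nhds \<beta>) F)" "\<And>t. \<beta> t \<in> B t"
    by (rule function_box_cluster_point[OF Bc F(1)]) (rule that)
  define G where "G = inf (nhds \<beta>) F"
  have G: "G \<noteq> bot" "G \<le> F" and lim: "((\<lambda>b. b t) \<longlongrightarrow> \<beta> t) G" for t
    using \<beta>(1,2) by (simp_all add: G_def)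
  have evC: "\<forall>\<^sub>F b in G. b \<in> ?C" using G(2) F(2) by (rule filter_leD)
  have const: "\<beta> t = x" if "\<forall>\<^sub>F b in G. b t = x" for t x
  proof -
    have "\<forall>\<^sub>F b in G. b t \<in> {x}" using that by eventually_elim simp
    then have "\<beta> t \<in> {x}"
      by (rule Lim_in_closed_set[OF compact_closed[OF compact_sing] _ G(1) lim])
    then show ?thesis by simp
  qed
  have "timed_curve s0 s1 \<beta>"
  proof (rule timed_curve_limit[OF J K G(1) _ lim])
    show "\<forall>\<^sub>F b in G. timed_curve s0 s1 b \<and> b ` {s0..s1} \<subseteq> K"
      using evC by eventually_elim (use CK in \<open>simp add: timed_curves_between_def\<close>)
    show "\<beta> ` {s0..s1} \<subseteq> K"
    proof (rule image_subsetI)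
      fix t assume "t \<in> {s0..s1}"
      moreover have "\<beta> t \<in> B t" by (rule \<beta>(3))
      ultimately show "\<beta> t \<in> K" by (simp add: B_def)
    qed
  qed
  moreover have "\<beta> s0 = x0" by (rule const) (use evC in \<open>eventually_elim, simp add: timed_curves_between_def\<close>)
  moreover have "\<beta> s1 = x1" by (rule const) (use evC in \<open>eventually_elim, simp add: timed_curves_between_def\<close>)
  moreover have "\<beta> t = x1" if "t \<notin> {s0..s1}" for t
    by (rule const) (use evC in \<open>eventually_elim, use that in \<open>simp add: timed_curves_between_def\<close>\<close>)
  ultimately have "\<beta> \<in> ?C" by (simp add: timed_curves_between_def)
  then show "\<exists>\<beta>\<in>?C. inf (nhds \<beta>) F \<noteq> bot" using \<beta>(1) by blast
qed

text \<open>
  Evaluation is not jointly continuous for the topology of pointwise convergence, but it is on an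
  equi-Lipschitz set of functions.
\<close>
lemma continuous_on_evaluation:
  assumes J: "{s0..s1} \<subseteq> I" and K: "compact K"
    and CK: "\<And>b. b \<in> timed_curves_between s0 s1 x0 x1 \<Longrightarrow> b ` {s0..s1} \<subseteq> K"
  shows "continuous_on (timed_curves_between s0 s1 x0 x1 \<times> {s0..s1}) (\<lambda>(b, t). (t, b t))"
    (is "continuous_on (?C \<times> _) _")
  unfolding continuous_on_def
proof
  fix p assume "p \<in> ?C \<times> {s0..s1}"
  then obtain b0 t0 where p: "p = (b0, t0)" "b0 \<in> ?C" "t0 \<in> {s0..s1}" by auto
  have tI: "t0 \<in> I" using p J by auto
  obtain M where M: "0 < M" "\<And>s x y c. s \<in> {s0..s1} \<Longrightarrow> timed_curve x y c \<Longrightarrow> x \<le> y \<Longrightarrow> {x..y} \<subseteq> {s0..s1} \<Longrightarrow>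
      c ` {x..y} \<subseteq> K \<Longrightarrow> d s (c x) (c y) \<le> M * (y - x)"
    by (rule timed_curves_equi_lipschitz[OF J K]) (rule that)
  have lip: "d t0 (b t) (b t0) \<le> M * \<bar>t - t0\<bar>" if b: "b \<in> ?C" "t \<in> {s0..s1}" for b t
  proof -
    have bc: "timed_curve s0 s1 b" using b by (simp add: timed_curves_between_def)
    have *: "d t0 (b x) (b y) \<le> M * (y - x)" if "x \<in> {s0..s1}" "y \<in> {s0..s1}" "x \<le> y" for x y
    proof (rule M(2)[OF p(3) _ that(3)])
      show "timed_curve x y b" using timed_curve_subset[OF bc] that by auto
      show sub: "{x..y} \<subseteq> {s0..s1}" using that by auto
      show "b ` {x..y} \<subseteq> K" using CK[OF b(1)] image_mono[OF sub, of b] by (rule order_trans[rotated])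
    qed
    show ?thesis
      using *[OF b(2) p(3)] *[OF p(3) b(2)] d_sym[OF tI, of "b t" "b t0"] by (cases "t \<le> t0") auto
  qed
  let ?F = "at p within ?C \<times> {s0..s1}"
  have inC: "\<forall>\<^sub>F q in ?F. fst q \<in> ?C \<and> snd q \<in> {s0..s1}"
    unfolding eventually_at_filter by (intro always_eventually) auto
  have limt: "(snd \<longlongrightarrow> t0) ?F" and limb: "(fst \<longlongrightarrow> b0) ?F"
    using tendsto_snd[OF tendsto_ident_at, of p] tendsto_fst[OF tendsto_ident_at, of p] by (simp_all add: p(1))
  have limb0: "((\<lambda>q. fst q t0) \<longlongrightarrow> b0 t0) ?F"
  proof (rule topological_tendstoI)
    fix S assume "open S" "b0 t0 \<in> S"
    then have "open ((\<lambda>b. b t0) -` S)" "b0 \<in> (\<lambda>b. b t0) -` S"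
      by (auto intro!: open_vimage continuous_on_product_coordinates)
    from topological_tendstoD[OF limb this] show "\<forall>\<^sub>F q in ?F. fst q t0 \<in> S" by simp
  qed
  have "((\<lambda>q. fst q (snd q)) \<longlongrightarrow> b0 t0) ?F"
  proof (rule tendsto_if_d_tendsto_0[OF tI K])
    show "\<forall>\<^sub>F q in ?F. fst q (snd q) \<in> K"
      using inC by eventually_elim (use CK in \<open>auto simp: image_subset_iff\<close>)
    show "((\<lambda>q. d t0 (fst q (snd q)) (b0 t0)) \<longlongrightarrow> 0) ?F"
    proof (rule tendsto_sandwich[OF _ _ tendsto_const])
      show "\<forall>\<^sub>F q in ?F. 0 \<le> d t0 (fst q (snd q)) (b0 t0)" using d_nonneg[OF tI] by simp
      show "\<forall>\<^sub>F q in ?F. d t0 (fst q (snd q)) (b0 t0) \<le> M * \<bar>snd q - t0\<bar> + d t0 (fst q t0) (b0 t0)"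
        using inC
      proof eventually_elim
        case (elim q)
        have "d t0 (fst q (snd q)) (fst q t0) \<le> M * \<bar>snd q - t0\<bar>" using elim by (intro lip) auto
        then show ?case using d_tri[OF tI, of "fst q (snd q)" "b0 t0" "fst q t0"] by linarith
      qed
      have "((\<lambda>q. M * \<bar>snd q - t0\<bar> + d t0 (fst q t0) (b0 t0)) \<longlongrightarrow> M * \<bar>t0 - t0\<bar> + 0) ?F"
        by (intro tendsto_intros limt d_tendsto_0[OF tI] limb0)
      then show "((\<lambda>q. M * \<bar>snd q - t0\<bar> + d t0 (fst q t0) (b0 t0)) \<longlongrightarrow> 0) ?F" by simp
    qed
  qed
  then have "((\<lambda>q. (snd q, fst q (snd q))) \<longlongrightarrow> (t0, b0 t0)) ?F" using limt by (intro tendsto_Pair)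
  then show "((\<lambda>(b, t). (t, b t)) \<longlongrightarrow> (case p of (b, t) \<Rightarrow> (t, b t))) ?F"
    by (simp add: p(1) case_prod_beta')
qed

text \<open>
  Dropping the speed from the integrand leaves \<open>h * \<alpha>'\<close>.
\<close>
lemma lorentz_length_le:
  assumes fc: "future_causal_curve I h d a b \<alpha> \<beta>" and H: "\<And>t. t \<in> {a..b} \<Longrightarrow> h (\<alpha> t) (\<beta> t) \<le> H" "0 \<le> H"
  shows "lorentz_length h d a b \<alpha> \<beta> \<le> ennreal (H * (\<alpha> b - \<alpha> a))"
proof -
  note D = future_causal_curveD[OF fc]
  have int: "integrable lebesgue (\<lambda>t. indicator {a..b} t * (H * deriv \<alpha> t))"
    using abs_cont_real_derivative(1)[OF D(3,1)] unfolding set_integrable_def real_scaleR_def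
    by (simp add: mult.left_commute)
  have "lorentz_length h d a b \<alpha> \<beta> \<le> (\<integral>\<^sup>+t. ennreal (indicator {a..b} t * (H * deriv \<alpha> t)) \<partial>lebesgue)"
    unfolding lorentz_length_def
  proof (rule nn_integral_mono_AE)
    show "AE t in lebesgue. ennreal (sqrt ((h (\<alpha> t) (\<beta> t))\<^sup>2 * (deriv \<alpha> t)\<^sup>2
        - (real_of_ereal (gen_speed d \<beta> (\<alpha> t) t))\<^sup>2)) * indicator {a..b} t
      \<le> ennreal (indicator {a..b} t * (H * deriv \<alpha> t))"
      using D(5)
    proof eventually_elim
      case (elim t)
      show ?case
      proof (cases "t \<in> {a..b}")
        case True
        then have pos: "0 < deriv \<alpha> t" using elim by blast
        have hp: "0 < h (\<alpha> t) (\<beta> t)" by (rule h_pos[OF subsetD[OF D(2) imageI[OF True]]])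
        let ?x = "h (\<alpha> t) (\<beta> t) * deriv \<alpha> t"
        have "sqrt ((h (\<alpha> t) (\<beta> t))\<^sup>2 * (deriv \<alpha> t)\<^sup>2 - (real_of_ereal (gen_speed d \<beta> (\<alpha> t) t))\<^sup>2)
            \<le> sqrt (?x\<^sup>2)"
          by (rule real_sqrt_le_mono) (simp add: power_mult_distrib)
        also have "\<dots> = ?x" using pos hp by simp
        also have "\<dots> \<le> H * deriv \<alpha> t" using H(1)[OF True] pos by (intro mult_right_mono) auto
        finally show ?thesis using True by (simp add: ennreal_leI)
      qed simp
    qed
  qed
  also have "\<dots> = ennreal (LINT t|lebesgue. indicator {a..b} t * (H * deriv \<alpha> t))"
  proof (rule nn_integral_eq_integral[OF int])
    show "AE t in lebesgue. 0 \<le> indicator {a..b} t * (H * deriv \<alpha> t)"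
      using D(5) by eventually_elim (use H(2) in \<open>auto simp: indicator_def\<close>)
  qed
  also have "(LINT t|lebesgue. indicator {a..b} t * (H * deriv \<alpha> t)) = H * (LINT t:{a..b}|lebesgue. deriv \<alpha> t)"
    unfolding set_lebesgue_integral_def real_scaleR_def by (simp add: mult.left_commute)
  also have "(LINT t:{a..b}|lebesgue. deriv \<alpha> t) = \<alpha> b - \<alpha> a"
    using abs_cont_real_derivative(2)[OF D(3,1), of a b] D(1) by simp
  finally show ?thesis .
qed

text \<open>
  Let \<open>p \<le> q\<close> be points of \<open>K\<close> whose times differ by little. Every causal curve from \<open>p\<close> to \<open>q\<close>, even one
  that leaves \<open>K\<close>, stays over the compact set \<open>L\<close>, where \<open>h \<le> H\<close>; so its Lorentzian length is at most \<open>H\<close>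
  times the time difference. Along a fine partition of a causal curve in \<open>K\<close> these bounds telescope.
\<close>
lemma totally_non_imprisoning: "totally_non_imprisoning (I \<times> UNIV) (cone_le I h d) (cone_tau I h d)"
  unfolding totally_non_imprisoning_def
proof (intro allI impI)
  fix K :: "(real \<times> 'a) set" assume K: "K \<subseteq> I \<times> UNIV \<and> compact K"
  show "\<exists>C. \<forall>a b \<gamma>. causal_curve_in (cone_le I h d) K a b \<gamma> \<longrightarrow> tau_length (cone_tau I h d) a b \<gamma> \<le> ennreal C"
  proof (cases "K = {}")
    case True
    have "\<not> causal_curve_in (cone_le I h d) K a b \<gamma>" for a b \<gamma>
      unfolding causal_curve_in_def True by auto
    then show ?thesis by simp
  next
    case False
    have cJ: "compact (fst ` K)" and cX: "compact (snd ` K)"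
      using K by (auto intro!: compact_continuous_image continuous_intros)
    have Jne: "fst ` K \<noteq> {}" using False by simp
    obtain j0 where j0: "j0 \<in> fst ` K" "\<And>t. t \<in> fst ` K \<Longrightarrow> j0 \<le> t"
      using compact_attains_inf[OF cJ Jne] by blast
    obtain j1 where j1: "j1 \<in> fst ` K" "\<And>t. t \<in> fst ` K \<Longrightarrow> t \<le> j1"
      using compact_attains_sup[OF cJ Jne] by blast
    have J: "{j0..j1} \<subseteq> I" using j0(1) j1(1) K by (intro Icc_subset_I) auto
    obtain L \<eta> where L: "compact L" "snd ` K \<subseteq> L" "0 < \<eta>"
      "\<And>x y c. timed_curve x y c \<Longrightarrow> {x..y} \<subseteq> {j0..j1} \<Longrightarrow> x \<le> y \<Longrightarrow> y - x < \<eta> \<Longrightarrow> c x \<in> snd ` K \<Longrightarrow> c ` {x..y} \<subseteq> L"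
      by (rule timed_curve_escape[OF J cX]) (rule that)
    obtain H where H: "0 < H" "\<And>u x. u \<in> {j0..j1} \<Longrightarrow> x \<in> L \<Longrightarrow> h u x \<le> H"
      by (rule h_bounded[OF compact_Icc J L(1)]) (rule that)
    have short: "cone_tau I h d p q \<le> ennreal (H * (fst q - fst p))"
      if p: "p \<in> K" and q: "q \<in> K" and pq: "fst q - fst p < \<eta>" for p q
      unfolding cone_tau_def
    proof (rule Sup_least)
      fix l assume "l \<in> {lorentz_length h d a b \<alpha> \<beta> |a b \<alpha> \<beta>.
          future_causal_curve I h d a b \<alpha> \<beta> \<and> (\<alpha> a, \<beta> a) = p \<and> (\<alpha> b, \<beta> b) = q}"
      then obtain a b \<alpha> \<beta> where l: "l = lorentz_length h d a b \<alpha> \<beta>" and fc: "future_causal_curve I h d a b \<alpha> \<beta>"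
        and ends: "(\<alpha> a, \<beta> a) = p" "(\<alpha> b, \<beta> b) = q"
        by (elim CollectE exE conjE)
      obtain c where c: "timed_curve (\<alpha> a) (\<alpha> b) c" "\<And>t. t \<in> {a..b} \<Longrightarrow> c (\<alpha> t) = \<beta> t" "\<alpha> a < \<alpha> b"
          "\<alpha> ` {a..b} = {\<alpha> a..\<alpha> b}"
        by (rule causal_curve_imp_timed_curve[OF fc]) (rule that)
      have ab: "a < b" by (rule future_causal_curveD(1)[OF fc])
      have eq: "fst p = \<alpha> a" "fst q = \<alpha> b" "snd p = \<beta> a" using ends by auto
      have sub: "{\<alpha> a..\<alpha> b} \<subseteq> {j0..j1}"
        using j0(2)[OF imageI[OF p]] j1(2)[OF imageI[OF q]] eq by auto
      have "c (\<alpha> a) \<in> snd ` K" using c(2)[of a] ab eq(3) imageI[OF p, of snd] by simp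
      then have cL: "c ` {\<alpha> a..\<alpha> b} \<subseteq> L" using pq eq c(3) by (intro L(4)[OF c(1) sub]) auto
      have "h (\<alpha> t) (\<beta> t) \<le> H" if t: "t \<in> {a..b}" for t
      proof (rule H(2))
        have "\<alpha> t \<in> {\<alpha> a..\<alpha> b}" using imageI[OF t, of \<alpha>] unfolding c(4) .
        then show "\<alpha> t \<in> {j0..j1}" using sub by (rule set_mp[rotated])
        have "c (\<alpha> t) \<in> L" using \<open>\<alpha> t \<in> {\<alpha> a..\<alpha> b}\<close> cL by (simp add: image_subset_iff)
        then show "\<beta> t \<in> L" using c(2)[OF t] by simp
      qed
      then show "l \<le> ennreal (H * (fst q - fst p))"
        unfolding l eq using H(1) by (intro lorentz_length_le[OF fc]) auto
    qed
    show ?thesis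
    proof (intro exI allI impI)
      fix a b \<gamma> assume cc: "causal_curve_in (cone_le I h d) K a b \<gamma>"
      have ab: "a < b" and cont: "continuous_on {a..b} \<gamma>" and \<gamma>K: "\<gamma> ` {a..b} \<subseteq> K"
        and le: "\<And>t s. a \<le> t \<Longrightarrow> t < s \<Longrightarrow> s \<le> b \<Longrightarrow> cone_le I h d (\<gamma> t) (\<gamma> s)"
        using cc unfolding causal_curve_in_def by simp_all
      define f where "f t = fst (\<gamma> t)" for t
      have "continuous_on {a..b} f" unfolding f_def using cont by (rule continuous_on_fst)
      then have "uniformly_continuous_on {a..b} f" by (intro compact_uniformly_continuous) auto
      then obtain \<delta> where \<delta>: "0 < \<delta>" "\<And>x y. x \<in> {a..b} \<Longrightarrow> y \<in> {a..b} \<Longrightarrow> dist y x < \<delta> \<Longrightarrow> dist (f y) (f x) < \<eta>"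
        using L(3) unfolding uniformly_continuous_on_def by meson
      obtain N t where t: "partition_points a b N t" "\<And>i. i < N \<Longrightarrow> t (Suc i) - t i < \<delta>" "\<And>i. i \<le> N \<Longrightarrow> t i \<in> {a..b}"
        by (rule uniform_partition[OF ab \<delta>(1)]) (rule that)
      have step: "f (t i) \<le> f (t (Suc i))"
          "cone_tau I h d (\<gamma> (t i)) (\<gamma> (t (Suc i))) \<le> ennreal (H * (f (t (Suc i)) - f (t i)))" if i: "i < N" for i
      proof -
        have ti: "t i \<in> {a..b}" "t (Suc i) \<in> {a..b}" using t(3)[of i] t(3)[of "Suc i"] i by auto
        have lt: "t i < t (Suc i)" using t(1) i by (simp add: partition_points_def)
        show "f (t i) \<le> f (t (Suc i))"
          using le[of "t i" "t (Suc i)"] ti lt unfolding cone_le_iff by (simp add: f_def)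
        have "dist (f (t (Suc i))) (f (t i)) < \<eta>"
          using t(2)[OF i] lt by (intro \<delta>(2) ti) (simp add: dist_real_def)
        then have "fst (\<gamma> (t (Suc i))) - fst (\<gamma> (t i)) < \<eta>" by (simp add: f_def dist_real_def)
        then show "cone_tau I h d (\<gamma> (t i)) (\<gamma> (t (Suc i))) \<le> ennreal (H * (f (t (Suc i)) - f (t i)))"
          unfolding f_def using \<gamma>K ti by (intro short) (auto simp: image_subset_iff)
      qed
      have "tau_length (cone_tau I h d) a b \<gamma> \<le> (\<Sum>i<N. cone_tau I h d (\<gamma> (t i)) (\<gamma> (t (Suc i))))"
        unfolding tau_length_def
      proof (rule Inf_lower, rule CollectI)
        show "\<exists>M s. (\<Sum>i<N. cone_tau I h d (\<gamma> (t i)) (\<gamma> (t (Suc i))))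
            = (\<Sum>i<M. cone_tau I h d (\<gamma> (s i)) (\<gamma> (s (Suc i)))) \<and> partition_points a b M s"
          by (rule exI[of _ N], rule exI[of _ t], rule conjI[OF refl t(1)])
      qed
      also have "\<dots> \<le> (\<Sum>i<N. ennreal (H * (f (t (Suc i)) - f (t i))))"
        by (rule sum_mono) (use step(2) in simp)
      also have "\<dots> = ennreal (\<Sum>i<N. H * (f (t (Suc i)) - f (t i)))"
        by (rule sum_ennreal) (use step(1) H(1) in simp)
      also have "(\<Sum>i<N. H * (f (t (Suc i)) - f (t i))) = H * (f (t N) - f (t 0))"
        by (simp add: sum_distrib_left[symmetric] sum_lessThan_telescope[of "\<lambda>i. f (t i)"])
      also have "ennreal (H * (f (t N) - f (t 0))) \<le> ennreal (H * (j1 - j0))"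
      proof (rule ennreal_leI)
        have "\<gamma> (t N) \<in> K" "\<gamma> (t 0) \<in> K" using t(3)[of N] t(3)[of 0] \<gamma>K by (auto simp: image_subset_iff)
        then have "f (t N) \<le> j1" "j0 \<le> f (t 0)" using j0(2) j1(2) by (auto simp: f_def)
        then show "H * (f (t N) - f (t 0)) \<le> H * (j1 - j0)" using H(1) by simp
      qed
      finally show "tau_length (cone_tau I h d) a b \<gamma> \<le> ennreal (H * (j1 - j0))" .
    qed
  qed
qed

end

section \<open>Global hyperbolicity\<close>

lemma (in divergent_cone_data) compact_causal_diamond:
  assumes p: "fst p \<in> I" and q: "fst q \<in> I"
  shows "compact (causal_diamond (I \<times> UNIV) (cone_le I h d) p q)"
proof (cases "fst p \<le> fst q")
  case False
  have "causal_diamond (I \<times> UNIV) (cone_le I h d) p q = {}"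
  proof (rule equals0I)
    fix z assume "z \<in> causal_diamond (I \<times> UNIV) (cone_le I h d) p q"
    then have "fst p \<le> fst z" "fst z \<le> fst q" unfolding causal_diamond_def cone_le_iff by auto
    then show False using False by simp
  qed
  then show ?thesis by simp
next
  case True
  obtain s0 x0 s1 x1 where eq: "p = (s0, x0)" "q = (s1, x1)" by force
  have s: "s0 \<le> s1" and J: "{s0..s1} \<subseteq> I" using True p q Icc_subset_I unfolding eq by auto
  obtain K where K: "compact K" "\<And>c. timed_curve s0 s1 c \<Longrightarrow> c s0 = x0 \<Longrightarrow> c ` {s0..s1} \<subseteq> K"
    by (rule reach_boundedE[OF reach_is_bounded[OF s J, of x0]]) (rule that)
  have CK: "b ` {s0..s1} \<subseteq> K" if "b \<in> timed_curves_between s0 s1 x0 x1" for b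
    using that by (intro K(2)) (simp_all add: timed_curves_between_def)
  show ?thesis
    unfolding eq causal_diamond_eq_image[OF s J]
    by (intro compact_continuous_image continuous_on_evaluation[OF J K(1) CK]
        compact_Times timed_curves_between_compact[OF J K(1) CK] compact_Icc)
qed

theorem theorem1p5:
  fixes I :: "real set"
    and h :: "real \<Rightarrow> 'a::topological_space \<Rightarrow> real"
    and d :: "real \<Rightarrow> 'a \<Rightarrow> 'a \<Rightarrow> real"
  assumes X: "locally_compact_space (euclidean :: 'a topology)"
    and I: "open I" "is_interval I"
    and h_cont: "continuous_on (I \<times> UNIV) (\<lambda>(s, x). h s x)"
    and h_pos: "\<And>s x. s \<in> I \<Longrightarrow> 0 < h s x"
    and d_metric: "\<And>s. s \<in> I \<Longrightarrow> Metric_space UNIV (d s)"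
    and d_top: "\<And>s. s \<in> I \<Longrightarrow> generates_topology (length_metric (d s))"
    and d_log_lipschitz:
      "\<And>J K. compact J \<Longrightarrow> J \<subseteq> I \<Longrightarrow> compact K \<Longrightarrow>
         \<exists>C>0. \<exists>r>0. \<forall>s\<in>J. \<forall>s'\<in>J. \<forall>x\<in>K. \<forall>y\<in>K.
           x \<noteq> y \<and> (INF u\<in>J. d u x y) < r \<longrightarrow>
           \<bar>ln (d s x y / d s' x y)\<bar> \<le> C * \<bar>s - s'\<bar>"
    and h_lipschitz:
      "\<And>J K. compact J \<Longrightarrow> J \<subseteq> I \<Longrightarrow> compact K \<Longrightarrow>
         \<exists>C'>0. \<forall>s\<in>J. \<forall>s'\<in>J. \<forall>x\<in>K. \<bar>h s x - h s' x\<bar> \<le> C' * \<bar>s - s'\<bar>"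
    and divergence:
      "\<And>\<alpha> \<beta>. (\<forall>T>0. abs_cont_family I d 0 T \<beta>) \<Longrightarrow> tends_to_infinity \<beta> \<Longrightarrow>
         \<alpha> ` {0..} \<subseteq> I \<Longrightarrow> (\<forall>T>0. abs_cont dist 0 T \<alpha>) \<Longrightarrow>
         (\<integral>\<^sup>+t\<in>{0..}. (e2ennreal (gen_speed d \<beta> (\<alpha> t) t) / ennreal (h (\<alpha> t) (\<beta> t))) \<partial>lebesgue) = \<infinity>"
  shows "globally_hyperbolic (I \<times> UNIV) (cone_le I h d) (cone_tau I h d)"
proof (cases "I = {}")
  case True
  have "\<not> causal_curve_in le {} a b \<gamma>" for le a b and \<gamma> :: "real \<Rightarrow> real \<times> 'a"
    unfolding causal_curve_in_def by auto
  then have "totally_non_imprisoning ({} \<times> UNIV) (cone_le I h d) (cone_tau I h d)"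
    unfolding totally_non_imprisoning_def by simp
  then show ?thesis unfolding globally_hyperbolic_def using True by simp
next
  case False
  interpret divergent_cone_data I h d
    by (intro divergent_cone_data.intro cone_data.intro divergent_cone_data_axioms.intro)
      (fact X I False h_cont h_pos d_metric d_top d_log_lipschitz divergence)+
  show ?thesis
    unfolding globally_hyperbolic_def
  proof (intro conjI ballI)
    show "totally_non_imprisoning (I \<times> UNIV) (cone_le I h d) (cone_tau I h d)"
      by (rule totally_non_imprisoning)
    fix p q :: "real \<times> 'a" assume "p \<in> I \<times> UNIV" "q \<in> I \<times> UNIV"
    then show "compact (causal_diamond (I \<times> UNIV) (cone_le I h d) p q)"
      by (intro compact_causal_diamond) auto
  qed
qed

end
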